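(* Let $G$ be a t.d.l.c. group. Then $G$ is computably t.d.l.c. via a closed subgroup of $S_\infty$ if and only if $G$ is computably t.d.l.c. via a meet groupoid. Moreover, the equivalence is uniform: there are algorithms which, from (indices of the computable data of) a presentation of $G$ of one of these two types, produce (indices of) a presentation of $G$ of the other type.
   Context: All topological groups have a countable basis, and all t.d.l.c. (totally disconnected locally compact) groups are assumed infinite. Trees: $\mathbb N^*$ is the set of finite strings of naturals; a tree is a nonempty prefix-closed $T\subseteq\mathbb N^*$; $[T]$ is its set of infinite paths with the Baire-space topology; $[\sigma]_T=\{f\in[T]:\sigma\prec f\}$. A computable tree $T$ without leaves is computably locally compact (c.l.c.) if $[T]$ is locally compact, $\{\sigma\in T:[\sigma]_T\text{ compact}\}$ is decidable, and there is a computable $H$ such that whenever $[\sigma]_T$ is compact and $\rho\in T$ extends $\sigma$, $\rho(i)\le H(\sigma,i)$ for all $i<|\rho|$. Presentation of $S_\infty$: $\sigma\oplus\tau$ denotes the interleaving of two strings of equal length ($(\sigma\oplus\tau)(2i)=\sigma(i)$, $(\sigma\oplus\tau)(2i+1)=\tau(i)$), similarly for functions. $\mathrm{Tree}(S_\infty)$ is the set of $\sigma\oplus\tau$ with $\sigma,\tau$ injective and $\sigma(\tau(k))=k$, $\tau(\sigma(i))=i$ whenever defined; $S_\infty$ is the group of paths $h\oplus h^{-1}$ ($h$ a permutation of $\mathbb N$) with $(f_0\oplus f_1)^{-1}=f_1\oplus f_0$, $(g_0\oplus g_1)(f_0\oplus f_1)=(g_0\circ f_0)\oplus(f_1\circ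 g_1)$. For a closed subgroup $C$, $\mathrm{Tree}(C)=\{\eta\in\mathrm{Tree}(S_\infty):[\eta]\cap C\ne\emptyset\}$. $G$ is computably t.d.l.c. via a closed subgroup of $S_\infty$ if $G\cong C$ (as topological groups) for a closed subgroup $C$ of $S_\infty$ with $\mathrm{Tree}(C)$ c.l.c. Meet groupoid: $\mathcal W(G)$ has as elements the compact open cosets of $G$ (cosets of compact open subgroups) together with $\emptyset$, with operations $A\mapsto A^{-1}$, intersection $\cap$, and the partial product $A\cdot B=AB$, defined exactly when for some compact open subgroup $V$, $A$ is a left coset of $V$ and $B$ is a right coset of $V$. A copy of $\mathcal W(G)$ is a structure isomorphic to it via a bijection preserving inverse, meet and partial product (including its domain of definition); the subgroups of the copy are the elements $U$ with $U\cdot U=U$. A copy is Haar computable if its domain is a computable subset of $\mathbb N$, inverse, meet and the partial product (including whether it is defined) are computable, and the partial function $(U,V)\mapsto|U:U\cap V|$ on pairs of subgroups is computable. $G$ is computably t.d.l.c. via a meet groupoid if $\mathcal W(G)$ has a Haar computable copy.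
   Formalization: From meet groupoids to closed subgroups, uniformity is stated by one algorithm for non-compact G and, for compact G, one also given the element of the copy that denotes G; without this it fails: a meet groupoid presentation does not computably reveal whether G is compact. *)

theory Defs
  imports
    "HOL-Analysis.Analysis"
    "HOL-Algebra.Coset"
    "HOL-Library.Nat_Bijection"
    "HOL-Library.Sublist"
begin

section \<open>Partial computable functions\<close>

text \<open>
  The partial computable functions, presented as unary functions on the natural numbers: pairs
  are coded by \<^const>\<open>prod_encode\<close>, finite strings by \<^const>\<open>list_encode\<close>.  The pairing functions
  take the place of the projections of the n-ary formulation.
\<close>

datatype prog =
    Zero
  | Succ
  | First
  | Second
  | Tuple prog prog
  | Comp prog prog
  | PrimRec prog prog
  | Minimize prog

text \<open>
  Identity need not be primitive, as \<^const>\<open>prod_encode\<close> is surjective.  A search by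
  \<^const>\<open>Minimize\<close> succeeds only if all earlier values are defined (and nonzero).
\<close>

primrec run :: "prog \<Rightarrow> nat \<Rightarrow> nat option" where
  "run Zero = (\<lambda>x. Some 0)"
| "run Succ = (\<lambda>x. Some (Suc x))"
| "run First = (\<lambda>x. Some (fst (prod_decode x)))"
| "run Second = (\<lambda>x. Some (snd (prod_decode x)))"
| "run (Tuple p q) = (\<lambda>x.
     Option.bind (run p x) (\<lambda>y. Option.bind (run q x) (\<lambda>z. Some (prod_encode (y, z)))))"
| "run (Comp p q) = (\<lambda>x. Option.bind (run q x) (run p))"
| "run (PrimRec p q) = (\<lambda>x. case prod_decode x of (a, n) \<Rightarrow>
     rec_nat (run p a)
       (\<lambda>m r. Option.bind r (\<lambda>y. run q (prod_encode (a, prod_encode (m, y))))) n)"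
| "run (Minimize p) = (\<lambda>x.
     let good = (\<lambda>n. run p (prod_encode (x, n)) = Some 0 \<and>
                     (\<forall>m<n. \<exists>y. run p (prod_encode (x, m)) = Some (Suc y)))
     in if Ex good then Some (LEAST n. good n) else None)"

primrec prog_index :: "prog \<Rightarrow> nat" where
  "prog_index Zero = 0"
| "prog_index Succ = 1"
| "prog_index First = 2"
| "prog_index Second = 3"
| "prog_index (Tuple p q) = 4 + 4 * prod_encode (prog_index p, prog_index q)"
| "prog_index (Comp p q) = 5 + 4 * prod_encode (prog_index p, prog_index q)"
| "prog_index (PrimRec p q) = 6 + 4 * prod_encode (prog_index p, prog_index q)"
| "prog_index (Minimize p) = 7 + 4 * prog_index p"

lemma inj_prog_index: "inj prog_index"
proof (rule injI)
  fix p q show "prog_index p = prog_index q \<Longrightarrow> p = q"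
    by (induction p arbitrary: q; case_tac q; simp; presburger)
qed

lemma surj_prog_index: "surj prog_index"
proof -
  have "\<exists>p. prog_index p = n" for n
  proof (induction n rule: less_induct)
    case (less n)
    consider "n < 4" | m where "n = 4 + 4 * m" | m where "n = 5 + 4 * m"
      | m where "n = 6 + 4 * m" | m where "n = 7 + 4 * m"
      by atomize_elim presburger
    then show ?case
    proof cases
      case 1
      then consider "n = 0" | "n = 1" | "n = 2" | "n = 3" by linarith
      then show ?thesis by cases (metis prog_index.simps)+
    next
      case (2 m)
      obtain a b where ab: "m = prod_encode (a, b)" by (metis prod_decode_inverse surj_pair)
      have "a < n" "b < n" using 2 ab le_prod_encode_1[of a b] le_prod_encode_2[of b a] by auto
      then show ?thesis using less 2 ab by (metis prog_index.simps(5))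
    next
      case (3 m)
      obtain a b where ab: "m = prod_encode (a, b)" by (metis prod_decode_inverse surj_pair)
      have "a < n" "b < n" using 3 ab le_prod_encode_1[of a b] le_prod_encode_2[of b a] by auto
      then show ?thesis using less 3 ab by (metis prog_index.simps(6))
    next
      case (4 m)
      obtain a b where ab: "m = prod_encode (a, b)" by (metis prod_decode_inverse surj_pair)
      have "a < n" "b < n" using 4 ab le_prod_encode_1[of a b] le_prod_encode_2[of b a] by auto
      then show ?thesis using less 4 ab by (metis prog_index.simps(7))
    next
      case (5 m)
      then have "m < n" by simp
      then show ?thesis using less 5 by (metis prog_index.simps(8))
    qed
  qed
  then show ?thesis by (metis surj_def)
qed

lemma bij_prog_index: "bij prog_index"
  by (simp add: bij_def inj_prog_index surj_prog_index)

text \<open>The standard enumeration of the partial computable functions.\<close>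

definition phi :: "nat \<Rightarrow> nat \<Rightarrow> nat option" where
  "phi e = run (inv_into UNIV prog_index e)"

definition decides :: "nat \<Rightarrow> nat set \<Rightarrow> bool" where
  "decides e A \<longleftrightarrow> (\<forall>x. phi e x = Some (of_bool (x \<in> A)))"

text \<open>
  A binary partial function is computed by an index with the same domain of definition.
\<close>

definition computes2 :: "nat \<Rightarrow> (nat \<Rightarrow> nat \<Rightarrow> nat option) \<Rightarrow> bool" where
  "computes2 e f \<longleftrightarrow> (\<forall>x y. phi e (prod_encode (x, y)) = f x y)"


section \<open>Trees\<close>

text \<open>
  The topology of \<^typ>\<open>nat \<Rightarrow> nat\<close> is the library's product topology, with \<^typ>\<open>nat\<close> discrete: this
  is Baire space.
\<close>

definition is_tree :: "nat list set \<Rightarrow> bool" where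
  "is_tree S \<longleftrightarrow> S \<noteq> {} \<and> (\<forall>\<sigma>\<in>S. \<forall>\<rho>. prefix \<rho> \<sigma> \<longrightarrow> \<rho> \<in> S)"

definition leafless :: "nat list set \<Rightarrow> bool" where
  "leafless S \<longleftrightarrow> (\<forall>\<sigma>\<in>S. \<exists>\<rho>\<in>S. strict_prefix \<sigma> \<rho>)"

definition initial_of :: "nat list \<Rightarrow> (nat \<Rightarrow> nat) \<Rightarrow> bool" where
  "initial_of \<sigma> f \<longleftrightarrow> (\<forall>i<length \<sigma>. f i = \<sigma> ! i)"

definition paths :: "nat list set \<Rightarrow> (nat \<Rightarrow> nat) set" where
  "paths S = {f. \<forall>n. map f [0..<n] \<in> S}"

definition paths_through :: "nat list set \<Rightarrow> nat list \<Rightarrow> (nat \<Rightarrow> nat) set" where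
  "paths_through S \<sigma> = {f \<in> paths S. initial_of \<sigma> f}"

text \<open>The triple \<^term>\<open>(s, k, h)\<close> consists of indices for the tree, for the set of strings that
  determine a compact set of paths, and for the bound.\<close>

definition clc_tree_data :: "nat list set \<Rightarrow> nat \<times> nat \<times> nat \<Rightarrow> bool" where
  "clc_tree_data S = (\<lambda>(s, k, h).
     is_tree S \<and> leafless S \<and>
     decides s (list_encode ` S) \<and>
     locally_compact_space (top_of_set (paths S)) \<and>
     decides k (list_encode ` {\<sigma> \<in> S. compact (paths_through S \<sigma>)}) \<and>
     (\<exists>H :: nat list \<Rightarrow> nat \<Rightarrow> nat.
        (\<forall>\<sigma> i. phi h (prod_encode (list_encode \<sigma>, i)) = Some (H \<sigma> i)) \<and>
        (\<forall>\<sigma> \<rho>. compact (paths_through S \<sigma>) \<and> \<rho> \<in> S \<and> prefix \<sigma> \<rho> \<longrightarrow>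
          (\<forall>i<length \<rho>. \<rho> ! i \<le> H \<sigma> i))))"

definition clc_tree :: "nat list set \<Rightarrow> bool" where
  "clc_tree S \<longleftrightarrow> (\<exists>d. clc_tree_data S d)"


section \<open>Totally disconnected locally compact groups\<close>

definition topological_group :: "('g, 'm) monoid_scheme \<Rightarrow> 'g topology \<Rightarrow> bool" where
  "topological_group G T \<longleftrightarrow>
     group G \<and> topspace T = carrier G \<and>
     continuous_map (prod_topology T T) T (\<lambda>(x, y). x \<otimes>\<^bsub>G\<^esub> y) \<and>
     continuous_map T T (\<lambda>x. inv\<^bsub>G\<^esub> x)"

definition totally_disconnected_space :: "'a topology \<Rightarrow> bool" where
  "totally_disconnected_space T \<longleftrightarrow> (\<forall>S. connectedin T S \<longrightarrow> (\<exists>x. S \<subseteq> {x}))"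

text \<open>The Hausdorff property is a consequence of total disconnectedness.\<close>

definition tdlc_group :: "('g, 'm) monoid_scheme \<Rightarrow> 'g topology \<Rightarrow> bool" where
  "tdlc_group G T \<longleftrightarrow>
     topological_group G T \<and> second_countable T \<and>
     totally_disconnected_space T \<and> locally_compact_space T \<and>
     infinite (carrier G)"

definition topological_group_iso ::
    "('g, 'm) monoid_scheme \<Rightarrow> 'g topology \<Rightarrow> ('h, 'n) monoid_scheme \<Rightarrow> 'h topology \<Rightarrow> bool" where
  "topological_group_iso G T H U \<longleftrightarrow> (\<exists>f. f \<in> iso G H \<and> homeomorphic_map T U f)"


section \<open>Closed subgroups of the symmetric group\<close>

text \<open>On strings of equal length, interleaving is the library function \<^const>\<open>splice\<close>.\<close>

definition interleave :: "(nat \<Rightarrow> nat) \<Rightarrow> (nat \<Rightarrow> nat) \<Rightarrow> nat \<Rightarrow> nat" where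
  "interleave f g n = (if even n then f (n div 2) else g (n div 2))"

definition left_part :: "(nat \<Rightarrow> nat) \<Rightarrow> nat \<Rightarrow> nat" where
  "left_part f i = f (2 * i)"

definition right_part :: "(nat \<Rightarrow> nat) \<Rightarrow> nat \<Rightarrow> nat" where
  "right_part f i = f (2 * i + 1)"

text \<open>Strings of odd length are included as the prefixes of the interleavings, since otherwise the
  set would not be closed under prefixes.\<close>

definition Tree_Sinf :: "nat list set" where
  "Tree_Sinf = {\<eta>. \<exists>\<sigma> \<tau>. length \<sigma> = length \<tau> \<and> distinct \<sigma> \<and> distinct \<tau> \<and>
     (\<forall>k<length \<tau>. \<tau> ! k < length \<sigma> \<longrightarrow> \<sigma> ! (\<tau> ! k) = k) \<and>
     (\<forall>i<length \<sigma>. \<sigma> ! i < length \<tau> \<longrightarrow> \<tau> ! (\<sigma> ! i) = i) \<and>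
     prefix \<eta> (splice \<sigma> \<tau>)}"

definition Sinf :: "(nat \<Rightarrow> nat) monoid" where
  "Sinf = \<lparr>carrier = {interleave h (inv_into UNIV h) | h. bij h},
           mult = (\<lambda>g f. interleave (left_part g \<circ> left_part f) (right_part f \<circ> right_part g)),
           one = interleave id id\<rparr>"

definition closed_subgroup_Sinf :: "(nat \<Rightarrow> nat) set \<Rightarrow> bool" where
  "closed_subgroup_Sinf C \<longleftrightarrow> subgroup C Sinf \<and> closedin (top_of_set (carrier Sinf)) C"

definition Tree_of :: "(nat \<Rightarrow> nat) set \<Rightarrow> nat list set" where
  "Tree_of C = {\<eta> \<in> Tree_Sinf. paths_through Tree_Sinf \<eta> \<inter> C \<noteq> {}}"

definition computably_tdlc_via_closed_subgroup ::
    "('g, 'm) monoid_scheme \<Rightarrow> 'g topology \<Rightarrow> bool" where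
  "computably_tdlc_via_closed_subgroup G T \<longleftrightarrow>
     (\<exists>C. closed_subgroup_Sinf C \<and>
          topological_group_iso G T (Sinf\<lparr>carrier := C\<rparr>) (top_of_set C) \<and>
          clc_tree (Tree_of C))"

definition closed_subgroup_presentation ::
    "('g, 'm) monoid_scheme \<Rightarrow> 'g topology \<Rightarrow> nat \<Rightarrow> bool" where
  "closed_subgroup_presentation G T p \<longleftrightarrow>
     (\<exists>C s k h. p = list_encode [s, k, h] \<and>
          closed_subgroup_Sinf C \<and>
          topological_group_iso G T (Sinf\<lparr>carrier := C\<rparr>) (top_of_set C) \<and>
          clc_tree_data (Tree_of C) (s, k, h))"


section \<open>Meet groupoids\<close>

definition compact_open_subgroup ::
    "('g, 'm) monoid_scheme \<Rightarrow> 'g topology \<Rightarrow> 'g set \<Rightarrow> bool" where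
  "compact_open_subgroup G T U \<longleftrightarrow> subgroup U G \<and> compactin T U \<and> openin T U"

definition left_coset_of :: "('g, 'm) monoid_scheme \<Rightarrow> 'g set \<Rightarrow> 'g set \<Rightarrow> bool" where
  "left_coset_of G V A \<longleftrightarrow> (\<exists>a\<in>carrier G. A = a <#\<^bsub>G\<^esub> V)"

definition right_coset_of :: "('g, 'm) monoid_scheme \<Rightarrow> 'g set \<Rightarrow> 'g set \<Rightarrow> bool" where
  "right_coset_of G V A \<longleftrightarrow> (\<exists>a\<in>carrier G. A = V #>\<^bsub>G\<^esub> a)"

definition meet_groupoid :: "('g, 'm) monoid_scheme \<Rightarrow> 'g topology \<Rightarrow> 'g set set" where
  "meet_groupoid G T = insert {} {A. \<exists>V. compact_open_subgroup G T V \<and>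
     (left_coset_of G V A \<or> right_coset_of G V A)}"

definition meet_groupoid_prod ::
    "('g, 'm) monoid_scheme \<Rightarrow> 'g topology \<Rightarrow> 'g set \<Rightarrow> 'g set \<Rightarrow> 'g set option" where
  "meet_groupoid_prod G T A B =
     (if \<exists>V. compact_open_subgroup G T V \<and> left_coset_of G V A \<and> right_coset_of G V B
      then Some (A <#>\<^bsub>G\<^esub> B) else None)"

text \<open>The fields are relevant on the domain only; \<^term>\<open>None\<close> marks an undefined product.\<close>

record meet_structure =
  mdom :: "nat set"
  minv :: "nat \<Rightarrow> nat"
  mmeet :: "nat \<Rightarrow> nat \<Rightarrow> nat"
  mprod :: "nat \<Rightarrow> nat \<Rightarrow> nat option"

definition meet_groupoid_iso ::
    "('g, 'm) monoid_scheme \<Rightarrow> 'g topology \<Rightarrow> meet_structure \<Rightarrow> (nat \<Rightarrow> 'g set) \<Rightarrow> bool" where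
  "meet_groupoid_iso G T M \<theta> \<longleftrightarrow>
     bij_betw \<theta> (mdom M) (meet_groupoid G T) \<and>
     (\<forall>x\<in>mdom M. minv M x \<in> mdom M \<and> \<theta> (minv M x) = set_inv\<^bsub>G\<^esub> (\<theta> x)) \<and>
     (\<forall>x\<in>mdom M. \<forall>y\<in>mdom M. mmeet M x y \<in> mdom M \<and> \<theta> (mmeet M x y) = \<theta> x \<inter> \<theta> y) \<and>
     (\<forall>x\<in>mdom M. \<forall>y\<in>mdom M. set_option (mprod M x y) \<subseteq> mdom M \<and>
        map_option \<theta> (mprod M x y) = meet_groupoid_prod G T (\<theta> x) (\<theta> y))"

definition msubgroups :: "meet_structure \<Rightarrow> nat set" where
  "msubgroups M = {u \<in> mdom M. mprod M u u = Some u}"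

definition subgroup_index :: "('g, 'm) monoid_scheme \<Rightarrow> 'g set \<Rightarrow> 'g set \<Rightarrow> nat" where
  "subgroup_index G U W = card (rcosets\<^bsub>G\<lparr>carrier := U\<rparr>\<^esub> W)"

text \<open>The six indices are for the domain, the inverse, the meet, the domain of definition of the
  product, the product, and the subgroup index, in this order.\<close>

definition Haar_computable_data ::
    "('g, 'm) monoid_scheme \<Rightarrow> meet_structure \<Rightarrow> (nat \<Rightarrow> 'g set)
       \<Rightarrow> nat \<times> nat \<times> nat \<times> nat \<times> nat \<times> nat \<Rightarrow> bool" where
  "Haar_computable_data G M \<theta> = (\<lambda>(d, i, m, r, q, h).
     decides d (mdom M) \<and>
     (\<forall>x. phi i x = (if x \<in> mdom M then Some (minv M x) else None)) \<and>
     computes2 m (\<lambda>x y. if x \<in> mdom M \<and> y \<in> mdom M then Some (mmeet M x y) else None) \<and>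
     decides r (prod_encode ` {(x, y). x \<in> mdom M \<and> y \<in> mdom M \<and> mprod M x y \<noteq> None}) \<and>
     computes2 q (\<lambda>x y. if x \<in> mdom M \<and> y \<in> mdom M then mprod M x y else None) \<and>
     computes2 h (\<lambda>u v. if u \<in> msubgroups M \<and> v \<in> msubgroups M
                        then Some (subgroup_index G (\<theta> u) (\<theta> u \<inter> \<theta> v)) else None))"

definition computably_tdlc_via_meet_groupoid ::
    "('g, 'm) monoid_scheme \<Rightarrow> 'g topology \<Rightarrow> bool" where
  "computably_tdlc_via_meet_groupoid G T \<longleftrightarrow>
     (\<exists>M \<theta>. meet_groupoid_iso G T M \<theta> \<and> (\<exists>e. Haar_computable_data G M \<theta> e))"

definition meet_groupoid_presentation_via ::
    "('g, 'm) monoid_scheme \<Rightarrow> 'g topology \<Rightarrow> meet_structure \<Rightarrow> (nat \<Rightarrow> 'g set) \<Rightarrow> nat \<Rightarrow> bool" where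
  "meet_groupoid_presentation_via G T M \<theta> p \<longleftrightarrow>
     meet_groupoid_iso G T M \<theta> \<and>
     (\<exists>d i m r q h. p = list_encode [d, i, m, r, q, h] \<and>
        Haar_computable_data G M \<theta> (d, i, m, r, q, h))"

definition meet_groupoid_presentation ::
    "('g, 'm) monoid_scheme \<Rightarrow> 'g topology \<Rightarrow> nat \<Rightarrow> bool" where
  "meet_groupoid_presentation G T p \<longleftrightarrow> (\<exists>M \<theta>. meet_groupoid_presentation_via G T M \<theta> p)"


section \<open>Uniformity\<close>

text \<open>
  The algorithm \<^term>\<open>a\<close> translates presentations as closed subgroups into presentations by meet
  groupoids, and \<^term>\<open>b\<close> translates back if the group is not compact.  For a compact group,
  \<^term>\<open>c\<close> translates back with the help of the element of the copy that denotes the whole group.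

  This help cannot be dispensed with.  The indices of a tree tell whether the empty string
  determines a compact set, i.e. whether the group is compact.  The indices of a meet groupoid do
  not: let \<^term>\<open>e\<close> be a program, and let the domain consist of the codes of the cosets
  \<open>a + 2^k Z_2\<close> in the 2-adic rationals such that \<^term>\<open>e\<close> does not halt within \<open>max (-k) (-v(a))\<close>
  steps, where \<open>v\<close> is the valuation and \<open>a\<close> the canonical representative, together with the empty
  set.  This is a copy for a compact group \<open>2^(-s) Z_2\<close> if \<^term>\<open>e\<close> halts, and for the 2-adic
  rationals otherwise, with indices computable from \<^term>\<open>e\<close>.  Nor does compactness alone suffice:
  the bound on the tree gives nontrivial finite quotients of a compact group, but a meet groupoid
  that so far looks like that of the 3-adic integers may still turn out to be that of their
  semidirect product with \<open>{1, -1}\<close>, which has no nontrivial quotient that is a 3-group.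
\<close>

definition uniform_translations :: "'g itself \<Rightarrow> nat \<Rightarrow> nat \<Rightarrow> nat \<Rightarrow> bool" where
  "uniform_translations _ a b c \<longleftrightarrow>
     (\<forall>(G :: 'g monoid) T. tdlc_group G T \<longrightarrow>
        (\<forall>p. closed_subgroup_presentation G T p \<longrightarrow>
             (\<exists>q. phi a p = Some q \<and> meet_groupoid_presentation G T q)) \<and>
        (\<forall>q. \<not> compact_space T \<and> meet_groupoid_presentation G T q \<longrightarrow>
             (\<exists>p. phi b q = Some p \<and> closed_subgroup_presentation G T p)) \<and>
        (\<forall>M \<theta> q u. meet_groupoid_presentation_via G T M \<theta> q \<and>
             u \<in> mdom M \<and> \<theta> u = carrier G \<longrightarrow>
             (\<exists>p. phi c (prod_encode (q, u)) = Some p \<and> closed_subgroup_presentation G T p)))"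

text \<open>
  HOL cannot quantify over types below an existential quantifier, and algorithms chosen separately
  for each type of elements would not be uniform.  So the algorithms are obtained for the groups
  with elements in \<^typ>\<open>nat \<Rightarrow> nat\<close>, a type that contains a copy of every second countable t.d.l.c.
  group, and are then required to work unchanged for the groups with elements in \<^typ>\<open>'g\<close>.
\<close>

definition equivalence_uniform :: "'g itself \<Rightarrow> bool" where
  "equivalence_uniform _ \<longleftrightarrow>
     (\<exists>a b c. uniform_translations TYPE(nat \<Rightarrow> nat) a b c) \<and>
     (\<forall>a b c. uniform_translations TYPE(nat \<Rightarrow> nat) a b c \<longrightarrow> uniform_translations TYPE('g) a b c)"

end

theory Submission
  imports Defs "HOL-Library.More_List"
begin

text \<open>
  An algorithm that uses given indices only as subroutines is an oracle program; substituting the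
  indices for the oracles is an arithmetical operation on indices, so uniformity needs no universal
  program.

  For a closed subgroup, compact open sets are coded by finite lists of strings with compact sets of
  paths.  The bound on the tree turns inclusions between products of such sets into finite checks.  A
  compact open \<open>A\<close> with least code is a coset iff some (then unique) \<open>V\<close> satisfies \<open>A\<^sup>-\<^sup>1 A \<subseteq> V\<close> and
  \<open>A V \<subseteq> A\<close>, and the pairs of least codes of such \<open>A\<close> and \<open>V\<close> form the copy of the meet groupoid.

  Conversely, the group acts on a copy of its meet groupoid by left translation, faithfully and with
  closed image by van Dantzig's theorem.  As \<open>g A = B\<close> iff \<open>g \<in> B A\<^sup>-\<^sup>1\<close>, a string extends to an element of the
  image iff the meet of finitely many computable cosets is not empty.  If this meet is \<open>D\<close>, then
  \<open>g A\<close> takes exactly \<open>|V : V \<inter> A A\<^sup>-\<^sup>1|\<close> values for \<open>g\<close> in \<open>D\<close>, where \<open>V = D\<^sup>-\<^sup>1 D\<close>, so that the values can be found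
  by a search.
\<close>

section \<open>Oracle programs\<close>

text \<open>The first translation has to decide statements about all elements of compact sets. They
  become finite because the bound on the tree also limits where a product reads its factors:
  composition looks up positions that are themselves values, and the values are bounded. What is not
  computed directly, such as a least code or a list of cosets, is found by a search whose
  termination follows from compactness.

  In the second translation a string restricts the group only by its entries that concern nonempty
  cosets. One such entry is enough for the solutions to lie in a compact coset. Without any, the
  cylinder is the whole image, so that its compactness is that of the group, which the copy does not
  reveal. This single case is the reason for the hint. The values of the action on a compact coset
  could be enumerated without the index, but only their number tells when the enumeration is
  complete.\<close>

datatype oprog =
    Oracle nat
  | OZero
  | OSucc
  | OFirst
  | OSecond
  | OTuple oprog oprog
  | OComp oprog oprog
  | OPrimRec oprog oprog
  | OMinimize oprog

primrec orun :: "(nat \<Rightarrow> nat \<Rightarrow> nat option) \<Rightarrow> oprog \<Rightarrow> nat \<Rightarrow> nat option" where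
  "orun w (Oracle i) = w i"
| "orun w OZero = (\<lambda>x. Some 0)"
| "orun w OSucc = (\<lambda>x. Some (Suc x))"
| "orun w OFirst = (\<lambda>x. Some (fst (prod_decode x)))"
| "orun w OSecond = (\<lambda>x. Some (snd (prod_decode x)))"
| "orun w (OTuple p q) = (\<lambda>x.
     Option.bind (orun w p x) (\<lambda>y. Option.bind (orun w q x) (\<lambda>z. Some (prod_encode (y, z)))))"
| "orun w (OComp p q) = (\<lambda>x. Option.bind (orun w q x) (orun w p))"
| "orun w (OPrimRec p q) = (\<lambda>x. case prod_decode x of (a, n) \<Rightarrow>
     rec_nat (orun w p a)
       (\<lambda>m r. Option.bind r (\<lambda>y. orun w q (prod_encode (a, prod_encode (m, y))))) n)"
| "orun w (OMinimize p) = (\<lambda>x.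
     let good = (\<lambda>n. orun w p (prod_encode (x, n)) = Some 0 \<and>
                     (\<forall>m<n. \<exists>y. orun w p (prod_encode (x, m)) = Some (Suc y)))
     in if Ex good then Some (LEAST n. good n) else None)"

primrec instantiate :: "(nat \<Rightarrow> prog) \<Rightarrow> oprog \<Rightarrow> prog" where
  "instantiate \<rho> (Oracle i) = \<rho> i"
| "instantiate \<rho> OZero = Zero"
| "instantiate \<rho> OSucc = Succ"
| "instantiate \<rho> OFirst = First"
| "instantiate \<rho> OSecond = Second"
| "instantiate \<rho> (OTuple p q) = Tuple (instantiate \<rho> p) (instantiate \<rho> q)"
| "instantiate \<rho> (OComp p q) = Comp (instantiate \<rho> p) (instantiate \<rho> q)"
| "instantiate \<rho> (OPrimRec p q) = PrimRec (instantiate \<rho> p) (instantiate \<rho> q)"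
| "instantiate \<rho> (OMinimize p) = Minimize (instantiate \<rho> p)"

primrec instance_index :: "(nat \<Rightarrow> nat) \<Rightarrow> oprog \<Rightarrow> nat" where
  "instance_index e (Oracle i) = e i"
| "instance_index e OZero = 0"
| "instance_index e OSucc = 1"
| "instance_index e OFirst = 2"
| "instance_index e OSecond = 3"
| "instance_index e (OTuple p q) = 4 + 4 * prod_encode (instance_index e p, instance_index e q)"
| "instance_index e (OComp p q) = 5 + 4 * prod_encode (instance_index e p, instance_index e q)"
| "instance_index e (OPrimRec p q) = 6 + 4 * prod_encode (instance_index e p, instance_index e q)"
| "instance_index e (OMinimize p) = 7 + 4 * instance_index e p"

lemma run_instantiate: "run (instantiate \<rho> t) = orun (\<lambda>i. run (\<rho> i)) t"
  by (induction t) (auto simp: Let_def)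

lemma prog_index_instantiate:
  "prog_index (instantiate \<rho> t) = instance_index (\<lambda>i. prog_index (\<rho> i)) t"
  by (induction t) auto

lemma phi_prog_index [simp]: "phi (prog_index p) = run p"
  by (simp add: phi_def inj_prog_index)

text \<open>Every number is the index of some program, since \<open>prog_index\<close> is
  surjective; so arbitrary numbers \<open>e i\<close> may stand for the oracles, and the arithmetic
  on indices agrees with substitution into programs.\<close>

lemma phi_instance_index: "phi (instance_index e t) = orun (\<lambda>i. phi (e i)) t"
proof -
  define \<rho> where "\<rho> = (\<lambda>i. inv_into UNIV prog_index (e i))"
  have "prog_index (\<rho> i) = e i" for i
    unfolding \<rho>_def using surj_prog_index by (metis surj_f_inv_f)
  then have "instance_index e t = prog_index (instantiate \<rho> t)"
    by (simp add: prog_index_instantiate)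
  then have "phi (instance_index e t) = run (instantiate \<rho> t)"
    by simp
  moreover have "phi (e i) = run (\<rho> i)" for i
    by (simp add: \<rho>_def phi_def)
  ultimately show ?thesis
    by (simp add: run_instantiate)
qed


section \<open>Encodable types\<close>

text \<open>That 0 is a code makes the head and the tail of a list total on codes.\<close>

class encodable =
  fixes enc :: "'a \<Rightarrow> nat"
  assumes enc_inject: "enc x = enc y \<Longrightarrow> x = y"
    and enc_zero: "\<exists>x. enc x = 0"
begin

lemma enc_eq_iff: "enc x = enc y \<longleftrightarrow> x = y"
  using enc_inject by blast

definition default_code :: 'a where
  "default_code = (SOME x. enc x = 0)"

lemma enc_default_code [simp]: "enc default_code = 0"
  unfolding default_code_def using someI_ex[OF enc_zero] .

end

instantiation nat :: encodable
begin
definition enc_nat :: "nat \<Rightarrow> nat" where [simp]: "enc_nat n = n"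
instance by standard auto
end

instantiation bool :: encodable
begin
definition enc_bool :: "bool \<Rightarrow> nat" where [simp]: "enc_bool b = of_bool b"
instance by standard (auto simp: of_bool_def split: if_splits)
end

instantiation prod :: (encodable, encodable) encodable
begin
definition enc_prod :: "'a \<times> 'b \<Rightarrow> nat" where "enc_prod p = prod_encode (enc (fst p), enc (snd p))"
instance
proof
  show "x = y" if "enc x = enc y" for x y :: "'a \<times> 'b"
    using that by (auto simp: enc_prod_def enc_eq_iff prod_eq_iff)
  show "\<exists>x :: 'a \<times> 'b. enc x = 0"
    by (rule exI[of _ "(default_code, default_code)"]) (simp add: enc_prod_def prod_encode_def)
qed
end

instantiation list :: (encodable) encodable
begin
definition enc_list :: "'a list \<Rightarrow> nat" where "enc_list l = list_encode (map enc l)"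
instance
proof
  show "x = y" if "enc x = enc y" for x y :: "'a list"
    using that by (auto simp: enc_list_def list_encode_eq enc_eq_iff inj_on_def dest: map_injective)
  show "\<exists>x :: 'a list. enc x = 0"
    by (rule exI[of _ "[]"]) (simp add: enc_list_def)
qed
end

lemma enc_Pair: "enc (a, b) = prod_encode (enc a, enc b)"
  by (simp add: enc_prod_def)

lemma enc_Nil [simp]: "enc [] = 0"
  by (simp add: enc_list_def)

lemma enc_Cons: "enc (x # xs) = Suc (enc (x, xs))"
  by (simp add: enc_list_def enc_Pair)

lemma enc_nat_list [simp]: "enc (l :: nat list) = list_encode l"
  by (simp add: enc_list_def map_idI)

lemma prod_decode_enc: "prod_decode (enc p) = (enc (fst p), enc (snd p))"
  by (simp add: enc_prod_def)

text \<open>A fold cannot compute the length of its list beforehand; it runs as many steps as the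
  code says, which by this bound is enough.\<close>

lemma length_le_enc: "length l \<le> enc l"
proof (induction l)
  case (Cons x xs)
  have "enc xs \<le> enc (x, xs)" by (simp add: enc_Pair le_prod_encode_2)
  with Cons show ?case by (simp add: enc_Cons)
qed simp


section \<open>Uniformly computable functions\<close>

text \<open>A family consists of the admissible pairs of a context and the oracles that it provides.  The
  program must not depend on the context; the context may still be an arbitrary mathematical
  object.\<close>

type_synonym 'c family = "('c \<times> (nat \<Rightarrow> nat \<Rightarrow> nat option)) set"

text \<open>Functions in this sense are total. Partial functions enter as oracles behind a guard
  (\<open>computable_oracle\<close>) and leave through \<open>computable_partial\<close>.\<close>

definition computable :: "'c family \<Rightarrow> ('c \<Rightarrow> 'a::encodable \<Rightarrow> 'b::encodable) \<Rightarrow> bool" where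
  "computable F f \<longleftrightarrow> (\<exists>t. \<forall>(c, w)\<in>F. \<forall>x. orun w t (enc x) = Some (enc (f c x)))"

named_theorems computable_intros

lemma computableI:
  assumes "\<And>c w x. (c, w) \<in> F \<Longrightarrow> orun w t (enc x) = Some (enc (f c x))"
  shows "computable F f"
  unfolding computable_def using assms by blast

lemma computableE:
  assumes "computable F f"
  obtains t where "\<And>c w x. (c, w) \<in> F \<Longrightarrow> orun w t (enc x) = Some (enc (f c x))"
  using assms unfolding computable_def by blast

text \<open>The codes have to agree, not the values, so the type of the result may change.
  Conversions from truth values to numbers or from strings to their codes thus cost nothing.\<close>

lemma computable_cong:
  assumes "computable F f" "\<And>c w x. (c, w) \<in> F \<Longrightarrow> enc (f c x) = enc (g c x)"
  shows "computable F g"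
proof -
  obtain t where "\<And>c w x. (c, w) \<in> F \<Longrightarrow> orun w t (enc x) = Some (enc (f c x))"
    using assms(1) by (rule computableE) blast
  with assms(2) show ?thesis by (intro computableI[where t=t]) simp
qed

lemma computable_id [computable_intros]: "computable F (\<lambda>c x. x)"
  by (rule computableI[where t="OTuple OFirst OSecond"]) simp

lemma computable_const [computable_intros]: "computable F (\<lambda>c x. k)"
proof -
  have "\<exists>t. \<forall>w x. orun w t x = Some n" for n
  proof (induction n)
    case 0
    show ?case by (rule exI[of _ OZero]) simp
  next
    case (Suc n)
    then obtain t where "\<forall>w x. orun w t x = Some n" by blast
    then show ?case by (intro exI[of _ "OComp OSucc t"]) simp
  qed
  then obtain t where "\<And>w x. orun w t x = Some (enc k)" by blast
  then show ?thesis by (intro computableI[where t=t])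
qed

lemma computable_comp:
  assumes "computable F f" "computable F g"
  shows "computable F (\<lambda>c x. f c (g c x))"
proof -
  obtain s where "\<And>c w x. (c, w) \<in> F \<Longrightarrow> orun w s (enc x) = Some (enc (f c x))"
    using assms(1) by (rule computableE) blast
  moreover obtain t where "\<And>c w x. (c, w) \<in> F \<Longrightarrow> orun w t (enc x) = Some (enc (g c x))"
    using assms(2) by (rule computableE) blast
  ultimately show ?thesis by (intro computableI[where t="OComp s t"]) simp
qed

lemma computable_Pair [computable_intros]:
  assumes "computable F f" "computable F g"
  shows "computable F (\<lambda>c x. (f c x, g c x))"
proof -
  obtain s where "\<And>c w x. (c, w) \<in> F \<Longrightarrow> orun w s (enc x) = Some (enc (f c x))"
    using assms(1) by (rule computableE) blast
  moreover obtain t where "\<And>c w x. (c, w) \<in> F \<Longrightarrow> orun w t (enc x) = Some (enc (g c x))"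
    using assms(2) by (rule computableE) blast
  ultimately show ?thesis by (intro computableI[where t="OTuple s t"]) (simp add: enc_Pair)
qed

lemma computable_fst [computable_intros]:
  assumes "computable F f"
  shows "computable F (\<lambda>c x. fst (f c x))"
proof -
  have "computable F (\<lambda>c x. fst x)"
    by (rule computableI[where t=OFirst]) (simp add: prod_decode_enc)
  from computable_comp[OF this assms] show ?thesis .
qed

lemma computable_snd [computable_intros]:
  assumes "computable F f"
  shows "computable F (\<lambda>c x. snd (f c x))"
proof -
  have "computable F (\<lambda>c x. snd x)"
    by (rule computableI[where t=OSecond]) (simp add: prod_decode_enc)
  from computable_comp[OF this assms] show ?thesis .
qed

lemma computable_comp2:
  assumes "computable F (\<lambda>c z. f c (fst z) (snd z))" "computable F g" "computable F h"
  shows "computable F (\<lambda>c x. f c (g c x) (h c x))"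
  using computable_comp[OF assms(1) computable_Pair[OF assms(2,3)]] by simp

lemma computable_comp3:
  assumes "computable F (\<lambda>c z. f c (fst z) (fst (snd z)) (snd (snd z)))"
    "computable F g" "computable F h" "computable F k"
  shows "computable F (\<lambda>c x. f c (g c x) (h c x) (k c x))"
  using computable_comp[OF assms(1) computable_Pair[OF assms(2) computable_Pair[OF assms(3,4)]]]
  by simp

lemma computable_enc [computable_intros]:
  assumes "computable F f" shows "computable F (\<lambda>c x. enc (f c x))"
  using assms by (rule computable_cong) simp

lemma computable_Suc [computable_intros]:
  assumes "computable F f"
  shows "computable F (\<lambda>c x. Suc (f c x))"
proof -
  have "computable F (\<lambda>c x. Suc x)"
    by (rule computableI[where t=OSucc]) simp
  from computable_comp[OF this assms] show ?thesis .
qed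

lemma computable_rec_nat [computable_intros]:
  assumes "computable F f" "computable F (\<lambda>c z. g c (fst z) (fst (snd z)) (snd (snd z)))" "computable F h"
  shows "computable F (\<lambda>c x. rec_nat (f c x) (\<lambda>n y. g c x n y) (h c x))"
proof -
  obtain s where s: "\<And>c w x. (c, w) \<in> F \<Longrightarrow> orun w s (enc x) = Some (enc (f c x))"
    using assms(1) by (rule computableE) blast
  obtain t where t: "\<And>c w z. (c, w) \<in> F \<Longrightarrow>
      orun w t (enc z) = Some (enc (g c (fst z) (fst (snd z)) (snd (snd z))))"
    using assms(2) by (rule computableE) blast
  have *: "rec_nat (orun w s (enc x))
       (\<lambda>m r. Option.bind r (\<lambda>y. orun w t (prod_encode (enc x, prod_encode (m, y))))) n =
       Some (enc (rec_nat (f c x) (\<lambda>n y. g c x n y) n))" if "(c, w) \<in> F" for c w x n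
  proof (induction n)
    case (Suc n)
    then show ?case
      using t[OF that, of "(x, n, rec_nat (f c x) (\<lambda>n y. g c x n y) n)"] by (simp add: enc_Pair)
  qed (simp add: s[OF that])
  have "computable F (\<lambda>c z. rec_nat (f c (fst z)) (\<lambda>n y. g c (fst z) n y) (snd z))"
    by (rule computableI[where t="OPrimRec s t"]) (simp add: prod_decode_enc *)
  from computable_comp[OF this computable_Pair[OF computable_id assms(3)]] show ?thesis by simp
qed

lemma computable_If [computable_intros]:
  assumes "computable F P" "computable F f" "computable F g"
  shows "computable F (\<lambda>c x. if P c x then f c x else g c x)"
proof -
  have "computable F (\<lambda>c x. of_bool (P c x) :: nat)"
    using assms(1) by (rule computable_cong) simp
  \<comment> \<open>Recursion on the truth value as 0 or 1. The recursion step receives input,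
    counter and previous value, so \<open>f\<close> is composed with the projection to the
    input.\<close>
  then have "computable F (\<lambda>c x. rec_nat (g c x) (\<lambda>n y. f c x) (of_bool (P c x)))"
    using computable_comp[OF assms(2) computable_fst[OF computable_id]]
    by (intro computable_rec_nat assms) auto
  then show ?thesis by (rule computable_cong) simp
qed

text \<open>The guard is evaluated first, so the oracle need not be defined where the guard fails.\<close>

lemma computable_oracle:
  fixes P :: "'c \<Rightarrow> 'a::encodable \<Rightarrow> bool"
  assumes P: "computable F P" and g: "computable F g"
    and w: "\<And>c w x. (c, w) \<in> F \<Longrightarrow> P c x \<Longrightarrow> w i (enc (g c x)) = Some (enc (f c x))"
  shows "computable F (\<lambda>c x. if P c x then f c x else d)"
proof -
  obtain r where r: "\<And>c w x. (c, w) \<in> F \<Longrightarrow> orun w r (enc x) = Some (enc (P c x))"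
    using P by (rule computableE) blast
  obtain s where s: "\<And>c w x. (c, w) \<in> F \<Longrightarrow> orun w s (enc x) = Some (enc (g c x))"
    using g by (rule computableE) blast
  obtain t where "\<And>c w x. (c, w) \<in> F \<Longrightarrow> orun w t (enc (x :: 'a)) = Some (enc d)"
    using computable_const by (rule computableE) blast
  then show ?thesis
    \<comment> \<open>Recursion on the truth value of the guard: the oracle sits in the recursion
      step, which runs once if the guard is 1 and not at all if it is 0.\<close>
    by (intro computableI[where t="OComp (OPrimRec t (OComp (Oracle i) (OComp s OFirst)))
        (OTuple (OTuple OFirst OSecond) r)"]) (simp add: r s w)
qed

lemma computable_Not [computable_intros]:
  assumes "computable F P" shows "computable F (\<lambda>c x. \<not> P c x)"
proof -
  have "computable F (\<lambda>c x. if P c x then False else True)"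
    by (intro computable_intros assms)
  then show ?thesis by (rule computable_cong) simp
qed

lemma computable_conj [computable_intros]:
  assumes "computable F P" "computable F Q" shows "computable F (\<lambda>c x. P c x \<and> Q c x)"
proof -
  have "computable F (\<lambda>c x. if P c x then Q c x else False)"
    by (intro computable_intros assms)
  then show ?thesis by (rule computable_cong) simp
qed

lemma computable_imp [computable_intros]:
  assumes "computable F P" "computable F Q" shows "computable F (\<lambda>c x. P c x \<longrightarrow> Q c x)"
proof -
  have "computable F (\<lambda>c x. if P c x then Q c x else True)"
    by (intro computable_intros assms)
  then show ?thesis by (rule computable_cong) simp
qed

text \<open>A search looks for the value 0, the code of \<open>False\<close>; hence the program
  decides the negation. The witness must exist for every input. For this reason later definitions by
  \<open>LEAST\<close> carry their domain condition as a premise inside: outside the domain the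
  search stops at 0.\<close>

lemma computable_Least [computable_intros]:
  fixes P :: "'c \<Rightarrow> 'a::encodable \<Rightarrow> nat \<Rightarrow> bool"
  assumes "computable F (\<lambda>c z. P c (fst z) (snd z))"
    and ex: "\<And>c w x. (c, w) \<in> F \<Longrightarrow> \<exists>n. P c x n"
  shows "computable F (\<lambda>c x. LEAST n. P c x n)"
proof -
  have "computable F (\<lambda>c z. \<not> P c (fst z) (snd z))"
    by (rule computable_Not) (rule assms)
  then obtain t where
    t: "\<And>c w z. (c, w) \<in> F \<Longrightarrow> orun w t (enc z) = Some (enc (\<not> P c (fst z) (snd z)))"
    by (rule computableE) (rule that)
  show ?thesis
  proof (rule computableI[where t="OMinimize t"])
    fix c w and x :: 'a
    assume c: "(c, w) \<in> F"
    have t': "orun w t (prod_encode (enc x, n)) = Some (of_bool (\<not> P c x n))" for n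
      using t[OF c, of "(x, n)"] by (simp add: enc_Pair)
    define m where "m = (LEAST n. P c x n)"
    have m: "P c x m" "\<And>k. k < m \<Longrightarrow> \<not> P c x k"
      using LeastI_ex[OF ex[OF c]] not_less_Least by (auto simp: m_def)
    have good: "P c x n \<and> (\<forall>k. P c x k \<longrightarrow> \<not> k < n) \<longleftrightarrow> n = m" for n
      using m by (metis linorder_neqE_nat)
    show "orun w (OMinimize t) (enc x) = Some (enc (LEAST n. P c x n))"
      by (simp add: t' good Let_def flip: m_def) (rule Least_equality, auto)
  qed
qed


subsection \<open>Arithmetic\<close>

lemma computable_add [computable_intros]:
  fixes f g :: "'c \<Rightarrow> 'a::encodable \<Rightarrow> nat"
  assumes "computable F f" "computable F g" shows "computable F (\<lambda>c x. f c x + g c x)"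
proof -
  have "computable F (\<lambda>c z. rec_nat (fst z) (\<lambda>n y. Suc y) (snd z))"
    by (intro computable_intros)
  moreover have "rec_nat (fst z) (\<lambda>n y. Suc y) (snd z) = fst z + snd z" for z
    by (induction "snd z" arbitrary: z) (simp, metis add_Suc_right fst_conv old.nat.simps(7) snd_conv)
  ultimately have "computable F (\<lambda>c z. fst z + snd z :: nat)" by simp
  from computable_comp[OF this computable_Pair[OF assms]] show ?thesis by simp
qed

lemma computable_mult [computable_intros]:
  fixes f g :: "'c \<Rightarrow> 'a::encodable \<Rightarrow> nat"
  assumes "computable F f" "computable F g" shows "computable F (\<lambda>c x. f c x * g c x)"
proof -
  have "computable F (\<lambda>c z. rec_nat 0 (\<lambda>n y. y + fst z) (snd z) :: nat)"
    by (intro computable_intros)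
  moreover have "rec_nat 0 (\<lambda>n y. y + a) b = a * b" for a b :: nat
    by (induction b) auto
  ultimately have "computable F (\<lambda>c z. fst z * snd z :: nat)" by simp
  from computable_comp[OF this computable_Pair[OF assms]] show ?thesis by simp
qed

lemma computable_diff [computable_intros]:
  fixes f g :: "'c \<Rightarrow> 'a::encodable \<Rightarrow> nat"
  assumes "computable F f" "computable F g" shows "computable F (\<lambda>c x. f c x - g c x)"
proof -
  have "computable F (\<lambda>c z. rec_nat (fst z) (\<lambda>n y. rec_nat 0 (\<lambda>m _. m) y) (snd z))"
    by (intro computable_intros)
  moreover have "rec_nat 0 (\<lambda>m _. m) y = y - 1" for y :: nat
    by (cases y) auto
  moreover have "rec_nat a (\<lambda>n y. y - 1) b = a - b" for a b :: nat
    by (induction b) auto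
  ultimately have "computable F (\<lambda>c z. fst z - snd z :: nat)" by simp
  from computable_comp[OF this computable_Pair[OF assms]] show ?thesis by simp
qed

text \<open>Both truncated differences of the codes vanish only if the codes agree, and codes are
  injective. So equality is decidable on every encodable type.\<close>

lemma computable_eq [computable_intros]:
  fixes f g :: "'c \<Rightarrow> 'a::encodable \<Rightarrow> 'b::encodable"
  assumes "computable F f" "computable F g" shows "computable F (\<lambda>c x. f c x = g c x)"
proof -
  have zero: "computable F (\<lambda>c n. n = (0 :: nat))"
  proof -
    have "computable F (\<lambda>c n :: nat. rec_nat True (\<lambda>m _. False) n)"
      by (intro computable_intros)
    moreover have "rec_nat True (\<lambda>m _. False) n = (n = 0)" for n :: nat
      by (cases n) auto
    ultimately show ?thesis by simp
  qed
  have "computable F (\<lambda>c x. (enc (f c x) - enc (g c x)) + (enc (g c x) - enc (f c x)))"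
    by (intro computable_intros assms)
  from computable_comp[OF zero this]
  have "computable F (\<lambda>c x. (enc (f c x) - enc (g c x)) + (enc (g c x) - enc (f c x)) = 0)" .
  moreover have "(enc a - enc b) + (enc b - enc a) = 0 \<longleftrightarrow> a = b" for a b :: 'b
    using enc_eq_iff[of a b] by linarith
  ultimately show ?thesis by simp
qed

lemma computable_le [computable_intros]:
  fixes f g :: "'c \<Rightarrow> 'a::encodable \<Rightarrow> nat"
  assumes "computable F f" "computable F g" shows "computable F (\<lambda>c x. f c x \<le> g c x)"
proof -
  have "computable F (\<lambda>c x. f c x - g c x = 0)"
    by (intro computable_intros assms)
  then show ?thesis by (rule computable_cong) simp
qed

lemma computable_less [computable_intros]:
  fixes f g :: "'c \<Rightarrow> 'a::encodable \<Rightarrow> nat"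
  assumes "computable F f" "computable F g" shows "computable F (\<lambda>c x. f c x < g c x)"
proof -
  have "computable F (\<lambda>c x. Suc (f c x) \<le> g c x)"
    by (intro computable_intros assms)
  then show ?thesis by (rule computable_cong) auto
qed

lemma computable_div2 [computable_intros]:
  fixes f :: "'c \<Rightarrow> 'a::encodable \<Rightarrow> nat"
  assumes "computable F f" shows "computable F (\<lambda>c x. f c x div 2)"
proof -
  have "computable F (\<lambda>c n. LEAST m. n < 2 * m + (2 :: nat))"
    by (intro computable_intros) presburger
  moreover have "(LEAST m. n < 2 * m + 2) = n div 2" for n :: nat
    by (rule Least_equality) auto
  ultimately have "computable F (\<lambda>c n. n div 2 :: nat)" by simp
  from computable_comp[OF this assms] show ?thesis .
qed

lemma computable_even [computable_intros]:
  fixes f :: "'c \<Rightarrow> 'a::encodable \<Rightarrow> nat"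
  assumes "computable F f" shows "computable F (\<lambda>c x. even (f c x))"
proof -
  have "computable F (\<lambda>c x. 2 * (f c x div 2) = f c x)"
    by (intro computable_intros assms)
  then show ?thesis by (rule computable_cong) (simp, presburger)
qed

lemma computable_prod_encode [computable_intros]:
  assumes "computable F f" "computable F g"
  shows "computable F (\<lambda>c x. prod_encode (f c x, g c x))"
  using computable_Pair[OF assms] by (rule computable_cong) (simp add: enc_Pair)

lemma computable_list_encode [computable_intros]:
  assumes "computable F f" shows "computable F (\<lambda>c x. list_encode (f c x))"
  using assms by (rule computable_cong) simp

lemma computable_list_decode [computable_intros]:
  assumes "computable F f" shows "computable F (\<lambda>c x. list_decode (f c x))"
  using assms by (rule computable_cong) simp

lemma computable_prod_decode [computable_intros]:
  assumes "computable F f" shows "computable F (\<lambda>c x. prod_decode (f c x))"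
  using assms by (rule computable_cong) (simp add: enc_prod_def)


subsection \<open>Lists\<close>

lemma computable_Cons [computable_intros]:
  assumes "computable F f" "computable F g"
  shows "computable F (\<lambda>c x. f c x # g c x)"
proof -
  have "computable F (\<lambda>c x. Suc (enc (f c x, g c x)))"
    by (intro computable_intros assms)
  then show ?thesis by (rule computable_cong) (simp add: enc_Cons)
qed

lemma prod_decode_0 [simp]: "prod_decode 0 = (0, 0)"
  using prod_encode_inverse[of "(0, 0)"] by (simp add: prod_encode_def)

text \<open>No case distinction: the code 0 of the empty list stays 0 under truncated subtraction
  and decodes to \<open>(0, 0)\<close>, whose second component is again the code of the empty
  list.\<close>

lemma computable_tl [computable_intros]:
  fixes f :: "'c \<Rightarrow> 'a::encodable \<Rightarrow> 'b::encodable list"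
  assumes "computable F f" shows "computable F (\<lambda>c x. tl (f c x))"
proof -
  have *: "computable F (\<lambda>c x. snd (prod_decode (enc (f c x) - 1)))"
    by (intro computable_intros assms)
  have "snd (prod_decode (enc l - 1)) = enc (tl l)" for l :: "'b list"
    by (cases l) (auto simp: enc_Cons enc_Pair)
  then show ?thesis by (intro computable_cong[OF *]) simp
qed

definition hd_default :: "'a::encodable list \<Rightarrow> 'a" where
  "hd_default l = (if l = [] then default_code else hd l)"

lemma computable_hd_default:
  fixes f :: "'c \<Rightarrow> 'a::encodable \<Rightarrow> 'b::encodable list"
  assumes "computable F f" shows "computable F (\<lambda>c x. hd_default (f c x))"
proof -
  have *: "computable F (\<lambda>c x. fst (prod_decode (enc (f c x) - 1)))"
    by (intro computable_intros assms)
  have "fst (prod_decode (enc l - 1)) = enc (hd_default l)" for l :: "'b list"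
    by (cases l) (auto simp: enc_Cons enc_Pair hd_default_def)
  then show ?thesis by (intro computable_cong[OF *]) simp
qed

text \<open>The pair of remaining list and accumulator is iterated. Once the list is exhausted the
  step is the identity, so any number of steps beyond the length gives the same result; the code of
  the list is such a number.\<close>

lemma computable_fold [computable_intros]:
  assumes l: "computable F l"
    and f: "computable F (\<lambda>c z. f c (fst z) (fst (snd z)) (snd (snd z)))" and a: "computable F a"
  shows "computable F (\<lambda>c x. fold (\<lambda>y b. f c x y b) (l c x) (a c x))"
proof -
  define step where
    "step c x p = (if fst p = [] then p else (tl (fst p), f c x (hd_default (fst p)) (snd p)))" for c x p
  have "computable F (\<lambda>c x. snd (rec_nat (l c x, a c x) (\<lambda>n p. step c x p) (enc (l c x))))"
    unfolding step_def
    by (intro computable_intros a l computable_comp3[OF f] computable_hd_default)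
  moreover have "snd (rec_nat (l c x, a c x) (\<lambda>n p. step c x p) (enc (l c x))) =
    fold (\<lambda>y b. f c x y b) (l c x) (a c x)" for c x
  proof -
    \<comment> \<open>\<open>rec_nat\<close> adds a step at the end, whereas the list is consumed
      from its front; so the first step has to be split off.\<close>
    have shift: "rec_nat (step c x p) (\<lambda>n. step c x) n = step c x (rec_nat p (\<lambda>n. step c x) n)" for p n
      by (induction n) auto
    have "rec_nat (m, b) (\<lambda>n. step c x) n = ([], fold (\<lambda>y b. f c x y b) m b)"
      if "length m \<le> n" for m b n
      using that
    proof (induction m arbitrary: b n)
      case Nil
      show ?case by (induction n) (auto simp: step_def)
    next
      case (Cons y m)
      then obtain k where k: "n = Suc k" "length m \<le> k" by (cases n) auto
      have "rec_nat (y # m, b) (\<lambda>n. step c x) n =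
          rec_nat (step c x (y # m, b)) (\<lambda>n. step c x) k"
        unfolding shift k by simp
      also have "\<dots> = ([], fold (\<lambda>y b. f c x y b) (y # m) b)"
        by (simp add: step_def hd_default_def Cons.IH[OF k(2)])
      finally show ?case .
    qed
    then show ?thesis by (simp add: length_le_enc)
  qed
  ultimately show ?thesis by simp
qed

lemma computable_rev [computable_intros]:
  assumes "computable F f" shows "computable F (\<lambda>c x. rev (f c x))"
proof -
  have "computable F (\<lambda>c x. fold (\<lambda>y b. y # b) (f c x) [])"
    by (intro computable_intros assms)
  then show ?thesis by (rule computable_cong) (simp add: fold_Cons_rev)
qed

lemma computable_foldr [computable_intros]:
  assumes l: "computable F l"
    and f: "computable F (\<lambda>c z. f c (fst z) (fst (snd z)) (snd (snd z)))" and a: "computable F a"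
  shows "computable F (\<lambda>c x. foldr (\<lambda>y b. f c x y b) (l c x) (a c x))"
proof -
  have "computable F (\<lambda>c x. fold (\<lambda>y b. f c x y b) (rev (l c x)) (a c x))"
    by (intro computable_intros l a f)
  then show ?thesis unfolding foldr_conv_fold .
qed

lemma computable_append [computable_intros]:
  fixes f g :: "'c \<Rightarrow> 'a::encodable \<Rightarrow> 'b::encodable list"
  assumes "computable F f" "computable F g" shows "computable F (\<lambda>c x. f c x @ g c x)"
proof -
  have "computable F (\<lambda>c x. foldr (\<lambda>y b. y # b) (f c x) (g c x))"
    by (intro computable_intros assms)
  moreover have "foldr (\<lambda>y b. y # b) l m = l @ m" for l m :: "'b list"
    by (induction l) auto
  ultimately show ?thesis by simp
qed

lemma computable_map [computable_intros]:
  assumes f: "computable F (\<lambda>c z. f c (fst z) (snd z))" and l: "computable F l"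
  shows "computable F (\<lambda>c x. map (\<lambda>y. f c x y) (l c x))"
proof -
  have "computable F (\<lambda>c x. foldr (\<lambda>y b. f c x y # b) (l c x) [])"
    by (intro computable_intros l computable_comp2[OF f])
  moreover have "foldr (\<lambda>y b. f c x y # b) l [] = map (\<lambda>y. f c x y) l" for c x l
    by (induction l) auto
  ultimately show ?thesis by simp
qed

lemma computable_filter [computable_intros]:
  assumes f: "computable F (\<lambda>c z. P c (fst z) (snd z))" and l: "computable F l"
  shows "computable F (\<lambda>c x. filter (\<lambda>y. P c x y) (l c x))"
proof -
  have "computable F (\<lambda>c x. foldr (\<lambda>y b. if P c x y then y # b else b) (l c x) [])"
    by (intro computable_intros l computable_comp2[OF f])
  moreover have "foldr (\<lambda>y b. if P c x y then y # b else b) l [] = filter (\<lambda>y. P c x y) l" for c x l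
    by (induction l) auto
  ultimately show ?thesis by simp
qed

lemma computable_concat [computable_intros]:
  assumes l: "computable F l" shows "computable F (\<lambda>c x. concat (l c x))"
proof -
  have "computable F (\<lambda>c x. foldr (\<lambda>y b. y @ b) (l c x) [])"
    by (intro computable_intros l)
  then show ?thesis by (simp add: concat_conv_foldr)
qed

lemma computable_length [computable_intros]:
  fixes l :: "'c \<Rightarrow> 'a::encodable \<Rightarrow> 'b::encodable list"
  assumes l: "computable F l" shows "computable F (\<lambda>c x. length (l c x))"
proof -
  have "computable F (\<lambda>c x. foldr (\<lambda>y b. Suc b) (l c x) 0)"
    by (intro computable_intros l)
  moreover have "foldr (\<lambda>y b. Suc b) m 0 = length m" for m :: "'b list"
    by (induction m) auto
  ultimately show ?thesis by simp
qed

lemma computable_sum_list [computable_intros]: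
  fixes l :: "'c \<Rightarrow> 'a::encodable \<Rightarrow> nat list"
  assumes l: "computable F l" shows "computable F (\<lambda>c x. sum_list (l c x))"
proof -
  have "computable F (\<lambda>c x. foldr (\<lambda>y b. y + b) (l c x) 0)"
    by (intro computable_intros l)
  then show ?thesis by (simp add: sum_list.eq_foldr)
qed

lemma computable_nth_default [computable_intros]:
  fixes l :: "'c \<Rightarrow> 'a::encodable \<Rightarrow> 'b::encodable list"
  assumes "computable F d" "computable F l" "computable F i"
  shows "computable F (\<lambda>c x. nth_default (d c x) (l c x) (i c x))"
proof -
  have *: "computable F (\<lambda>c x. if i c x < length (l c x)
      then hd_default (rec_nat (l c x) (\<lambda>_ m. tl m) (i c x)) else d c x)"
    by (intro computable_intros computable_hd_default assms)
  have "rec_nat m (\<lambda>_ m. tl m) n = drop n m" for m :: "'b list" and n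
    by (induction n) (auto simp: drop_Suc tl_drop)
  then show ?thesis
    by (intro computable_cong[OF *]) (auto simp: nth_default_def hd_default_def hd_drop_conv_nth)
qed

lemma computable_upt [computable_intros]:
  assumes "computable F f" "computable F g" shows "computable F (\<lambda>c x. [f c x..<g c x])"
proof -
  have "computable F (\<lambda>c x. rec_nat [] (\<lambda>n l. if f c x \<le> n then l @ [n] else l) (g c x))"
    by (intro computable_intros assms computable_comp[OF assms(1)])
  moreover have "rec_nat [] (\<lambda>n l. if a \<le> n then l @ [n] else l) b = [a..<b]" for a b
    by (induction b) auto
  ultimately show ?thesis by simp
qed

lemma computable_Ball_set [computable_intros]:
  assumes l: "computable F l" and P: "computable F (\<lambda>c z. P c (fst z) (snd z))"
  shows "computable F (\<lambda>c x. \<forall>y\<in>set (l c x). P c x y)"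
proof -
  have "computable F (\<lambda>c x. filter (\<lambda>y. \<not> P c x y) (l c x) = [])"
    by (intro computable_intros l P)
  then show ?thesis by (simp add: filter_empty_conv)
qed

lemma computable_Bex_set [computable_intros]:
  assumes l: "computable F l" and P: "computable F (\<lambda>c z. P c (fst z) (snd z))"
  shows "computable F (\<lambda>c x. \<exists>y\<in>set (l c x). P c x y)"
proof -
  have "computable F (\<lambda>c x. filter (\<lambda>y. P c x y) (l c x) \<noteq> [])"
    by (intro computable_intros l P)
  then show ?thesis by (simp add: filter_empty_conv)
qed

lemma computable_All_less [computable_intros]:
  fixes b :: "'c \<Rightarrow> 'a::encodable \<Rightarrow> nat"
  assumes "computable F b" "computable F (\<lambda>c z. P c (fst z) (snd z))"
  shows "computable F (\<lambda>c x. \<forall>i<b c x. P c x i)"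
proof -
  have "computable F (\<lambda>c x. \<forall>i\<in>set [0..<b c x]. P c x i)"
    by (intro computable_intros assms)
  then show ?thesis by (rule computable_cong) auto
qed

lemma computable_distinct [computable_intros]:
  assumes l: "computable F l" shows "computable F (\<lambda>c x. distinct (l c x))"
proof -
  have "computable F (\<lambda>c x. \<forall>i<length (l c x). \<forall>j<i.
      nth_default default_code (l c x) i \<noteq> nth_default default_code (l c x) j)"
    by (intro computable_intros l computable_comp[OF l])
  then show ?thesis
    by (rule computable_cong)
      (auto simp: distinct_conv_nth nth_default_def, metis linorder_neqE_nat)
qed

lemma computable_prefix [computable_intros]:
  fixes f g :: "'c \<Rightarrow> 'a::encodable \<Rightarrow> 'b::encodable list"
  assumes "computable F f" "computable F g" shows "computable F (\<lambda>c x. prefix (f c x) (g c x))"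
proof -
  have "computable F (\<lambda>c x. length (f c x) \<le> length (g c x) \<and> (\<forall>i<length (f c x).
      nth_default default_code (f c x) i = nth_default default_code (g c x) i))"
    by (intro computable_intros assms computable_comp[OF assms(1)] computable_comp[OF assms(2)])
  moreover have "length l \<le> length m \<and> (\<forall>i<length l.
      nth_default default_code l i = nth_default default_code m i) \<longleftrightarrow> prefix l m" for l m :: "'b list"
    by (auto simp: nth_default_def prefix_def prefix_length_le list_eq_iff_nth_eq nth_append
        intro!: exI[of _ "drop (length l) m"])
  ultimately show ?thesis by simp
qed

lemma computable_product_lists [computable_intros]:
  fixes l :: "'c \<Rightarrow> 'a::encodable \<Rightarrow> 'b::encodable list list"
  assumes l: "computable F l" shows "computable F (\<lambda>c x. product_lists (l c x))"
proof -
  have "computable F (\<lambda>c x. foldr (\<lambda>xs b. concat (map (\<lambda>y. map (\<lambda>ys. y # ys) b) xs)) (l c x) [[]])"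
    by (intro computable_intros l)
  moreover have "foldr (\<lambda>xs b. concat (map (\<lambda>y. map (\<lambda>ys. y # ys) b) xs)) m [[]] = product_lists m"
    for m :: "'b list list"
    by (induction m) auto
  ultimately show ?thesis by simp
qed


subsection \<open>Computing indices of programs\<close>

text \<open>The oracles behave like the program \<open>Zero\<close>, which replaces them when an
  ordinary program is extracted.\<close>

definition no_oracle :: "unit family" where
  "no_oracle = {((), \<lambda>_ _. Some 0)}"

lemma computable_no_oracle_phi:
  assumes "computable no_oracle f"
  shows "\<exists>e. \<forall>x. phi e (enc x) = Some (enc (f () x))"
proof -
  obtain t where t: "\<And>x. orun (\<lambda>_ _. Some 0) t (enc x) = Some (enc (f () x))"
    using assms by (rule computableE) (auto simp: no_oracle_def)
  have "phi (prog_index (instantiate (\<lambda>_. Zero) t)) (enc x) = Some (enc (f () x))" for x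
    using t by (simp add: run_instantiate)
  then show ?thesis by blast
qed

text \<open>The oracle program is fixed, so the arithmetic on indices unfolds into a fixed
  expression in which only the indices at the oracles vary.\<close>

lemma computable_instance_index [computable_intros]:
  assumes e: "computable F (\<lambda>c z. e c (fst z) (snd z))"
  shows "computable F (\<lambda>c x. instance_index (\<lambda>i. e c x i) t)"
proof (induction t)
  case (Oracle i)
  show ?case using computable_comp2[OF e computable_id computable_const] by simp
qed (simp; intro computable_intros; assumption)+

text \<open>The index of the program that applies \<open>Succ\<close> n times to
  \<open>Zero\<close>: 1 is the index of \<open>Succ\<close>, and the form 5 + 4 k marks a
  composition. It serves to supply a number as an additional oracle.\<close>

primrec const_index :: "nat \<Rightarrow> nat" where
  "const_index 0 = 0"
| "const_index (Suc n) = 5 + 4 * prod_encode (1, const_index n)"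

lemma phi_const_index: "phi (const_index n) x = Some n"
proof -
  have "const_index n = prog_index ((Comp Succ ^^ n) Zero) \<and> run ((Comp Succ ^^ n) Zero) x = Some n"
    by (induction n) auto
  then show ?thesis by simp
qed

lemma computable_const_index [computable_intros]:
  assumes "computable F f" shows "computable F (\<lambda>c x. const_index (f c x))"
proof -
  have "computable F (\<lambda>c x. rec_nat 0 (\<lambda>n y. 5 + 4 * prod_encode (1, y)) (f c x))"
    by (intro computable_intros assms)
  moreover have "rec_nat 0 (\<lambda>n y. 5 + 4 * prod_encode (1, y)) n = const_index n" for n
    by (induction n) auto
  ultimately show ?thesis by simp
qed


section \<open>Compact open cosets\<close>

lemma (in group) mult_inv_cancel_left [simp]:
  "x \<in> carrier G \<Longrightarrow> y \<in> carrier G \<Longrightarrow> x \<otimes> (inv x \<otimes> y) = y"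
  "x \<in> carrier G \<Longrightarrow> y \<in> carrier G \<Longrightarrow> inv x \<otimes> (x \<otimes> y) = y"
  by (simp_all flip: m_assoc)

lemma (in group) mem_l_coset:
  assumes "U \<subseteq> carrier G" "a \<in> carrier G"
  shows "x \<in> a <# U \<longleftrightarrow> x \<in> carrier G \<and> inv a \<otimes> x \<in> U"
proof
  assume "x \<in> carrier G \<and> inv a \<otimes> x \<in> U"
  then show "x \<in> a <# U"
    using assms by (auto simp: l_coset_def intro!: bexI[of _ "inv a \<otimes> x"])
qed (use assms in \<open>auto simp: l_coset_def\<close>)

lemma (in group) mem_r_coset:
  assumes "U \<subseteq> carrier G" "a \<in> carrier G"
  shows "x \<in> U #> a \<longleftrightarrow> x \<in> carrier G \<and> x \<otimes> inv a \<in> U"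
proof
  assume "x \<in> carrier G \<and> x \<otimes> inv a \<in> U"
  then show "x \<in> U #> a"
    using assms by (auto simp: r_coset_def m_assoc intro!: bexI[of _ "x \<otimes> inv a"])
qed (use assms in \<open>auto simp: r_coset_def m_assoc subset_iff\<close>)

locale top_group = group G for G :: "('g, 'm) monoid_scheme" (structure) +
  fixes T :: "'g topology"
  assumes topspace_eq: "topspace T = carrier G"
    and continuous_mult: "continuous_map (prod_topology T T) T (\<lambda>(x, y). x \<otimes> y)"
    and continuous_inv: "continuous_map T T (\<lambda>x. inv x)"
begin

lemma continuous_mult2:
  assumes "continuous_map X T f" "continuous_map X T g"
  shows "continuous_map X T (\<lambda>x. f x \<otimes> g x)"
  using continuous_map_compose[OF continuous_map_pairedI[OF assms] continuous_mult]
  by (simp add: o_def)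

lemma continuous_inv_compose:
  assumes "continuous_map X T f" shows "continuous_map X T (\<lambda>x. inv (f x))"
  using continuous_map_compose[OF assms continuous_inv] by (simp add: o_def)

lemma continuous_left: "a \<in> carrier G \<Longrightarrow> continuous_map T T (\<lambda>x. a \<otimes> x)"
  by (rule continuous_mult2) (simp_all add: topspace_eq)

lemma continuous_right: "a \<in> carrier G \<Longrightarrow> continuous_map T T (\<lambda>x. x \<otimes> a)"
  by (rule continuous_mult2) (simp_all add: topspace_eq)

lemma openin_carrier: "openin T U \<Longrightarrow> U \<subseteq> carrier G"
  using openin_subset topspace_eq by metis

lemma openin_l_coset:
  assumes "openin T U" "a \<in> carrier G" shows "openin T (a <# U)"
proof -
  have "a <# U = {x \<in> topspace T. inv a \<otimes> x \<in> U}"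
    using mem_l_coset[OF openin_carrier[OF assms(1)] assms(2)] by (auto simp: topspace_eq)
  then show ?thesis
    using openin_continuous_map_preimage[OF continuous_left assms(1), of "inv a"] assms by simp
qed

lemma openin_r_coset:
  assumes "openin T U" "a \<in> carrier G" shows "openin T (U #> a)"
proof -
  have "U #> a = {x \<in> topspace T. x \<otimes> inv a \<in> U}"
    using mem_r_coset[OF openin_carrier[OF assms(1)] assms(2)] by (auto simp: topspace_eq)
  then show ?thesis
    using openin_continuous_map_preimage[OF continuous_right assms(1), of "inv a"] assms by simp
qed

lemma compactin_l_coset:
  assumes "compactin T U" "a \<in> carrier G" shows "compactin T (a <# U)"
proof -
  have "a <# U = (\<lambda>x. a \<otimes> x) ` U" by (auto simp: l_coset_def)
  then show ?thesis using image_compactin[OF assms(1) continuous_left[OF assms(2)]] by simp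
qed

lemma set_inv_eq: "A \<subseteq> carrier G \<Longrightarrow> set_inv A = {x \<in> carrier G. inv x \<in> A}"
  by (force simp: SET_INV_def)

lemma set_inv_image: "set_inv A = (\<lambda>x. inv x) ` A"
  by (auto simp: SET_INV_def)

lemma openin_set_inv: "openin T U \<Longrightarrow> openin T (set_inv U)"
  using openin_continuous_map_preimage[OF continuous_inv]
  by (simp add: set_inv_eq openin_carrier topspace_eq)

lemma compactin_set_inv: "compactin T U \<Longrightarrow> compactin T (set_inv U)"
  using image_compactin continuous_inv by (simp add: set_inv_image) blast

text \<open>A nonempty set closed under x y^-1 z is a left coset of one subgroup and a right coset
  of another, and determines both. In this form cosets are described without naming a subgroup or a
  side.\<close>

definition coset :: "'g set \<Rightarrow> bool" where
  "coset A \<longleftrightarrow> compactin T A \<and> openin T A \<and> A \<noteq> {} \<and>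
     (\<forall>x\<in>A. \<forall>y\<in>A. \<forall>z\<in>A. x \<otimes> inv y \<otimes> z \<in> A)"

text \<open>The subgroup of which \<open>A\<close> is a left coset; it acts on \<open>A\<close> from
  the right.\<close>

definition right_group :: "'g set \<Rightarrow> 'g set" where
  "right_group A = {inv x \<otimes> y |x y. x \<in> A \<and> y \<in> A}"

definition left_group :: "'g set \<Rightarrow> 'g set" where
  "left_group A = {x \<otimes> inv y |x y. x \<in> A \<and> y \<in> A}"

lemma cosetD:
  assumes "coset A"
  shows "compactin T A" "openin T A" "A \<noteq> {}" "A \<subseteq> carrier G"
    "\<And>x y z. x \<in> A \<Longrightarrow> y \<in> A \<Longrightarrow> z \<in> A \<Longrightarrow> x \<otimes> inv y \<otimes> z \<in> A"
  using assms openin_carrier unfolding coset_def by auto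

lemma mem_right_group:
  assumes "coset A" "a \<in> A"
  shows "x \<in> right_group A \<longleftrightarrow> x \<in> carrier G \<and> a \<otimes> x \<in> A"
proof
  assume "x \<in> right_group A"
  then obtain y z where *: "x = inv y \<otimes> z" "y \<in> A" "z \<in> A" by (auto simp: right_group_def)
  then have "a \<otimes> inv y \<otimes> z \<in> A" using cosetD(5)[OF assms(1)] assms(2) by blast
  then show "x \<in> carrier G \<and> a \<otimes> x \<in> A"
    using * cosetD(4)[OF assms(1)] assms(2) by (auto simp: m_assoc subset_iff)
next
  assume x: "x \<in> carrier G \<and> a \<otimes> x \<in> A"
  then have "x = inv a \<otimes> (a \<otimes> x)" using cosetD(4)[OF assms(1)] assms(2) by auto
  then show "x \<in> right_group A" unfolding right_group_def using assms(2) x by blast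
qed

lemma mem_left_group:
  assumes "coset A" "a \<in> A"
  shows "x \<in> left_group A \<longleftrightarrow> x \<in> carrier G \<and> x \<otimes> a \<in> A"
proof
  assume "x \<in> left_group A"
  then obtain y z where *: "x = y \<otimes> inv z" "y \<in> A" "z \<in> A" by (auto simp: left_group_def)
  then have "y \<otimes> inv z \<otimes> a \<in> A" using cosetD(5)[OF assms(1)] assms(2) by blast
  then show "x \<in> carrier G \<and> x \<otimes> a \<in> A"
    using * cosetD(4)[OF assms(1)] assms(2) by (auto simp: m_assoc subset_iff)
next
  assume x: "x \<in> carrier G \<and> x \<otimes> a \<in> A"
  then have "x = (x \<otimes> a) \<otimes> inv a" using cosetD(4)[OF assms(1)] assms(2) by (auto simp: m_assoc)
  then show "x \<in> left_group A" unfolding left_group_def using assms(2) x by blast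
qed

lemma right_group_carrier: "coset A \<Longrightarrow> right_group A \<subseteq> carrier G"
  and left_group_carrier: "coset A \<Longrightarrow> left_group A \<subseteq> carrier G"
  using cosetD(4) by (auto simp: right_group_def left_group_def)

lemma right_group_eq:
  assumes "coset A" "a \<in> A" shows "right_group A = inv a <# A"
  using cosetD(4)[OF assms(1)] subsetD[OF cosetD(4)[OF assms(1)] assms(2)]
  by (intro Set.set_eqI) (auto simp: mem_right_group[OF assms] mem_l_coset)

lemma coset_eq_l_coset:
  assumes "coset A" "a \<in> A" shows "A = a <# right_group A"
  using cosetD(4)[OF assms(1)] subsetD[OF cosetD(4)[OF assms(1)] assms(2)]
  by (intro Set.set_eqI) (auto simp: mem_right_group[OF assms] mem_l_coset right_group_carrier[OF assms(1)])

lemma coset_eq_r_coset: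
  assumes "coset A" "a \<in> A" shows "A = left_group A #> a"
  using cosetD(4)[OF assms(1)] subsetD[OF cosetD(4)[OF assms(1)] assms(2)]
  by (intro Set.set_eqI)
    (auto simp: mem_left_group[OF assms] mem_r_coset left_group_carrier[OF assms(1)] m_assoc subset_iff)

text \<open>As a translate of \<open>A\<close> it is compact and open. Closure under products and
  inverses is the law for triples, applied to a x, a, a y and to a, a x, a.\<close>

lemma compact_open_right_group:
  assumes "coset A" shows "compact_open_subgroup G T (right_group A)"
proof -
  obtain a where a: "a \<in> A" using cosetD(3)[OF assms] by blast
  note A = cosetD[OF assms]
  have ac: "a \<in> carrier G" using a A by blast
  have "subgroup (right_group A) G"
  proof
    show "right_group A \<subseteq> carrier G" by (auto simp: mem_right_group[OF assms a])
    show "\<one> \<in> right_group A" using a ac by (simp add: mem_right_group[OF assms a])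
    show "x \<otimes> y \<in> right_group A" if "x \<in> right_group A" "y \<in> right_group A" for x y
    proof -
      have *: "x \<in> carrier G" "y \<in> carrier G" "a \<otimes> x \<in> A" "a \<otimes> y \<in> A"
        using that by (auto simp: mem_right_group[OF assms a])
      from A(5)[OF *(3) a *(4)] have "a \<otimes> (x \<otimes> y) \<in> A" using * ac by (simp add: m_assoc)
      then show ?thesis using * by (simp add: mem_right_group[OF assms a])
    qed
    show "inv x \<in> right_group A" if "x \<in> right_group A" for x
    proof -
      have *: "x \<in> carrier G" "a \<otimes> x \<in> A" using that by (auto simp: mem_right_group[OF assms a])
      from A(5)[OF a *(2) a] have "a \<otimes> inv x \<in> A" using * ac by (simp add: m_assoc inv_mult_group)
      then show ?thesis using * by (simp add: mem_right_group[OF assms a])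
    qed
  qed
  then show ?thesis unfolding compact_open_subgroup_def right_group_eq[OF assms a]
    using openin_l_coset[OF A(2)] compactin_l_coset[OF A(1)] ac by simp
qed

lemma coset_set_inv:
  assumes "coset A" shows "coset (set_inv A)"
proof -
  note A = cosetD[OF assms]
  have "inv x \<otimes> inv (inv y) \<otimes> inv z \<in> (\<lambda>x. inv x) ` A" if "x \<in> A" "y \<in> A" "z \<in> A" for x y z
    using A(5)[OF that(3,2,1)] that A(4)
    by (intro image_eqI[of _ _ "z \<otimes> inv y \<otimes> x"]) (auto simp: inv_mult_group m_assoc subset_iff)
  then show ?thesis
    using A openin_set_inv compactin_set_inv unfolding coset_def by (auto simp: set_inv_image)
qed

lemma right_group_set_inv: "A \<subseteq> carrier G \<Longrightarrow> right_group (set_inv A) = left_group A"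
  by (force simp: right_group_def left_group_def set_inv_image subset_iff)

lemma left_group_set_inv: "A \<subseteq> carrier G \<Longrightarrow> left_group (set_inv A) = right_group A"
  by (force simp: right_group_def left_group_def set_inv_image subset_iff)

lemma compact_open_left_group: "coset A \<Longrightarrow> compact_open_subgroup G T (left_group A)"
  using compact_open_right_group[OF coset_set_inv] right_group_set_inv cosetD(4) by metis

lemma set_inv_set_inv: "A \<subseteq> carrier G \<Longrightarrow> set_inv (set_inv A) = A"
  by (force simp: set_inv_image subset_iff image_image)

lemma coset_subgroup: "compact_open_subgroup G T V \<Longrightarrow> coset V"
  unfolding compact_open_subgroup_def coset_def
  using subgroup.one_closed subgroup.m_closed subgroup.m_inv_closed by (metis empty_iff)

lemma compact_open_subgroup_iff: "compact_open_subgroup G T V \<longleftrightarrow> coset V \<and> \<one> \<in> V"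
proof
  assume V: "coset V \<and> \<one> \<in> V"
  then have "right_group V = V" using cosetD(4) by (force simp: mem_right_group)
  then show "compact_open_subgroup G T V" using compact_open_right_group V by metis
qed (metis coset_subgroup compact_open_subgroup_def subgroup.one_closed)

lemma right_group_subgroup:
  assumes "compact_open_subgroup G T V" shows "right_group V = V" "left_group V = V"
  using assms cosetD(4) unfolding compact_open_subgroup_iff
  by (force simp: mem_right_group mem_left_group)+

lemma coset_translate:
  assumes "coset B" "a \<in> carrier G"
  shows "coset (a <# B)" "right_group (a <# B) = right_group B"
proof -
  note B = cosetD[OF assms(1)]
  have 1: "(a \<otimes> x) \<otimes> inv (a \<otimes> y) \<otimes> (a \<otimes> z) = a \<otimes> (x \<otimes> inv y \<otimes> z)"
    if "x \<in> B" "y \<in> B" "z \<in> B" for x y z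
    using that B(4) assms(2) by (simp add: m_assoc inv_mult_group subset_iff)
  have eq: "a <# B = (\<lambda>x. a \<otimes> x) ` B" by (auto simp: l_coset_def)
  have "\<forall>x\<in>a <# B. \<forall>y\<in>a <# B. \<forall>z\<in>a <# B. x \<otimes> inv y \<otimes> z \<in> a <# B"
    unfolding eq by (simp add: 1 B(5))
  then show c: "coset (a <# B)"
    unfolding coset_def using openin_l_coset[OF B(2) assms(2)] compactin_l_coset[OF B(1) assms(2)] B(3) eq
    by auto
  obtain b where b: "b \<in> B" using B(3) by blast
  then have "a \<otimes> b \<in> a <# B" by (auto simp: l_coset_def)
  from mem_right_group[OF c this] mem_right_group[OF assms(1) b]
  show "right_group (a <# B) = right_group B"
    using b assms(2) B(4) by (auto simp: l_coset_def m_assoc subset_iff)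
qed

lemma coset_l_coset:
  assumes V: "compact_open_subgroup G T V" and a: "a \<in> carrier G"
  shows "coset (a <# V)" "right_group (a <# V) = V"
  using coset_translate[OF coset_subgroup[OF V] a] right_group_subgroup[OF V] by simp_all

lemma set_inv_r_coset:
  assumes "subgroup V G" "a \<in> carrier G" shows "set_inv (V #> a) = inv a <# V"
proof (intro Set.set_eqI iffI)
  note c = subgroup.mem_carrier[OF assms(1)] and i = subgroup.m_inv_closed[OF assms(1)]
  fix x
  show "x \<in> inv a <# V" if "x \<in> set_inv (V #> a)"
    using that assms(2) c i by (auto simp: SET_INV_def r_coset_def l_coset_def inv_mult_group)
  show "x \<in> set_inv (V #> a)" if x: "x \<in> inv a <# V"
  proof -
    obtain v where "v \<in> V" "x = inv a \<otimes> v" using x by (auto simp: l_coset_def)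
    then show ?thesis using assms(2) c i
      by (auto simp: SET_INV_def r_coset_def inv_mult_group intro!: bexI[of _ "inv v"])
  qed
qed

lemma coset_r_coset:
  assumes V: "compact_open_subgroup G T V" and a: "a \<in> carrier G"
  shows "coset (V #> a)" "left_group (V #> a) = V"
proof -
  have sub: "subgroup V G" using V by (auto simp: compact_open_subgroup_def)
  have car: "V #> a \<subseteq> carrier G" using a subgroup.mem_carrier[OF sub] by (auto simp: r_coset_def)
  have eq: "set_inv (V #> a) = inv a <# V" using set_inv_r_coset[OF sub a] .
  have "coset (set_inv (V #> a))" unfolding eq using coset_l_coset(1)[OF V] a by simp
  from coset_set_inv[OF this] show "coset (V #> a)" using set_inv_set_inv[OF car] by simp
  show "left_group (V #> a) = V"
    using right_group_set_inv[OF car] coset_l_coset(2)[OF V, of "inv a"] a eq by simp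
qed

section \<open>The meet groupoid in terms of cosets\<close>

lemma left_coset_of_iff:
  assumes "compact_open_subgroup G T V"
  shows "left_coset_of G V A \<longleftrightarrow> coset A \<and> right_group A = V"
proof
  assume "left_coset_of G V A"
  then show "coset A \<and> right_group A = V"
    using coset_l_coset[OF assms] by (auto simp: left_coset_of_def)
next
  assume A: "coset A \<and> right_group A = V"
  then obtain a where "a \<in> A" "a \<in> carrier G" using cosetD(3,4) by blast
  then show "left_coset_of G V A"
    using coset_eq_l_coset A unfolding left_coset_of_def by blast
qed

lemma right_coset_of_iff:
  assumes "compact_open_subgroup G T V"
  shows "right_coset_of G V A \<longleftrightarrow> coset A \<and> left_group A = V"
proof
  assume "right_coset_of G V A"
  then show "coset A \<and> left_group A = V"
    using coset_r_coset[OF assms] by (auto simp: right_coset_of_def)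
next
  assume A: "coset A \<and> left_group A = V"
  then obtain a where "a \<in> A" "a \<in> carrier G" using cosetD(3,4) by blast
  then show "right_coset_of G V A"
    using coset_eq_r_coset A unfolding right_coset_of_def by blast
qed

text \<open>Every set that satisfies the law for triples is already a left coset, namely of its
  right group, so the right cosets add nothing new.\<close>

lemma meet_groupoid_eq: "meet_groupoid G T = insert {} {A. coset A}"
proof -
  have "(\<exists>V. compact_open_subgroup G T V \<and> (left_coset_of G V A \<or> right_coset_of G V A)) \<longleftrightarrow> coset A"
    (is "?L \<longleftrightarrow> ?R") for A
  proof
    show ?L if ?R
      using left_coset_of_iff[OF compact_open_right_group[OF that], of A] that
        compact_open_right_group[OF that] by auto
  qed (auto simp: left_coset_of_iff right_coset_of_iff)
  then show ?thesis by (simp add: meet_groupoid_def)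
qed

text \<open>The subgroup that witnesses definedness can only be the right group of A and the left
  group of B, so the quantifier disappears.\<close>

lemma meet_groupoid_prod_eq:
  "meet_groupoid_prod G T A B =
     (if coset A \<and> coset B \<and> right_group A = left_group B then Some (A <#> B) else None)"
proof -
  have "(\<exists>V. compact_open_subgroup G T V \<and> left_coset_of G V A \<and> right_coset_of G V B) \<longleftrightarrow>
    coset A \<and> coset B \<and> right_group A = left_group B" (is "?L \<longleftrightarrow> ?R")
  proof
    show ?L if ?R
      using left_coset_of_iff[of "right_group A" A] right_coset_of_iff[of "right_group A" B]
        compact_open_right_group[of A] that by auto
  qed (auto simp: left_coset_of_iff right_coset_of_iff)
  then show ?thesis by (simp add: meet_groupoid_prod_def)
qed

text \<open>For y in A the element a^-1 y lies in the right group of A, which is the left group of B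
  and so maps B to itself. Hence y B = a B.\<close>

lemma set_mult_eq_l_coset:
  assumes "coset A" "coset B" "right_group A = left_group B" "a \<in> A"
  shows "A <#> B = a <# B"
proof (intro Set.set_eqI iffI)
  note c = cosetD(4)[OF assms(1)] cosetD(4)[OF assms(2)]
  fix x
  assume "x \<in> A <#> B"
  then obtain y z where yz: "x = y \<otimes> z" "y \<in> A" "z \<in> B" by (auto simp: set_mult_def)
  have "inv a \<otimes> y \<in> left_group B"
    unfolding assms(3)[symmetric] right_group_def using yz assms(4) by blast
  then have "inv a \<otimes> y \<otimes> z \<in> B" using mem_left_group[OF assms(2) yz(3)] by blast
  then show "x \<in> a <# B" using yz assms(4) c
    by (auto simp: l_coset_def m_assoc subset_iff intro!: bexI[of _ "inv a \<otimes> y \<otimes> z"])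
qed (use assms(4) in \<open>auto simp: l_coset_def set_mult_def\<close>)

lemma coset_set_mult:
  assumes "coset A" "coset B" "right_group A = left_group B"
  shows "coset (A <#> B)" "right_group (A <#> B) = right_group B"
proof -
  obtain a where a: "a \<in> A" "a \<in> carrier G" using cosetD[OF assms(1)] by blast
  show "coset (A <#> B)" "right_group (A <#> B) = right_group B"
    unfolding set_mult_eq_l_coset[OF assms a(1)] using coset_translate[OF assms(2) a(2)] .
qed

text \<open>The complement is a union of open cosets of the right group of \<open>A\<close>. As the
  locale assumes no separation axiom, closedness has to come from the group structure. It makes
  intersections of cosets compact.\<close>

lemma closedin_coset:
  assumes "coset A" shows "closedin T A"
proof -
  note V = compact_open_right_group[OF assms]
  have "topspace T - A = (\<Union>x\<in>carrier G - A. x <# right_group A)"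
  proof (intro Set.set_eqI iffI)
    fix x assume "x \<in> topspace T - A"
    moreover have "x \<in> x <# right_group A" if "x \<in> carrier G"
      using V that by (force simp: l_coset_def compact_open_subgroup_iff)
    ultimately show "x \<in> (\<Union>x\<in>carrier G - A. x <# right_group A)" by (auto simp: topspace_eq)
  next
    fix x assume "x \<in> (\<Union>x\<in>carrier G - A. x <# right_group A)"
    then obtain y v where y: "y \<in> carrier G" "y \<notin> A" "v \<in> right_group A" "x = y \<otimes> v"
      by (auto simp: l_coset_def)
    have v: "v \<in> carrier G" "inv v \<in> right_group A"
      using y(3) V unfolding compact_open_subgroup_def
      by (auto simp: subgroup.m_inv_closed dest: subgroup.mem_carrier)
    have "x \<notin> A"
    proof
      assume "x \<in> A"
      from mem_right_group[OF assms this, of "inv v"] have "x \<otimes> inv v \<in> A" using v by blast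
      then show False using y v by (simp add: m_assoc)
    qed
    then show "x \<in> topspace T - A" using y v by (simp add: topspace_eq)
  qed
  moreover have "openin T (\<Union>x\<in>carrier G - A. x <# right_group A)"
    using V openin_l_coset by (auto simp: compact_open_subgroup_def)
  ultimately show ?thesis
    using cosetD(4)[OF assms] by (simp add: closedin_def topspace_eq)
qed

lemma coset_Int:
  assumes "coset A" "coset B" "A \<inter> B \<noteq> {}" shows "coset (A \<inter> B)"
  using assms cosetD[OF assms(1)] cosetD[OF assms(2)] closed_Int_compactin[OF closedin_coset[OF assms(1)]]
  unfolding coset_def by auto

lemma compact_open_subgroup_Int:
  assumes "compact_open_subgroup G T U" "compact_open_subgroup G T V"
  shows "compact_open_subgroup G T (U \<inter> V)"
  using assms coset_Int unfolding compact_open_subgroup_iff by blast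

text \<open>If A A = A, then a a is in A, so a and with it a^-1 lie in the right group; hence A
  contains a a^-1 = 1 and is a subgroup. Thus subgroups are recognised from the partial product
  alone.\<close>

lemma meet_groupoid_prod_idem_iff:
  assumes "A \<in> meet_groupoid G T"
  shows "meet_groupoid_prod G T A A = Some A \<longleftrightarrow> compact_open_subgroup G T A"
proof
  assume "meet_groupoid_prod G T A A = Some A"
  then have A: "coset A" "right_group A = left_group A" "A <#> A = A"
    unfolding meet_groupoid_prod_eq by (auto split: if_splits)
  obtain a where a: "a \<in> A" "a \<in> carrier G" using cosetD[OF A(1)] by blast
  then have "a \<otimes> a \<in> A" using A(3) by (force simp: set_mult_def)
  then have "a \<in> right_group A" using a by (simp add: mem_right_group[OF A(1) a(1)])
  then have "inv a \<in> right_group A"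
    using compact_open_right_group[OF A(1)] by (simp add: compact_open_subgroup_def subgroup.m_inv_closed)
  then have "\<one> \<in> A" using a by (simp add: mem_right_group[OF A(1) a(1)])
  then show "compact_open_subgroup G T A" using A(1) by (simp add: compact_open_subgroup_iff)
next
  assume A: "compact_open_subgroup G T A"
  then have "A <#> A = A"
    using subgroup_mult_id by (simp add: compact_open_subgroup_def)
  then show "meet_groupoid_prod G T A A = Some A"
    using coset_subgroup[OF A] right_group_subgroup[OF A] by (simp add: meet_groupoid_prod_eq)
qed

lemma subgroup_index_eq: "subgroup_index G U W = card ((\<lambda>a. W #> a) ` U)"
  by (simp add: subgroup_index_def RCOSETS_def r_coset_def UNION_singleton_eq_range image_def)
    (rule arg_cong[where f=card], auto)

end

lemma top_group_iff: "top_group G T \<longleftrightarrow> topological_group G T"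
  by (simp add: top_group_def top_group_axioms_def topological_group_def)


section \<open>Transport along isomorphisms\<close>

locale top_group_iso = A: top_group G T + B: top_group H U
  for G :: "('g, 'm) monoid_scheme" and T and H :: "('h, 'n) monoid_scheme" and U +
  fixes f
  assumes f_iso: "f \<in> iso G H" and f_homeo: "homeomorphic_map T U f"
begin

lemma f_bij: "bij_betw f (carrier G) (carrier H)"
  using f_iso by (simp add: iso_def)

lemma f_inj: "inj_on f (carrier G)"
  using f_bij by (rule bij_betw_imp_inj_on)

lemma f_image: "f ` carrier G = carrier H"
  using f_bij by (rule bij_betw_imp_surj_on)

lemma f_mult: "x \<in> carrier G \<Longrightarrow> y \<in> carrier G \<Longrightarrow> f (x \<otimes>\<^bsub>G\<^esub> y) = f x \<otimes>\<^bsub>H\<^esub> f y"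
  using f_iso by (auto simp: iso_def hom_def)

lemma f_inv: "x \<in> carrier G \<Longrightarrow> f (inv\<^bsub>G\<^esub> x) = inv\<^bsub>H\<^esub> f x"
  using f_iso by (intro group_hom.hom_inv)
    (auto simp: group_hom_def group_hom_axioms_def iso_def A.is_group B.is_group)

lemma f_mem_image: "x \<in> carrier G \<Longrightarrow> A \<subseteq> carrier G \<Longrightarrow> f x \<in> f ` A \<longleftrightarrow> x \<in> A"
  using f_inj by (rule inj_on_image_mem_iff)

lemma coset_image:
  assumes "A \<subseteq> carrier G" shows "B.coset (f ` A) \<longleftrightarrow> A.coset A"
proof -
  have "f x \<otimes>\<^bsub>H\<^esub> inv\<^bsub>H\<^esub> f y \<otimes>\<^bsub>H\<^esub> f z \<in> f ` A \<longleftrightarrow> x \<otimes>\<^bsub>G\<^esub> inv\<^bsub>G\<^esub> y \<otimes>\<^bsub>G\<^esub> z \<in> A"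
    if "x \<in> A" "y \<in> A" "z \<in> A" for x y z
  proof -
    have "x \<in> carrier G" "y \<in> carrier G" "z \<in> carrier G" using that assms by auto
    then show ?thesis
      using f_mem_image[of "x \<otimes>\<^bsub>G\<^esub> inv\<^bsub>G\<^esub> y \<otimes>\<^bsub>G\<^esub> z" A] assms by (simp add: f_mult f_inv)
  qed
  then show ?thesis
    using homeomorphic_map_compactness[OF f_homeo, of A] homeomorphic_map_openness[OF f_homeo, of A] assms
    by (simp add: A.coset_def B.coset_def A.topspace_eq)
qed

lemma right_group_image:
  assumes "A \<subseteq> carrier G" shows "B.right_group (f ` A) = f ` A.right_group A"
proof -
  have "inv\<^bsub>H\<^esub> f x \<otimes>\<^bsub>H\<^esub> f y = f (inv\<^bsub>G\<^esub> x \<otimes>\<^bsub>G\<^esub> y)" if "x \<in> A" "y \<in> A" for x y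
    using that assms by (simp add: f_mult f_inv subset_iff)
  then show ?thesis by (force simp: A.right_group_def B.right_group_def)
qed

lemma left_group_image:
  assumes "A \<subseteq> carrier G" shows "B.left_group (f ` A) = f ` A.left_group A"
proof -
  have "f x \<otimes>\<^bsub>H\<^esub> inv\<^bsub>H\<^esub> f y = f (x \<otimes>\<^bsub>G\<^esub> inv\<^bsub>G\<^esub> y)" if "x \<in> A" "y \<in> A" for x y
    using that assms by (simp add: f_mult f_inv subset_iff)
  then show ?thesis by (force simp: A.left_group_def B.left_group_def)
qed

lemma set_mult_image:
  assumes "A \<subseteq> carrier G" "B \<subseteq> carrier G"
  shows "f ` (A <#>\<^bsub>G\<^esub> B) = f ` A <#>\<^bsub>H\<^esub> f ` B"
proof -
  have "f (x \<otimes>\<^bsub>G\<^esub> y) = f x \<otimes>\<^bsub>H\<^esub> f y" if "x \<in> A" "y \<in> B" for x y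
    using that assms by (simp add: f_mult subset_iff)
  then show ?thesis by (force simp: set_mult_def)
qed

lemma set_inv_image: "A \<subseteq> carrier G \<Longrightarrow> f ` (set_inv\<^bsub>G\<^esub> A) = set_inv\<^bsub>H\<^esub> (f ` A)"
  by (force simp: A.set_inv_image B.set_inv_image f_inv subset_iff)

lemma image_eq_iff: "A \<subseteq> carrier G \<Longrightarrow> B \<subseteq> carrier G \<Longrightarrow> f ` A = f ` B \<longleftrightarrow> A = B"
  using f_inj by (meson inj_on_image_eq_iff)

lemma meet_groupoid_carrier: "A \<in> meet_groupoid G T \<Longrightarrow> A \<subseteq> carrier G"
  using A.cosetD(4) by (auto simp: A.meet_groupoid_eq)

lemma meet_groupoid_image: "meet_groupoid H U = (\<lambda>A. f ` A) ` meet_groupoid G T"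
proof -
  have "B \<in> (\<lambda>A. f ` A) ` Collect A.coset" if cB: "B.coset B" for B
  proof -
    define A where "A = {x \<in> carrier G. f x \<in> B}"
    have A: "A \<subseteq> carrier G" by (auto simp: A_def)
    have B: "B = f ` A"
    proof (intro Set.set_eqI iffI)
      fix y assume y: "y \<in> B"
      then obtain x where "x \<in> carrier G" "y = f x" using B.cosetD(4)[OF cB] f_image by blast
      then show "y \<in> f ` A" using y by (auto simp: A_def)
    qed (auto simp: A_def)
    then have "A.coset A" using coset_image[OF A] cB by simp
    then show ?thesis using B by blast
  qed
  moreover have "B.coset (f ` A)" if "A.coset A" for A
    using coset_image[OF A.cosetD(4)[OF that]] that by simp
  ultimately have "Collect B.coset = (\<lambda>A. f ` A) ` Collect A.coset" by auto
  then show ?thesis by (simp add: A.meet_groupoid_eq B.meet_groupoid_eq)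
qed

lemma meet_groupoid_prod_image:
  assumes "A \<subseteq> carrier G" "B \<subseteq> carrier G"
  shows "meet_groupoid_prod H U (f ` A) (f ` B) = map_option ((`) f) (meet_groupoid_prod G T A B)"
  unfolding A.meet_groupoid_prod_eq B.meet_groupoid_prod_eq
  using assms coset_image set_mult_image right_group_image left_group_image
    image_eq_iff[OF A.right_group_carrier A.left_group_carrier] by auto

lemma subgroup_index_image:
  assumes "A \<subseteq> carrier G" "B \<subseteq> carrier G"
  shows "subgroup_index H (f ` A) (f ` B) = subgroup_index G A B"
proof -
  have *: "f ` B #>\<^bsub>H\<^esub> f a = f ` (B #>\<^bsub>G\<^esub> a)" if "a \<in> A" for a
    using set_mult_image[of B "{a}"] that assms by (auto simp: r_coset_eq_set_mult)
  have "(\<lambda>a. f ` B #>\<^bsub>H\<^esub> a) ` f ` A = (\<lambda>C. f ` C) ` (\<lambda>a. B #>\<^bsub>G\<^esub> a) ` A"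
    unfolding image_image by (rule image_cong) (simp_all add: *)
  moreover have "inj_on (\<lambda>C. f ` C) ((\<lambda>a. B #>\<^bsub>G\<^esub> a) ` A)"
  proof (rule inj_onI, elim imageE)
    fix C D a b
    assume "f ` C = f ` D" "C = B #>\<^bsub>G\<^esub> a" "a \<in> A" "D = B #>\<^bsub>G\<^esub> b" "b \<in> A"
    moreover have "B #>\<^bsub>G\<^esub> x \<subseteq> carrier G" if "x \<in> A" for x
      using A.r_coset_subset_G[OF assms(2), of x] assms(1) that by blast
    ultimately show "C = D" by (simp add: image_eq_iff)
  qed
  ultimately show ?thesis
    by (simp add: A.subgroup_index_eq B.subgroup_index_eq card_image)
qed

text \<open>Neither the structure on numbers nor the indices change; only the naming map is composed
  with the isomorphism. The subgroup index counts cosets and is therefore invariant.\<close>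

lemma presentation_via_image:
  assumes "meet_groupoid_presentation_via G T M \<theta> p"
  shows "meet_groupoid_presentation_via H U M (\<lambda>x. f ` \<theta> x) p"
proof -
  have iso: "meet_groupoid_iso G T M \<theta>"
    using assms by (auto simp: meet_groupoid_presentation_via_def)
  have car: "\<theta> x \<subseteq> carrier G" if "x \<in> mdom M" for x
    using iso meet_groupoid_carrier that
    by (metis bij_betw_apply meet_groupoid_iso_def)
  have "meet_groupoid_iso H U M (\<lambda>x. f ` \<theta> x)"
    unfolding meet_groupoid_iso_def
  proof (intro conjI ballI)
    have bij: "bij_betw \<theta> (mdom M) (meet_groupoid G T)"
      using iso by (simp add: meet_groupoid_iso_def)
    have "bij_betw (\<lambda>A. f ` A) (meet_groupoid G T) (meet_groupoid H U)"
      using meet_groupoid_carrier by (auto simp: bij_betw_def inj_on_def image_eq_iff meet_groupoid_image)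
    from bij_betw_trans[OF bij this] show "bij_betw (\<lambda>x. f ` \<theta> x) (mdom M) (meet_groupoid H U)"
      by (simp add: o_def)
  next
    fix x assume x: "x \<in> mdom M"
    show "minv M x \<in> mdom M" "f ` \<theta> (minv M x) = set_inv\<^bsub>H\<^esub> (f ` \<theta> x)"
      using iso x set_inv_image[OF car[OF x]] by (simp_all add: meet_groupoid_iso_def)
  next
    fix x y assume xy: "x \<in> mdom M" "y \<in> mdom M"
    show "mmeet M x y \<in> mdom M" "set_option (mprod M x y) \<subseteq> mdom M"
      using iso xy by (simp_all add: meet_groupoid_iso_def)
    show "f ` \<theta> (mmeet M x y) = f ` \<theta> x \<inter> f ` \<theta> y"
      using iso xy inj_on_image_Int[OF f_inj car[OF xy(1)] car[OF xy(2)]]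
      by (simp add: meet_groupoid_iso_def)
    have "meet_groupoid_prod G T (\<theta> x) (\<theta> y) = map_option \<theta> (mprod M x y)"
      using iso xy by (simp add: meet_groupoid_iso_def)
    then show "map_option (\<lambda>x. f ` \<theta> x) (mprod M x y) = meet_groupoid_prod H U (f ` \<theta> x) (f ` \<theta> y)"
      using meet_groupoid_prod_image[OF car[OF xy(1)] car[OF xy(2)]]
      by (simp add: option.map_comp o_def)
  qed
  moreover have "(if u \<in> msubgroups M \<and> v \<in> msubgroups M
       then Some (subgroup_index H (f ` \<theta> u) (f ` \<theta> u \<inter> f ` \<theta> v)) else None) =
     (if u \<in> msubgroups M \<and> v \<in> msubgroups M
       then Some (subgroup_index G (\<theta> u) (\<theta> u \<inter> \<theta> v)) else None)" for u v
    using subgroup_index_image[of "\<theta> u" "\<theta> u \<inter> \<theta> v"] inj_on_image_Int[OF f_inj, of "\<theta> u" "\<theta> v"] car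
    by (auto simp: msubgroups_def le_infI1)
  ultimately show ?thesis
    using assms by (simp add: meet_groupoid_presentation_via_def Haar_computable_data_def)
qed

end

section \<open>Invariance under isomorphism, and copies whose elements are sequences\<close>

lemma topological_group_iso_obtain:
  assumes "topological_group_iso G T H U" "topological_group G T" "topological_group H U"
  obtains f where "top_group_iso G T H U f"
  using assms by (auto simp: topological_group_iso_def top_group_iso_def top_group_iso_axioms_def top_group_iff)

lemma topological_group_iso_sym:
  assumes "topological_group_iso G T H U" "topological_group G T" "topological_group H U"
  shows "topological_group_iso H U G T"
proof -
  interpret G: group G using assms(2) by (simp add: topological_group_def)
  interpret H: group H using assms(3) by (simp add: topological_group_def)
  have top: "topspace T = carrier G" "topspace U = carrier H"
    using assms(2,3) by (simp_all add: topological_group_def)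
  obtain f where f: "f \<in> iso G H" "homeomorphic_map T U f"
    using assms(1) by (auto simp: topological_group_iso_def)
  obtain g where fg: "homeomorphic_maps T U f g"
    using f(2) homeomorphic_map_maps by blast
  then have g: "homeomorphic_map U T g"
    using homeomorphic_maps_map homeomorphic_maps_sym by blast
  have cancel: "f x \<in> carrier H" "g (f x) = x" if "x \<in> carrier G" for x
    using fg that by (auto simp: homeomorphic_maps_def top continuous_map_def)
  have cancel': "g y \<in> carrier G" "f (g y) = y" if "y \<in> carrier H" for y
    using fg that by (auto simp: homeomorphic_maps_def top continuous_map_def)
  have "g (x \<otimes>\<^bsub>H\<^esub> y) = g x \<otimes>\<^bsub>G\<^esub> g y" if "x \<in> carrier H" "y \<in> carrier H" for x y
  proof -
    have "f (g x \<otimes>\<^bsub>G\<^esub> g y) = x \<otimes>\<^bsub>H\<^esub> y"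
      using f(1) cancel' that by (simp add: iso_def hom_def Pi_iff)
    then show ?thesis using cancel(2)[of "g x \<otimes>\<^bsub>G\<^esub> g y"] cancel' that by simp
  qed
  moreover have "bij_betw g (carrier H) (carrier G)"
    by (rule bij_betw_byWitness[where f'=f]) (use cancel cancel' in auto)
  ultimately have "g \<in> iso H G"
    using cancel' by (auto simp: iso_def hom_def)
  then show ?thesis using g by (auto simp: topological_group_iso_def)
qed

lemma topological_group_iso_trans:
  assumes "topological_group_iso G T H U" "topological_group_iso H U K W"
  shows "topological_group_iso G T K W"
  using assms iso_set_trans homeomorphic_map_compose unfolding topological_group_iso_def by metis

lemma closed_subgroup_presentation_iso:
  assumes "topological_group_iso G T H U" "closed_subgroup_presentation H U p"
  shows "closed_subgroup_presentation G T p"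
  using assms topological_group_iso_trans unfolding closed_subgroup_presentation_def by metis

lemma tdlc_group_iso:
  assumes iso: "topological_group_iso G T H U" and H: "topological_group H U" and G: "tdlc_group G T"
  shows "tdlc_group H U"
proof -
  obtain f where f: "f \<in> iso G H" "homeomorphic_map T U f"
    using iso by (auto simp: topological_group_iso_def)
  then have hs: "T homeomorphic_space U"
    using homeomorphic_map_imp_homeomorphic_space by blast
  obtain g where g: "homeomorphic_map U T g"
    using topological_group_iso_sym[OF iso _ H] G
    by (auto simp: topological_group_iso_def tdlc_group_def)
  have "totally_disconnected_space U"
    unfolding totally_disconnected_space_def
  proof (intro allI impI)
    fix S assume S: "connectedin U S"
    then have sub: "S \<subseteq> topspace U" by (simp add: connectedin_def)
    have "connectedin T (g ` S)" using S homeomorphic_map_connectedness[OF g sub] by simp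
    then obtain x where "g ` S \<subseteq> {x}"
      using G unfolding tdlc_group_def totally_disconnected_space_def by blast
    moreover have "inj_on g S"
      using homeomorphic_imp_injective_map[OF g] sub by (rule inj_on_subset)
    ultimately have "y = z" if "y \<in> S" "z \<in> S" for y z
      using that unfolding inj_on_def by blast
    then show "\<exists>x. S \<subseteq> {x}" by blast
  qed
  moreover have "second_countable U" "locally_compact_space U"
    using hs homeomorphic_space_second_countability homeomorphic_locally_compact_space G
    by (auto simp: tdlc_group_def)
  moreover have "infinite (carrier H)"
    using f(1) G bij_betw_finite unfolding iso_def tdlc_group_def by blast
  ultimately show ?thesis using H by (simp add: tdlc_group_def)
qed

text \<open>Two points that no open set distinguishes form a connected set.\<close>

lemma totally_disconnected_imp_t0:
  assumes "totally_disconnected_space T" "x \<in> topspace T" "y \<in> topspace T" "x \<noteq> y"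
  shows "\<exists>V. openin T V \<and> (x \<in> V) \<noteq> (y \<in> V)"
proof (rule ccontr)
  assume "\<not> ?thesis"
  then have same: "x \<in> V \<longleftrightarrow> y \<in> V" if "openin T V" for V using that by blast
  have "connectedin T {x, y}"
    unfolding connectedin
  proof (intro conjI notI)
    assume "\<exists>E1 E2. openin T E1 \<and> openin T E2 \<and> {x, y} \<subseteq> E1 \<union> E2 \<and> E1 \<inter> E2 \<inter> {x, y} = {} \<and>
      E1 \<inter> {x, y} \<noteq> {} \<and> E2 \<inter> {x, y} \<noteq> {}"
    then show False using same by blast
  qed (use assms in auto)
  then show False using assms unfolding totally_disconnected_space_def by blast
qed

text \<open>A point is determined by the members of a countable base that contain it, so its
  sequence of memberships can replace it. Only the elements are renamed: multiplication and topology
  are pulled back along the decoding, and the topology is not taken from Baire space.\<close>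

lemma tdlc_group_embed:
  fixes G :: "('g, 'm) monoid_scheme" (structure)
  assumes G: "tdlc_group G T"
  obtains H :: "(nat \<Rightarrow> nat) monoid" and U where "topological_group H U" "topological_group_iso G T H U"
proof -
  interpret top_group G T using G by (simp add: top_group_iff tdlc_group_def)
  obtain B where B: "countable B" "\<And>V. V \<in> B \<Longrightarrow> openin T V"
    and base: "\<And>W x. openin T W \<Longrightarrow> x \<in> W \<Longrightarrow> \<exists>V\<in>B. x \<in> V \<and> V \<subseteq> W"
    using G unfolding tdlc_group_def second_countable_def by metis
  define e where "e x = (\<lambda>n. of_bool (x \<in> from_nat_into B n) :: nat)" for x :: 'g
  have e: "inj_on e (carrier G)"
  proof (rule inj_onI, rule ccontr)
    fix x y assume xy: "x \<in> carrier G" "y \<in> carrier G" "e x = e y" "x \<noteq> y"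
    obtain W where W: "openin T W" "(x \<in> W) \<noteq> (y \<in> W)"
      using totally_disconnected_imp_t0[of T x y] G xy by (auto simp: tdlc_group_def topspace_eq)
    then obtain V where V: "V \<in> B" "(x \<in> V) \<noteq> (y \<in> V)" by (metis base subsetD)
    then obtain n where "V = from_nat_into B n" using B(1) by (metis from_nat_into_surj)
    then show False using V(2) fun_cong[OF xy(3), of n] by (auto simp: e_def of_bool_eq_iff)
  qed
  define d where "d = inv_into (carrier G) e"
  have de: "d (e x) = x" if "x \<in> carrier G" for x using e that by (simp add: d_def)
  define H where "H = \<lparr>carrier = e ` carrier G, mult = \<lambda>x y. e (d x \<otimes> d y), one = e \<one>\<rparr>"
  have gH: "group H"
    by (rule groupI) (auto simp: H_def de m_assoc intro!: bexI[of _ "inv _"])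
  define U where "U = pullback_topology (carrier H) d T"
  have carH: "carrier H = e ` carrier G" by (simp add: H_def)
  have topU: "topspace U = carrier H"
    by (auto simp: U_def topspace_pullback_topology topspace_eq carH de)
  have d: "continuous_map U T d"
    unfolding U_def using continuous_map_pullback[OF continuous_map_id] by (simp add: o_def)
  have e': "continuous_map T U e"
    unfolding U_def
  proof (rule continuous_map_pullback')
    show "continuous_map T T (d \<circ> e)"
      by (rule continuous_map_eq[OF continuous_map_id]) (simp add: de topspace_eq)
  qed (auto simp: topspace_eq carH)
  have "homeomorphic_maps T U e d"
    using d e' by (auto simp: homeomorphic_maps_def topU carH de topspace_eq)
  then have homeo: "homeomorphic_map T U e" using homeomorphic_map_maps by blast
  have iso: "e \<in> iso G H"
    using e by (auto simp: iso_def hom_def H_def de bij_betw_def)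
  have inv: "inv\<^bsub>H\<^esub> x = e (inv (d x))" if "x \<in> carrier H" for x
    by (rule group.inv_equality[OF gH]) (use that in \<open>auto simp: H_def de\<close>)
  have "continuous_map (prod_topology U U) U (\<lambda>p. e (d (fst p) \<otimes> d (snd p)))"
  proof -
    have "continuous_map (prod_topology U U) T (\<lambda>p. d (fst p) \<otimes> d (snd p))"
      using continuous_map_compose[OF continuous_map_fst d] continuous_map_compose[OF continuous_map_snd d]
      by (intro continuous_mult2) (simp_all add: o_def)
    from continuous_map_compose[OF this e'] show ?thesis by (simp add: o_def)
  qed
  moreover have "continuous_map U U (\<lambda>x. inv\<^bsub>H\<^esub> x)"
    using continuous_map_compose[OF continuous_inv_compose[OF d] e']
    by (rule continuous_map_eq) (simp add: topU inv)
  ultimately have "topological_group H U"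
    using gH topU by (simp add: topological_group_def case_prod_unfold) (simp add: H_def)
  moreover have "topological_group_iso G T H U"
    using iso homeo by (auto simp: topological_group_iso_def)
  ultimately show ?thesis by (rule that)
qed

text \<open>Presentations consist of numbers and are invariant under isomorphism, as is compactness.
  So algorithms that serve all groups of sequences serve, by the embedding, the groups with elements
  of any type.\<close>

lemma uniform_translations_transfer:
  assumes u: "uniform_translations TYPE(nat \<Rightarrow> nat) a b c"
  shows "uniform_translations TYPE('g) a b c"
  unfolding uniform_translations_def
proof (intro allI impI, goal_cases)
  case (1 G T)
  note G = this
  then have tG: "topological_group G T" by (simp add: tdlc_group_def)
  obtain H :: "(nat \<Rightarrow> nat) monoid" and U where tH: "topological_group H U"
    and GH: "topological_group_iso G T H U"
    using tdlc_group_embed[OF G] .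
  have HG: "topological_group_iso H U G T" using topological_group_iso_sym[OF GH tG tH] .
  have H: "tdlc_group H U" using tdlc_group_iso[OF GH tH G] .
  obtain f where "top_group_iso G T H U f" using topological_group_iso_obtain[OF GH tG tH] .
  then interpret f: top_group_iso G T H U f .
  obtain g where "top_group_iso H U G T g" using topological_group_iso_obtain[OF HG tH tG] .
  then interpret g: top_group_iso H U G T g .
  have cpt: "compact_space U \<longleftrightarrow> compact_space T"
    using f.f_homeo homeomorphic_map_imp_homeomorphic_space homeomorphic_compact_space by blast
  have *: "(\<forall>p. closed_subgroup_presentation H U p \<longrightarrow>
          (\<exists>q. phi a p = Some q \<and> meet_groupoid_presentation H U q)) \<and>
     (\<forall>q. \<not> compact_space U \<and> meet_groupoid_presentation H U q \<longrightarrow>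
          (\<exists>p. phi b q = Some p \<and> closed_subgroup_presentation H U p)) \<and>
     (\<forall>M \<theta> q u. meet_groupoid_presentation_via H U M \<theta> q \<and> u \<in> mdom M \<and> \<theta> u = carrier H \<longrightarrow>
          (\<exists>p. phi c (prod_encode (q, u)) = Some p \<and> closed_subgroup_presentation H U p))"
    using u H unfolding uniform_translations_def by blast
  have cl: "closed_subgroup_presentation G T p \<longleftrightarrow> closed_subgroup_presentation H U p" for p
    using closed_subgroup_presentation_iso[OF GH] closed_subgroup_presentation_iso[OF HG] by blast
  have mg: "meet_groupoid_presentation G T q \<longleftrightarrow> meet_groupoid_presentation H U q" for q
    unfolding meet_groupoid_presentation_def
    using f.presentation_via_image g.presentation_via_image by blast
  show ?case
  proof (intro conjI allI impI)
    fix M \<theta> q u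
    assume "meet_groupoid_presentation_via G T M \<theta> q \<and> u \<in> mdom M \<and> \<theta> u = carrier G"
    then have "meet_groupoid_presentation_via H U M (\<lambda>x. f ` \<theta> x) q" "u \<in> mdom M" "f ` \<theta> u = carrier H"
      using f.presentation_via_image f.f_image by auto
    then show "\<exists>p. phi c (prod_encode (q, u)) = Some p \<and> closed_subgroup_presentation G T p"
      using * unfolding cl by blast
  qed (use * cpt in \<open>auto simp: cl mg\<close>)
qed


section \<open>Closed subgroups of the symmetric group and their trees\<close>

abbreviation restr :: "(nat \<Rightarrow> nat) \<Rightarrow> nat \<Rightarrow> nat list" where
  "restr f n \<equiv> map f [0..<n]"

lemma initial_of_eq: "initial_of \<sigma> f \<longleftrightarrow> \<sigma> = restr f (length \<sigma>)"
proof -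
  have "\<sigma> = restr f (length \<sigma>) \<longleftrightarrow> (\<forall>i<length \<sigma>. f i = \<sigma> ! i)"
    unfolding list_eq_iff_nth_eq[of \<sigma>] by auto
  then show ?thesis unfolding initial_of_def by (rule sym)
qed

lemma initial_of_iff_prefix:
  assumes "length \<sigma> \<le> n" shows "initial_of \<sigma> f \<longleftrightarrow> prefix \<sigma> (restr f n)"
proof -
  have "restr f n = restr f (length \<sigma>) @ map f [length \<sigma>..<n]"
    using assms by (metis le_add_diff_inverse map_append upt_add_eq_append zero_le)
  moreover have "prefix \<sigma> (\<rho> @ \<rho>') \<longleftrightarrow> \<sigma> = \<rho>" if "length \<rho> = length \<sigma>" for \<rho> \<rho>'
    using that by (auto simp: prefix_def)
  ultimately show ?thesis unfolding initial_of_eq by simp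
qed

text \<open>Relates the interleaved strings in \<open>Tree_Sinf\<close> to initial segments of
  functions. The induction removes the first two entries, so the function is shifted by 2.\<close>

lemma splice_restr:
  "splice (map (\<lambda>i. f (2 * i)) [0..<m]) (map (\<lambda>i. f (2 * i + 1)) [0..<m]) = restr f (2 * m)"
proof (induction m arbitrary: f)
  case (Suc m)
  have upt: "[0..<Suc n] = 0 # map Suc [0..<n]" for n
    by (simp add: upt_conv_Cons map_Suc_upt del: upt_Suc)
  have "[0..<2 * Suc m] = 0 # 1 # map (\<lambda>i. i + 2) [0..<2 * m]"
    by (simp add: upt o_def del: upt_Suc)
  with Suc.IH[of "\<lambda>i. f (i + 2)"] show ?case
    by (simp add: upt o_def del: upt_Suc)
qed simp

lemma splice_eq_restr:
  assumes "length \<sigma> = length \<tau>"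
  shows "splice \<sigma> \<tau> = restr (\<lambda>i. if even i then \<sigma> ! (i div 2) else \<tau> ! (i div 2)) (2 * length \<sigma>)"
proof -
  have "splice (map (\<lambda>i. \<sigma> ! i) [0..<length \<sigma>]) (map (\<lambda>i. \<tau> ! i) [0..<length \<sigma>]) =
      restr (\<lambda>i. if even i then \<sigma> ! (i div 2) else \<tau> ! (i div 2)) (2 * length \<sigma>)"
    by (subst splice_restr[symmetric]) simp
  then show ?thesis using assms by (metis map_nth)
qed

text \<open>The even and the odd part are inverse to each other. Each single equation involves only
  two values of \<open>f\<close> and is therefore visible on strings, unlike a statement with
  \<open>bij\<close> and \<open>inv_into\<close>.\<close>

definition inverse_pairs :: "(nat \<Rightarrow> nat) set" where
  "inverse_pairs = {f. \<forall>i. f (2 * f (2 * i) + 1) = i \<and> f (2 * f (2 * i + 1)) = i}"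

lemma carrier_Sinf: "carrier Sinf = inverse_pairs"
proof (intro Set.set_eqI iffI)
  fix f assume "f \<in> carrier Sinf"
  then obtain h where "f = interleave h (inv_into UNIV h)" "bij h" by (auto simp: Sinf_def)
  then show "f \<in> inverse_pairs"
    by (auto simp: inverse_pairs_def interleave_def bij_is_inj bij_is_surj surj_f_inv_f)
next
  fix f assume "f \<in> inverse_pairs"
  then have *: "f (2 * f (2 * i) + 1) = i" "f (2 * f (2 * i + 1)) = i" for i
    by (auto simp: inverse_pairs_def)
  define h where "h = (\<lambda>i. f (2 * i))"
  have bij: "bij h"
    by (rule bij_betw_byWitness[where f'="\<lambda>i. f (2 * i + 1)"]) (use * in \<open>auto simp: h_def\<close>)
  have inv: "inv_into UNIV h i = f (2 * i + 1)" for i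
    by (rule inv_f_eq) (use bij * in \<open>auto simp: h_def bij_is_inj\<close>)
  have "f = interleave h (inv_into UNIV h)"
  proof
    fix n show "f n = interleave h (inv_into UNIV h) n"
      by (cases "even n") (auto simp: interleave_def inv elim!: oddE, simp add: h_def)
  qed
  then show "f \<in> carrier Sinf" using bij by (auto simp: Sinf_def)
qed

text \<open>Multiplication entry by entry: an entry of the product needs two values, one of which
  tells where to look up the other. Continuity and the finite checks on strings rest on
  this.\<close>

definition mult_S :: "(nat \<Rightarrow> nat) \<Rightarrow> (nat \<Rightarrow> nat) \<Rightarrow> nat \<Rightarrow> nat" where
  "mult_S g f n = (if even n then g (2 * f n) else f (2 * g n + 1))"

definition inv_S :: "(nat \<Rightarrow> nat) \<Rightarrow> nat \<Rightarrow> nat" where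
  "inv_S f n = f (if even n then n + 1 else n - 1)"

lemma mult_Sinf: "g \<otimes>\<^bsub>Sinf\<^esub> f = mult_S g f"
  by (rule ext) (auto simp: Sinf_def mult_S_def interleave_def left_part_def right_part_def elim!: evenE oddE)

lemma one_Sinf: "\<one>\<^bsub>Sinf\<^esub> n = n div 2"
  by (simp add: Sinf_def interleave_def)

lemma group_Sinf: "group Sinf"
proof (rule groupI)
  show "f \<otimes>\<^bsub>Sinf\<^esub> g \<in> carrier Sinf" if "f \<in> carrier Sinf" "g \<in> carrier Sinf" for f g
    using that by (simp add: carrier_Sinf mult_Sinf inverse_pairs_def mult_S_def)
  show "\<one>\<^bsub>Sinf\<^esub> \<in> carrier Sinf"
    by (simp add: carrier_Sinf inverse_pairs_def one_Sinf)
  show "f \<otimes>\<^bsub>Sinf\<^esub> g \<otimes>\<^bsub>Sinf\<^esub> h = f \<otimes>\<^bsub>Sinf\<^esub> (g \<otimes>\<^bsub>Sinf\<^esub> h)" for f g h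
    by (rule ext) (simp add: mult_Sinf mult_S_def)
  show "\<one>\<^bsub>Sinf\<^esub> \<otimes>\<^bsub>Sinf\<^esub> f = f" for f
    by (rule ext) (auto simp: mult_Sinf mult_S_def one_Sinf elim!: oddE)
  fix f assume f: "f \<in> carrier Sinf"
  have "inv_S f \<in> carrier Sinf" "inv_S f \<otimes>\<^bsub>Sinf\<^esub> f = \<one>\<^bsub>Sinf\<^esub>"
    using f by (auto simp: carrier_Sinf inverse_pairs_def inv_S_def mult_Sinf mult_S_def one_Sinf fun_eq_iff
        elim!: evenE oddE)
  then show "\<exists>g\<in>carrier Sinf. g \<otimes>\<^bsub>Sinf\<^esub> f = \<one>\<^bsub>Sinf\<^esub>" by blast
qed

lemma inv_Sinf:
  assumes "f \<in> carrier Sinf" shows "inv\<^bsub>Sinf\<^esub> f = inv_S f"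
  using assms
  by (intro group.inv_equality[OF group_Sinf])
    (auto simp: carrier_Sinf inverse_pairs_def inv_S_def mult_Sinf mult_S_def one_Sinf fun_eq_iff
        elim!: evenE oddE)

lemma restr_in_Tree_Sinf:
  assumes "f \<in> carrier Sinf" shows "restr f n \<in> Tree_Sinf"
proof -
  have f: "f (2 * f (2 * i) + 1) = i" "f (2 * f (2 * i + 1)) = i" for i
    using assms by (auto simp: carrier_Sinf inverse_pairs_def)
  define \<sigma> where "\<sigma> = map (\<lambda>i. f (2 * i)) [0..<n]"
  define \<tau> where "\<tau> = map (\<lambda>i. f (2 * i + 1)) [0..<n]"
  have "inj (\<lambda>i. f (2 * i))" "inj (\<lambda>i. f (2 * i + 1))"
    by (rule inj_on_inverseI[where g="\<lambda>i. f (2 * i + 1)"], simp add: f[simplified])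
      (rule inj_on_inverseI[where g="\<lambda>i. f (2 * i)"], simp add: f[simplified])
  then have "distinct \<sigma>" "distinct \<tau>"
    by (auto simp: \<sigma>_def \<tau>_def distinct_map intro: inj_on_subset)
  moreover have "prefix (restr f n) (splice \<sigma> \<tau>)"
    unfolding \<sigma>_def \<tau>_def splice_restr using initial_of_iff_prefix[of "restr f n" "2 * n" f]
    by (simp add: initial_of_def)
  moreover have "\<forall>k<length \<tau>. \<tau> ! k < length \<sigma> \<longrightarrow> \<sigma> ! (\<tau> ! k) = k"
    "\<forall>i<length \<sigma>. \<sigma> ! i < length \<tau> \<longrightarrow> \<tau> ! (\<sigma> ! i) = i"
    using f by (simp_all add: \<sigma>_def \<tau>_def)
  ultimately show ?thesis
    unfolding Tree_Sinf_def by (intro CollectI exI[of _ \<sigma>] exI[of _ \<tau>]) (simp add: \<sigma>_def \<tau>_def)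
qed

text \<open>Paths belong to the group because the strings assert the inverse equations as far as
  they are defined, and each single equation is covered by a long enough initial segment.\<close>

lemma paths_Tree_Sinf: "paths Tree_Sinf = carrier Sinf"
proof
  show "carrier Sinf \<subseteq> paths Tree_Sinf"
    using restr_in_Tree_Sinf by (auto simp: paths_def)
  show "paths Tree_Sinf \<subseteq> carrier Sinf"
  proof
    fix f assume "f \<in> paths Tree_Sinf"
    then have f: "restr f n \<in> Tree_Sinf" for n by (simp add: paths_def)
    have "f (2 * f (2 * i) + 1) = i \<and> f (2 * f (2 * i + 1)) = i" for i
    proof -
      \<comment> \<open>Beyond all positions that the two equations for i read: 2 i, 2 i + 1, 2 f(2
        i) + 1 and 2 f(2 i + 1).\<close>
      define n where "n = 2 * f (2 * i) + 2 * f (2 * i + 1) + 2 * i + 3"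
      obtain \<sigma> \<tau> where len: "length \<sigma> = length \<tau>" and 1: "\<And>k. k < length \<tau> \<Longrightarrow> \<tau> ! k < length \<sigma> \<Longrightarrow> \<sigma> ! (\<tau> ! k) = k"
        and 2: "\<And>i. i < length \<sigma> \<Longrightarrow> \<sigma> ! i < length \<tau> \<Longrightarrow> \<tau> ! (\<sigma> ! i) = i"
        and pre: "prefix (restr f n) (splice \<sigma> \<tau>)"
        using f[of n] by (auto simp: Tree_Sinf_def)
      have n: "n \<le> 2 * length \<sigma>"
        using prefix_length_le[OF pre] by (simp add: splice_eq_restr[OF len])
      have eq: "f k = (if even k then \<sigma> ! (k div 2) else \<tau> ! (k div 2))" if "k < n" for k
      proof -
        have "initial_of (restr f n) (\<lambda>i. if even i then \<sigma> ! (i div 2) else \<tau> ! (i div 2))"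
          using initial_of_iff_prefix[of "restr f n" "2 * length \<sigma>"] n pre by (simp add: splice_eq_restr[OF len])
        then show ?thesis using that by (auto simp: initial_of_def)
      qed
      have \<sigma>: "\<sigma> ! k = f (2 * k)" if "2 * k < n" for k using eq[of "2 * k"] that by simp
      have \<tau>: "\<tau> ! k = f (2 * k + 1)" if "2 * k + 1 < n" for k using eq[of "2 * k + 1"] that by simp
      have "\<tau> ! (\<sigma> ! i) = i"
        by (rule 2) (use n len in \<open>auto simp: \<sigma> n_def\<close>)
      moreover have "\<sigma> ! (\<tau> ! i) = i"
        by (rule 1) (use n len in \<open>auto simp: \<tau> n_def\<close>)
      moreover have "2 * f (2 * i) + 1 < n" "2 * f (2 * i + 1) < n" "2 * i + 1 < n" "2 * i < n"
        by (simp_all add: n_def)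
      ultimately show ?thesis by (simp add: \<sigma> \<tau>)
    qed
    then show "f \<in> carrier Sinf" by (simp add: carrier_Sinf inverse_pairs_def)
  qed
qed

section \<open>Cylinders and the topology of Baire space\<close>

definition cyl :: "(nat \<Rightarrow> nat) set \<Rightarrow> nat list \<Rightarrow> (nat \<Rightarrow> nat) set" where
  "cyl C \<sigma> = {f \<in> C. initial_of \<sigma> f}"

lemma Tree_of_iff:
  assumes "C \<subseteq> carrier Sinf"
  shows "\<eta> \<in> Tree_of C \<longleftrightarrow> (\<exists>f\<in>C. initial_of \<eta> f)"
proof
  assume "\<exists>f\<in>C. initial_of \<eta> f"
  then obtain f where f: "f \<in> C" "initial_of \<eta> f" by blast
  moreover from f have "\<eta> \<in> Tree_Sinf"
    using restr_in_Tree_Sinf[of f "length \<eta>"] assms by (auto simp: initial_of_eq)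
  ultimately show "\<eta> \<in> Tree_of C"
    using assms by (auto simp: Tree_of_def paths_through_def paths_Tree_Sinf)
qed (auto simp: Tree_of_def paths_through_def)

lemma open_initial_of: "open {f. initial_of \<sigma> f}"
proof -
  have "open ((\<lambda>f :: nat \<Rightarrow> nat. f i) -` {\<sigma> ! i})" for i
    by (intro open_vimage continuous_on_product_coordinates) (simp add: open_discrete)
  then have "open (\<Inter>i\<in>{..<length \<sigma>}. (\<lambda>f. f i) -` {\<sigma> ! i})"
    by (intro open_INT) auto
  moreover have "{f. initial_of \<sigma> f} = (\<Inter>i\<in>{..<length \<sigma>}. (\<lambda>f. f i) -` {\<sigma> ! i})"
    by (auto simp: initial_of_def)
  ultimately show ?thesis by simp
qed

lemma closed_initial_of: "closed {f. initial_of \<sigma> f}"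
proof -
  have "closed ((\<lambda>f :: nat \<Rightarrow> nat. f i) -` {\<sigma> ! i})" for i
    by (intro closed_vimage continuous_on_product_coordinates) simp
  then have "closed (\<Inter>i\<in>{..<length \<sigma>}. (\<lambda>f. f i) -` {\<sigma> ! i})"
    by (intro closed_INT) auto
  moreover have "{f. initial_of \<sigma> f} = (\<Inter>i\<in>{..<length \<sigma>}. (\<lambda>f. f i) -` {\<sigma> ! i})"
    by (auto simp: initial_of_def)
  ultimately show ?thesis by simp
qed

text \<open>A basic neighbourhood in a product restricts finitely many coordinates, and a long
  enough initial segment of f fixes them all.\<close>

lemma open_imp_initial_of:
  assumes "open U" "f \<in> U"
  shows "\<exists>n. \<forall>g. initial_of (restr f n) g \<longrightarrow> g \<in> U"
proof -
  from assms obtain X where X: "f \<in> (\<Pi>\<^sub>E i\<in>UNIV. X i)"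
      "finite {i. X i \<noteq> (UNIV :: nat set)}" "(\<Pi>\<^sub>E i\<in>UNIV. X i) \<subseteq> U"
    using product_topology_open_contains_basis[of "\<lambda>_. euclidean" UNIV U f]
    by (auto simp: open_fun_def)
  obtain n where n: "\<And>i. X i \<noteq> UNIV \<Longrightarrow> i < n"
    using finite_nat_set_iff_bounded[THEN iffD1, OF X(2)] by blast
  have "g \<in> U" if g: "initial_of (restr f n) g" for g
  proof -
    have "g i \<in> X i" for i
    proof (cases "i < n")
      case True
      then have "g i = f i" using g by (simp add: initial_of_def)
      then show ?thesis using X(1) by (auto simp: PiE_iff)
    next
      case False
      then have "X i = UNIV" using n by blast
      then show ?thesis by simp
    qed
    then show ?thesis using X(3) by (auto simp: PiE_iff)
  qed
  then show ?thesis by blast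
qed

lemma openin_initial_of:
  assumes "openin (top_of_set C) A" "f \<in> A"
  obtains n where "cyl C (restr f n) \<subseteq> A"
proof -
  obtain U where "open U" "A = C \<inter> U" using assms(1) by (auto simp: openin_open)
  with open_imp_initial_of[of U f] assms(2) that show ?thesis by (auto simp: cyl_def)
qed

lemma openin_cyl: "openin (top_of_set C) (cyl C \<sigma>)"
  using open_initial_of[of \<sigma>] by (auto simp: openin_open cyl_def)

lemma continuous_eval: "continuous_on A (\<lambda>f :: nat \<Rightarrow> nat. f n)"
  using continuous_on_product_coordinates by (rule continuous_on_subset) simp

text \<open>Near a pair q the values of both factors at n are constant, hence so is the position
  where the product looks up its entry; four coordinates fixed near q fix the entry.\<close>

lemma continuous_mult_S: "continuous_on A (\<lambda>p. mult_S (fst p) (snd p))"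
proof (rule continuous_on_coordinatewise_then_product)
  fix n
  have ev: "\<forall>\<^sub>F p in at q within A. fst p m = fst q m" "\<forall>\<^sub>F p in at q within A. snd p m = snd q m"
    if "q \<in> A" for q :: "(nat \<Rightarrow> nat) \<times> (nat \<Rightarrow> nat)" and m
  proof -
    have "continuous_on A (\<lambda>p. fst p m)" "continuous_on A (\<lambda>p. snd p m)"
      by (rule continuous_on_compose2[OF continuous_eval[of UNIV] continuous_on_fst[OF continuous_on_id]], simp)
        (rule continuous_on_compose2[OF continuous_eval[of UNIV] continuous_on_snd[OF continuous_on_id]], simp)
    then show "\<forall>\<^sub>F p in at q within A. fst p m = fst q m" "\<forall>\<^sub>F p in at q within A. snd p m = snd q m"
      using that by (auto simp: continuous_on_def tendsto_discrete)
  qed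
  show "continuous_on A (\<lambda>p. mult_S (fst p) (snd p) n)"
    unfolding continuous_on_def tendsto_discrete
  proof
    fix q :: "(nat \<Rightarrow> nat) \<times> (nat \<Rightarrow> nat)" assume q: "q \<in> A"
    show "\<forall>\<^sub>F p in at q within A. mult_S (fst p) (snd p) n = mult_S (fst q) (snd q) n"
      using ev(1)[OF q, of n] ev(2)[OF q, of n] ev(1)[OF q, of "2 * snd q n"] ev(2)[OF q, of "2 * fst q n + 1"]
      by eventually_elim (simp add: mult_S_def)
  qed
qed

lemma continuous_inv_S: "continuous_on A inv_S"
  unfolding inv_S_def by (intro continuous_on_coordinatewise_then_product continuous_eval)

section \<open>Closed subgroups as topological groups, and their trees\<close>

locale closed_subgroup =
  fixes C :: "(nat \<Rightarrow> nat) set"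
  assumes closed_subgroup: "closed_subgroup_Sinf C"
begin

abbreviation "GC \<equiv> Sinf\<lparr>carrier := C\<rparr>"
abbreviation "TC \<equiv> top_of_set C"

lemma subgroup_C: "subgroup C Sinf"
  using closed_subgroup by (simp add: closed_subgroup_Sinf_def)

lemma C_carrier: "C \<subseteq> carrier Sinf"
  using subgroup_C by (rule subgroup.subset)

lemma group_GC: "group GC"
  using subgroup.subgroup_is_group[OF subgroup_C group_Sinf] .

lemma inv_GC: "f \<in> C \<Longrightarrow> inv\<^bsub>GC\<^esub> f = inv_S f"
  using group.m_inv_consistent[OF group_Sinf subgroup_C] inv_Sinf C_carrier by auto

lemma inv_S_closed: "f \<in> C \<Longrightarrow> inv_S f \<in> C"
  using subgroup.m_inv_closed[OF subgroup_C, of f] inv_Sinf[of f] C_carrier by auto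

lemma mult_S_closed: "f \<in> C \<Longrightarrow> g \<in> C \<Longrightarrow> mult_S f g \<in> C"
  using subgroup.m_closed[OF subgroup_C] by (simp add: mult_Sinf)

sublocale CG: top_group GC TC
proof -
  have "continuous_map (prod_topology TC TC) TC (\<lambda>p. mult_S (fst p) (snd p))"
    using continuous_mult_S mult_S_closed
    by (auto simp: subtopology_Times[symmetric] prod_topology_subtopology_eu)
  moreover have "continuous_map TC TC (\<lambda>x. inv\<^bsub>GC\<^esub> x)"
  proof (rule continuous_map_eq)
    show "continuous_map TC TC inv_S" using continuous_inv_S inv_S_closed by auto
  qed (simp add: inv_GC)
  ultimately show "top_group GC TC"
    using group_GC by (simp add: top_group_def top_group_axioms_def case_prod_unfold mult_Sinf)
qed

lemma Tree_of_iff_C: "\<eta> \<in> Tree_of C \<longleftrightarrow> cyl C \<eta> \<noteq> {}"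
  using Tree_of_iff[OF C_carrier] by (auto simp: cyl_def)

lemma restr_in_Tree_of: "f \<in> C \<Longrightarrow> restr f n \<in> Tree_of C"
  by (auto simp: Tree_of_iff_C cyl_def initial_of_def)

text \<open>C is closed relative to the symmetric group. So a path is first placed in the symmetric
  group, being a path of \<open>Tree_Sinf\<close>; if it were not in C, one of its initial segments
  would already exclude all elements of C.\<close>

lemma paths_Tree_of: "paths (Tree_of C) = C"
proof
  show "C \<subseteq> paths (Tree_of C)" using restr_in_Tree_of by (auto simp: paths_def)
  show "paths (Tree_of C) \<subseteq> C"
  proof
    fix f assume f: "f \<in> paths (Tree_of C)"
    have "restr f n \<in> Tree_Sinf" for n
      using f by (auto simp: paths_def Tree_of_def)
    then have car: "f \<in> carrier Sinf" by (auto simp: paths_def simp flip: paths_Tree_Sinf)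
    obtain Z where Z: "closed Z" "C = carrier Sinf \<inter> Z"
      using closed_subgroup by (auto simp: closed_subgroup_Sinf_def closedin_closed)
    show "f \<in> C"
    proof (rule ccontr)
      assume "f \<notin> C"
      then obtain n where n: "\<And>g. initial_of (restr f n) g \<Longrightarrow> g \<in> - Z"
        using open_imp_initial_of[of "- Z" f] Z car by auto
      have "cyl C (restr f n) \<noteq> {}" using f by (simp add: paths_def flip: Tree_of_iff_C)
      then obtain g where "g \<in> C" "initial_of (restr f n) g" by (auto simp: cyl_def)
      then show False using n Z(2) by blast
    qed
  qed
qed

lemma paths_through_eq: "paths_through (Tree_of C) \<sigma> = cyl C \<sigma>"
  by (simp add: paths_through_def paths_Tree_of cyl_def)

lemma cyl_mono: "prefix \<sigma> \<rho> \<Longrightarrow> cyl C \<rho> \<subseteq> cyl C \<sigma>"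
  by (auto simp: cyl_def prefix_def initial_of_def nth_append)

lemma is_tree_Tree_of: "is_tree (Tree_of C)"
proof -
  have "[] \<in> Tree_of C" using subgroup.one_closed[OF subgroup_C] by (auto simp: Tree_of_iff_C cyl_def initial_of_def)
  moreover have "\<rho> \<in> Tree_of C" if "\<sigma> \<in> Tree_of C" "prefix \<rho> \<sigma>" for \<rho> \<sigma>
    using that cyl_mono[OF that(2)] by (auto simp: Tree_of_iff_C)
  ultimately show ?thesis by (auto simp: is_tree_def)
qed

lemma leafless_Tree_of: "leafless (Tree_of C)"
  unfolding leafless_def
proof
  fix \<sigma> assume "\<sigma> \<in> Tree_of C"
  then obtain f where f: "f \<in> C" "initial_of \<sigma> f" by (auto simp: Tree_of_iff_C cyl_def)
  then have "strict_prefix \<sigma> (restr f (Suc (length \<sigma>)))"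
    using initial_of_iff_prefix[of \<sigma> "Suc (length \<sigma>)" f] arg_cong[of \<sigma> "restr f (Suc (length \<sigma>))" length]
    unfolding strict_prefix_def by (metis Suc_n_not_le_n diff_zero le_SucI length_map length_upt order_refl)
  then show "\<exists>\<rho>\<in>Tree_of C. strict_prefix \<sigma> \<rho>" using restr_in_Tree_of[OF f(1)] by blast
qed

lemma compact_cyl_mono:
  assumes "compact (cyl C \<sigma>)" "prefix \<sigma> \<rho>" shows "compact (cyl C \<rho>)"
proof -
  have "cyl C \<rho> = cyl C \<sigma> \<inter> {f. initial_of \<rho> f}"
    using cyl_mono[OF assms(2)] by (auto simp: cyl_def)
  then show ?thesis using compact_Int_closed[OF assms(1) closed_initial_of] by simp
qed

end


section \<open>A copy of the meet groupoid of a closed subgroup\<close>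

context top_group
begin

text \<open>If A^-1 A \<subseteq> V and A V \<subseteq> A, then x y^-1 z = x (y^-1 z) is in A V and
  so in A; the first inclusion puts the right group into V, the second puts V into the right group.
  Each inclusion concerns a product of two factors.\<close>

lemma coset_right_group_iff:
  assumes "compactin T A" "openin T A" "A \<noteq> {}" "V \<subseteq> carrier G"
  shows "coset A \<and> V = right_group A \<longleftrightarrow>
    (\<forall>x\<in>A. \<forall>y\<in>A. inv x \<otimes> y \<in> V) \<and> (\<forall>x\<in>A. \<forall>v\<in>V. x \<otimes> v \<in> A)" (is "?L \<longleftrightarrow> ?R")
proof
  assume L: ?L
  then have "x \<otimes> v \<in> A" if "x \<in> A" "v \<in> V" for x v
    using mem_right_group[of A x v] that by blast
  then show ?R using L by (auto simp: right_group_def)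
next
  assume R: ?R
  have A: "x \<in> carrier G" if "x \<in> A" for x using openin_carrier[OF assms(2)] that by blast
  have "x \<otimes> inv y \<otimes> z \<in> A" if "x \<in> A" "y \<in> A" "z \<in> A" for x y z
    using R that A by (simp add: m_assoc)
  then have c: "coset A" using assms by (simp add: coset_def)
  obtain a where a: "a \<in> A" using assms(3) by blast
  have "x \<in> V \<longleftrightarrow> x \<in> right_group A" for x
  proof -
    have "x \<in> V" if "x \<in> carrier G" "a \<otimes> x \<in> A"
    proof -
      have "inv a \<otimes> (a \<otimes> x) \<in> V" using R a that(2) by blast
      then show ?thesis using A[OF a] that(1) by simp
    qed
    then show ?thesis using R a assms(4) unfolding mem_right_group[OF c a] by blast
  qed
  then have "V = right_group A" by blast
  then show ?L using c by blast
qed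

text \<open>A set Z that contains A B equals it as soon as A^-1 Z \<subseteq> B, since z = a (a^-1
  z). Again only products of two factors are compared, so the product can be found by a
  search.\<close>

lemma set_mult_eq_iff:
  assumes "coset A" "coset B" "right_group A = left_group B" "Z \<subseteq> carrier G"
  shows "Z = A <#> B \<longleftrightarrow> (\<forall>a\<in>A. \<forall>b\<in>B. a \<otimes> b \<in> Z) \<and> (\<forall>a\<in>A. \<forall>z\<in>Z. inv a \<otimes> z \<in> B)"
    (is "?L \<longleftrightarrow> ?R")
proof
  assume L: ?L
  have "inv a \<otimes> z \<in> B" if "a \<in> A" "z \<in> Z" for a z
    using L that set_mult_eq_l_coset[OF assms(1-3) that(1)] cosetD(4)[OF assms(1)]
      mem_l_coset[OF cosetD(4)[OF assms(2)], of a z] by blast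
  then show ?R using L by (auto simp: set_mult_def)
next
  assume R: ?R
  obtain a where a: "a \<in> A" "a \<in> carrier G" using cosetD[OF assms(1)] by blast
  have "A <#> B \<subseteq> Z" using R by (auto simp: set_mult_def)
  moreover have "Z \<subseteq> A <#> B"
    unfolding set_mult_eq_l_coset[OF assms(1-3) a(1)]
    using R a assms(4) by (auto simp: mem_l_coset cosetD(4)[OF assms(2)])
  ultimately show ?L by blast
qed

text \<open>A right coset of W is determined by any of its elements. So a family of such cosets
  inside U that covers U omits none, and completeness of a list of cosets is an inclusion between
  sets.\<close>

lemma right_cosets_partition:
  assumes U: "compact_open_subgroup G T U" and W: "compact_open_subgroup G T W"
    and E: "\<And>B. B \<in> \<E> \<Longrightarrow> coset B \<and> left_group B = W \<and> B \<subseteq> U" and cover: "U \<subseteq> \<Union>\<E>"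
  shows "\<E> = (\<lambda>a. W #> a) ` U"
proof (intro Set.set_eqI iffI)
  have sub: "W \<subseteq> carrier G" using W cosetD(4) by (auto simp: compact_open_subgroup_iff)
  fix B
  show "B \<in> (\<lambda>a. W #> a) ` U" if "B \<in> \<E>"
  proof -
    have B: "coset B" "left_group B = W" "B \<subseteq> U" using E[OF that] by auto
    obtain b where b: "b \<in> B" using cosetD(3)[OF B(1)] by blast
    then have "B = W #> b" using coset_eq_r_coset[OF B(1) b] B(2) by simp
    then show ?thesis using b B(3) by blast
  qed
  show "B \<in> \<E>" if B: "B \<in> (\<lambda>a. W #> a) ` U"
  proof -
    obtain a where a: "a \<in> U" "B = W #> a" using B by blast
    obtain B' where "B' \<in> \<E>" "a \<in> B'" using a cover by blast
    then show ?thesis using E[of B'] coset_eq_r_coset[of B' a] a by simp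
  qed
qed

lemma finite_right_cosets:
  assumes U: "compact_open_subgroup G T U" and W: "compact_open_subgroup G T W"
  shows "finite ((\<lambda>a. W #> a) ` U)"
proof -
  have car: "U \<subseteq> carrier G" using U cosetD(4) by (auto simp: compact_open_subgroup_iff)
  have self: "a \<in> W #> a" if "a \<in> U" for a
    using W car that by (intro rcos_self) (auto simp: compact_open_subgroup_def)
  have "\<exists>F. finite F \<and> F \<subseteq> (\<lambda>a. W #> a) ` U \<and> U \<subseteq> \<Union>F"
  proof -
    have "compactin T U" using U by (simp add: compact_open_subgroup_def)
    moreover have "openin T B" if "B \<in> (\<lambda>a. W #> a) ` U" for B
      using that car W openin_r_coset by (auto simp: compact_open_subgroup_def)
    moreover have "U \<subseteq> \<Union>((\<lambda>a. W #> a) ` U)" using self by blast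
    ultimately show ?thesis unfolding compactin_def by meson
  qed
  then obtain F where F: "finite F" "F \<subseteq> (\<lambda>a. W #> a) ` U" "U \<subseteq> \<Union>F" by blast
  have "(\<lambda>a. W #> a) ` U \<subseteq> F"
  proof
    fix B assume "B \<in> (\<lambda>a. W #> a) ` U"
    then obtain a where a: "a \<in> U" "B = W #> a" by blast
    then obtain B' where B': "B' \<in> F" "a \<in> B'" using F by blast
    then obtain b where b: "b \<in> U" "B' = W #> b" using F by blast
    have "W #> b = W #> a"
      using repr_independence[of a W b] B' b car W by (auto simp: compact_open_subgroup_def)
    then show "B \<in> F" using a b B' by simp
  qed
  then show ?thesis using F(1) finite_subset by blast
qed

end

section \<open>Codes of compact open sets and finite checks on them\<close>

definition level :: "nat list list \<Rightarrow> nat" where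
  "level \<alpha> = sum_list (map length \<alpha>)"

lemma length_le_level: "\<sigma> \<in> set \<alpha> \<Longrightarrow> length \<sigma> \<le> level \<alpha>"
  unfolding level_def by (rule member_le_sum_list) simp_all

text \<open>Inversion exchanges the entries at 2 i and 2 i + 1. On a string of odd length the last
  entry has no partner and becomes the default 0, so this is applied at even lengths only.\<close>

definition swap_string :: "nat list \<Rightarrow> nat list" where
  "swap_string \<rho> = map (\<lambda>i. nth_default 0 \<rho> (if even i then i + 1 else i - 1)) [0..<length \<rho>]"

lemma swap_string_restr: "swap_string (restr f (2 * l)) = restr (inv_S f) (2 * l)"
  by (auto simp: swap_string_def inv_S_def nth_default_def)

lemma inv_S_inv_S: "inv_S (inv_S f) = f"
  by (rule ext) (auto simp: inv_S_def)

lemma inv_S_restr_eq: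
  assumes "restr f (2 * l) = restr g (2 * l)" shows "restr (inv_S f) (2 * l) = restr (inv_S g) (2 * l)"
  using assms by (metis swap_string_restr)

text \<open>The bound is an arbitrary function here; that it is computable is expressed by an oracle
  in \<open>tree_family\<close>.\<close>

locale bounded_tree = closed_subgroup +
  fixes H :: "nat list \<Rightarrow> nat \<Rightarrow> nat"
  assumes bound: "compact (cyl C \<sigma>) \<Longrightarrow> \<rho> \<in> Tree_of C \<Longrightarrow> prefix \<sigma> \<rho> \<Longrightarrow> i < length \<rho> \<Longrightarrow> \<rho> ! i \<le> H \<sigma> i"
begin

definition compact_string :: "nat list \<Rightarrow> bool" where
  "compact_string \<sigma> \<longleftrightarrow> \<sigma> \<in> Tree_of C \<and> compact (cyl C \<sigma>)"

definition valid :: "nat list list \<Rightarrow> bool" where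
  "valid \<alpha> \<longleftrightarrow> (\<forall>\<sigma>\<in>set \<alpha>. compact_string \<sigma>)"

definition region :: "nat list list \<Rightarrow> (nat \<Rightarrow> nat) set" where
  "region \<alpha> = (\<Union>\<sigma>\<in>set \<alpha>. cyl C \<sigma>)"

text \<open>The bound confines all extensions to a finite box of strings, from which membership in
  the tree picks the actual ones. Strings of \<open>\<alpha>\<close> longer than \<open>L\<close>
  contribute nothing, so \<open>L\<close> is taken to be at least
  \<open>level \<alpha>\<close>.\<close>

definition extend :: "nat list list \<Rightarrow> nat \<Rightarrow> nat list list" where
  "extend \<alpha> L = filter (\<lambda>\<rho>. \<rho> \<in> Tree_of C \<and> (\<exists>\<sigma>\<in>set \<alpha>. prefix \<sigma> \<rho>))
     (concat (map (\<lambda>\<sigma>. product_lists (map (\<lambda>i. [0..<Suc (H \<sigma> i)]) [0..<L])) \<alpha>))"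

lemma region_C: "region \<alpha> \<subseteq> C"
  by (auto simp: region_def cyl_def)

lemma set_extend:
  assumes "valid \<alpha>"
  shows "set (extend \<alpha> L) = {\<rho> \<in> Tree_of C. length \<rho> = L \<and> (\<exists>\<sigma>\<in>set \<alpha>. prefix \<sigma> \<rho>)}"
proof -
  have "\<rho> \<in> set (product_lists (map (\<lambda>i. [0..<Suc (H \<sigma> i)]) [0..<L])) \<longleftrightarrow>
      length \<rho> = L \<and> (\<forall>i<L. \<rho> ! i \<le> H \<sigma> i)" for \<rho> \<sigma>
    by (auto simp: product_lists_set list_all2_conv_all_nth less_Suc_eq_le simp del: upt_Suc)
  then have "\<rho> \<in> set (extend \<alpha> L) \<longleftrightarrow> \<rho> \<in> Tree_of C \<and> length \<rho> = L \<and>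
      (\<exists>\<sigma>\<in>set \<alpha>. prefix \<sigma> \<rho>) \<and> (\<exists>\<sigma>\<in>set \<alpha>. \<forall>i<L. \<rho> ! i \<le> H \<sigma> i)" for \<rho>
    by (auto simp: extend_def simp del: upt_Suc)
  moreover have "\<forall>i<length \<rho>. \<rho> ! i \<le> H \<sigma> i" if "\<sigma> \<in> set \<alpha>" "prefix \<sigma> \<rho>" "\<rho> \<in> Tree_of C" for \<sigma> \<rho>
    using assms bound that by (simp add: valid_def compact_string_def)
  ultimately show ?thesis by blast
qed

lemma mem_region:
  assumes "level \<alpha> \<le> L"
  shows "f \<in> region \<alpha> \<longleftrightarrow> f \<in> C \<and> (\<exists>\<sigma>\<in>set \<alpha>. prefix \<sigma> (restr f L))"
proof -
  have "initial_of \<sigma> f \<longleftrightarrow> prefix \<sigma> (restr f L)" if "\<sigma> \<in> set \<alpha>" for \<sigma>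
    using initial_of_iff_prefix[of \<sigma> L f] length_le_level[OF that] assms by simp
  then show ?thesis by (auto simp: region_def cyl_def)
qed

lemma restr_in_extend:
  assumes "valid \<alpha>" "level \<alpha> \<le> L" "f \<in> region \<alpha>" shows "restr f L \<in> set (extend \<alpha> L)"
  using assms restr_in_Tree_of by (auto simp: set_extend mem_region)

lemma extend_obtain:
  assumes "valid \<alpha>" "level \<alpha> \<le> L" "\<rho> \<in> set (extend \<alpha> L)"
  obtains f where "f \<in> region \<alpha>" "\<rho> = restr f L"
proof -
  have \<rho>: "\<rho> \<in> Tree_of C" "length \<rho> = L" "\<exists>\<sigma>\<in>set \<alpha>. prefix \<sigma> \<rho>"
    using assms by (auto simp: set_extend)
  then obtain f where f: "f \<in> C" "initial_of \<rho> f" by (auto simp: Tree_of_iff_C cyl_def)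
  then have "\<rho> = restr f L" using \<rho>(2) by (simp add: initial_of_eq)
  moreover from this have "f \<in> region \<alpha>" using \<rho>(3) f(1) by (simp add: mem_region[OF assms(2)])
  ultimately show ?thesis using that by blast
qed

definition region_le :: "nat list list \<Rightarrow> nat list list \<Rightarrow> bool" where
  "region_le \<alpha> \<beta> \<longleftrightarrow> (\<forall>\<rho>\<in>set (extend \<alpha> (level \<alpha> + level \<beta>)). \<exists>\<tau>\<in>set \<beta>. prefix \<tau> \<rho>)"

text \<open>At a length beyond all strings of both lists, a string decides membership in both
  regions; and as every string of the tree is passed by an element, each string in
  \<open>extend\<close> is an initial segment of some element of the region.\<close>

lemma region_le_iff:
  assumes "valid \<alpha>" shows "region_le \<alpha> \<beta> \<longleftrightarrow> region \<alpha> \<subseteq> region \<beta>"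
proof
  assume *: "region_le \<alpha> \<beta>"
  show "region \<alpha> \<subseteq> region \<beta>"
  proof
    fix f assume f: "f \<in> region \<alpha>"
    then show "f \<in> region \<beta>"
      using * restr_in_extend[OF assms _ f, of "level \<alpha> + level \<beta>"] region_C
      by (auto simp: region_le_def mem_region[of \<beta> "level \<alpha> + level \<beta>"])
  qed
next
  assume *: "region \<alpha> \<subseteq> region \<beta>"
  show "region_le \<alpha> \<beta>"
    unfolding region_le_def
  proof
    fix \<rho> assume "\<rho> \<in> set (extend \<alpha> (level \<alpha> + level \<beta>))"
    then obtain f where "f \<in> region \<alpha>" "\<rho> = restr f (level \<alpha> + level \<beta>)"
      using extend_obtain[OF assms] by (metis le_add1)
    then show "\<exists>\<tau>\<in>set \<beta>. prefix \<tau> \<rho>"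
      using * mem_region[of \<beta> "level \<alpha> + level \<beta>" f] by auto
  qed
qed

definition region_eq :: "nat list list \<Rightarrow> nat list list \<Rightarrow> bool" where
  "region_eq \<alpha> \<beta> \<longleftrightarrow> region_le \<alpha> \<beta> \<and> region_le \<beta> \<alpha>"

lemma region_eq_iff: "valid \<alpha> \<Longrightarrow> valid \<beta> \<Longrightarrow> region_eq \<alpha> \<beta> \<longleftrightarrow> region \<alpha> = region \<beta>"
  by (auto simp: region_eq_def region_le_iff)

definition meet_code :: "nat list list \<Rightarrow> nat list list \<Rightarrow> nat list list" where
  "meet_code \<alpha> \<beta> = filter (\<lambda>\<rho>. \<exists>\<tau>\<in>set \<beta>. prefix \<tau> \<rho>) (extend \<alpha> (level \<alpha> + level \<beta>))"

lemma valid_meet_code: "valid \<alpha> \<Longrightarrow> valid (meet_code \<alpha> \<beta>)"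
  using compact_cyl_mono
  by (fastforce simp: valid_def meet_code_def set_extend[unfolded valid_def] compact_string_def)

lemma region_meet_code:
  assumes "valid \<alpha>" shows "region (meet_code \<alpha> \<beta>) = region \<alpha> \<inter> region \<beta>"
proof (intro Set.set_eqI iffI)
  fix f
  assume "f \<in> region (meet_code \<alpha> \<beta>)"
  then obtain \<rho> where \<rho>: "\<rho> \<in> set (meet_code \<alpha> \<beta>)" "f \<in> C" "initial_of \<rho> f"
    by (auto simp: region_def cyl_def)
  then have "\<rho> = restr f (level \<alpha> + level \<beta>)"
    using assms by (auto simp: meet_code_def set_extend initial_of_eq)
  then show "f \<in> region \<alpha> \<inter> region \<beta>"
    using \<rho> assms mem_region[of \<alpha> "level \<alpha> + level \<beta>" f] mem_region[of \<beta> "level \<alpha> + level \<beta>" f]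
    by (auto simp: meet_code_def set_extend)
next
  fix f
  assume f: "f \<in> region \<alpha> \<inter> region \<beta>"
  then have "restr f (level \<alpha> + level \<beta>) \<in> set (meet_code \<alpha> \<beta>)"
    using restr_in_extend[OF assms, of "level \<alpha> + level \<beta>" f] mem_region[of \<beta> "level \<alpha> + level \<beta>" f]
    by (auto simp: meet_code_def)
  moreover have "f \<in> cyl C (restr f n)" for n using f region_C by (auto simp: cyl_def initial_of_def)
  ultimately show "f \<in> region (meet_code \<alpha> \<beta>)" unfolding region_def by blast
qed

text \<open>The strings are first extended to a common even length, at which swapping neighbours is
  inversion.\<close>

definition inv_code :: "nat list list \<Rightarrow> nat list list" where
  "inv_code \<alpha> = map swap_string (extend \<alpha> (2 * level \<alpha>))"

lemma mem_region_inv_code: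
  assumes "valid \<alpha>" shows "f \<in> region (inv_code \<alpha>) \<longleftrightarrow> f \<in> C \<and> inv_S f \<in> region \<alpha>"
proof
  assume "f \<in> region (inv_code \<alpha>)"
  then obtain \<rho> where \<rho>: "\<rho> \<in> set (extend \<alpha> (2 * level \<alpha>))" "f \<in> C" "initial_of (swap_string \<rho>) f"
    by (auto simp: region_def cyl_def inv_code_def)
  then obtain g where g: "g \<in> region \<alpha>" "\<rho> = restr g (2 * level \<alpha>)"
    using extend_obtain[OF assms] by (metis le_add2 mult_2)
  have "restr (inv_S g) (2 * level \<alpha>) = restr f (2 * level \<alpha>)"
    using \<rho>(3) unfolding g(2) swap_string_restr initial_of_eq by simp
  from inv_S_restr_eq[OF this] have eq: "restr g (2 * level \<alpha>) = restr (inv_S f) (2 * level \<alpha>)"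
    by (simp only: inv_S_inv_S)
  have "\<exists>\<sigma>\<in>set \<alpha>. prefix \<sigma> (restr g (2 * level \<alpha>))"
    using g(1) mem_region[of \<alpha> "2 * level \<alpha>" g] by simp
  then show "f \<in> C \<and> inv_S f \<in> region \<alpha>"
    using mem_region[of \<alpha> "2 * level \<alpha>" "inv_S f"] \<rho>(2) inv_S_closed unfolding eq by simp
next
  assume f: "f \<in> C \<and> inv_S f \<in> region \<alpha>"
  then have "restr (inv_S f) (2 * level \<alpha>) \<in> set (extend \<alpha> (2 * level \<alpha>))"
    using restr_in_extend[OF assms] by simp
  then have "swap_string (restr (inv_S f) (2 * level \<alpha>)) \<in> set (inv_code \<alpha>)"
    by (auto simp: inv_code_def)
  moreover have "f \<in> cyl C (swap_string (restr (inv_S f) (2 * level \<alpha>)))"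
    using f unfolding swap_string_restr inv_S_inv_S by (auto simp: cyl_def initial_of_def)
  ultimately show "f \<in> region (inv_code \<alpha>)" unfolding region_def by blast
qed

lemma valid_inv_code:
  assumes "valid \<alpha>" shows "valid (inv_code \<alpha>)"
  unfolding valid_def
proof
  fix \<sigma> assume "\<sigma> \<in> set (inv_code \<alpha>)"
  then obtain \<rho> where \<rho>: "\<rho> \<in> set (extend \<alpha> (2 * level \<alpha>))" "\<sigma> = swap_string \<rho>"
    by (auto simp: inv_code_def)
  then obtain g where g: "g \<in> region \<alpha>" "\<rho> = restr g (2 * level \<alpha>)"
    using extend_obtain[OF assms] by (metis le_add2 mult_2)
  have \<sigma>: "\<sigma> = restr (inv_S g) (2 * level \<alpha>)" unfolding \<rho> g swap_string_restr ..
  have "cyl C \<sigma> = inv_S ` cyl C \<rho>"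
  proof (intro Set.set_eqI iffI)
    fix f assume "f \<in> cyl C \<sigma>"
    then have f: "f \<in> C" "restr (inv_S g) (2 * level \<alpha>) = restr f (2 * level \<alpha>)"
      by (auto simp: cyl_def \<sigma> initial_of_eq)
    then have "inv_S f \<in> cyl C \<rho>"
      using inv_S_restr_eq[OF f(2)] inv_S_closed by (simp add: cyl_def initial_of_eq g inv_S_inv_S)
    then show "f \<in> inv_S ` cyl C \<rho>" by (metis image_eqI inv_S_inv_S)
  next
    fix f assume "f \<in> inv_S ` cyl C \<rho>"
    then obtain f' where f': "f = inv_S f'" "f' \<in> C" "restr g (2 * level \<alpha>) = restr f' (2 * level \<alpha>)"
      by (auto simp: cyl_def g initial_of_eq)
    then show "f \<in> cyl C \<sigma>"
      using inv_S_restr_eq[OF f'(3)] inv_S_closed by (simp add: cyl_def initial_of_eq \<sigma>)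
  qed
  moreover have "compact (cyl C \<rho>)"
    using \<rho>(1) assms compact_cyl_mono by (auto simp: set_extend valid_def compact_string_def)
  ultimately have "compact (cyl C \<sigma>)"
    using compact_continuous_image[OF continuous_inv_S] by simp
  moreover have "\<sigma> \<in> Tree_of C"
    unfolding \<sigma> using restr_in_Tree_of inv_S_closed g(1) region_C by blast
  ultimately show "compact_string \<sigma>" by (simp add: compact_string_def)
qed

definition entries :: "nat list list \<Rightarrow> nat \<Rightarrow> nat" where
  "entries \<alpha> n = sum_list (concat (extend \<alpha> n))"

lemma entries_bound:
  assumes "valid \<alpha>" "level \<alpha> \<le> n" "f \<in> region \<alpha>" "i < n" shows "f i \<le> entries \<alpha> n"
  unfolding entries_def
proof (rule member_le_sum_list)
  have "f i \<in> set (restr f n)" using assms(4) by simp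
  then show "f i \<in> set (concat (extend \<alpha> n))" using restr_in_extend[OF assms(1-3)] by force
qed simp

text \<open>For the first n entries of a product, with n the sum of the levels, the factors are read
  at positions up to twice a value plus one. The values at positions below n are bounded by
  \<open>entries\<close>, so initial segments of this length suffice.\<close>

definition product_level :: "nat list list \<Rightarrow> nat list list \<Rightarrow> nat list list \<Rightarrow> nat" where
  "product_level \<alpha> \<beta> \<gamma> =
     (level \<alpha> + level \<beta> + level \<gamma>) + 2 * (entries \<alpha> (level \<alpha> + level \<beta> + level \<gamma>) + entries \<beta> (level \<alpha> + level \<beta> + level \<gamma>)) + 2"

definition product_le :: "nat list list \<Rightarrow> nat list list \<Rightarrow> nat list list \<Rightarrow> bool" where
  "product_le \<alpha> \<beta> \<gamma> \<longleftrightarrow> (\<forall>\<rho>\<in>set (extend \<alpha> (product_level \<alpha> \<beta> \<gamma>)). \<forall>\<rho>'\<in>set (extend \<beta> (product_level \<alpha> \<beta> \<gamma>)).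
     \<exists>\<tau>\<in>set \<gamma>. \<forall>i<length \<tau>. nth_default 0 \<tau> i =
       (if even i then nth_default 0 \<rho> (2 * nth_default 0 \<rho>' i) else nth_default 0 \<rho>' (2 * nth_default 0 \<rho> i + 1)))"

text \<open>Two initial segments of length \<open>L\<close> determine whether the product begins
  with some string of \<open>\<gamma>\<close>, and every pair of strings from the two lists comes
  from a pair of elements. So quantifiers over elements become quantifiers over finite
  lists.\<close>

lemma product_le_iff:
  assumes \<alpha>: "valid \<alpha>" and \<beta>: "valid \<beta>"
  shows "product_le \<alpha> \<beta> \<gamma> \<longleftrightarrow> (\<forall>f\<in>region \<alpha>. \<forall>g\<in>region \<beta>. mult_S f g \<in> region \<gamma>)"
proof -
  define n where "n = level \<alpha> + level \<beta> + level \<gamma>"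
  define L where "L = product_level \<alpha> \<beta> \<gamma>"
  have L: "L = n + 2 * (entries \<alpha> n + entries \<beta> n) + 2" by (simp add: L_def n_def product_level_def)
  have le: "level \<alpha> \<le> n" "level \<beta> \<le> n" "level \<gamma> \<le> n" "n \<le> L" by (auto simp: n_def L)
  then have leL: "level \<alpha> \<le> L" "level \<beta> \<le> L" by auto
  define ok where "ok \<rho> \<rho>' \<longleftrightarrow> (\<exists>\<tau>\<in>set \<gamma>. \<forall>i<length \<tau>. nth_default 0 \<tau> i =
       (if even i then nth_default 0 \<rho> (2 * nth_default 0 \<rho>' i) else nth_default 0 \<rho>' (2 * nth_default 0 \<rho> i + 1)))"
    for \<rho> \<rho>' :: "nat list"
  have ok: "ok (restr f L) (restr g L) \<longleftrightarrow> mult_S f g \<in> region \<gamma>" if f: "f \<in> region \<alpha>" and g: "g \<in> region \<beta>" for f g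
  proof -
    have fg: "mult_S f g \<in> C" using f g region_C mult_S_closed by blast
    have nth: "nth_default 0 (restr h L) i = h i" if "i < L" for h i
      using that by (simp add: nth_default_def)
    have "(if even i then nth_default 0 (restr f L) (2 * nth_default 0 (restr g L) i)
        else nth_default 0 (restr g L) (2 * nth_default 0 (restr f L) i + 1)) = mult_S f g i" if "i < n" for i
    proof -
      have "f i \<le> entries \<alpha> n" "g i \<le> entries \<beta> n"
        using entries_bound[OF \<alpha> le(1) f that] entries_bound[OF \<beta> le(2) g that] .
      then have "i < L" "2 * g i < L" "2 * f i + 1 < L" using that by (auto simp: L)
      then show ?thesis unfolding mult_S_def by (simp only: nth)
    qed
    then have "(\<forall>i<length \<tau>. nth_default 0 \<tau> i = (if even i then nth_default 0 (restr f L) (2 * nth_default 0 (restr g L) i)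
        else nth_default 0 (restr g L) (2 * nth_default 0 (restr f L) i + 1))) \<longleftrightarrow> initial_of \<tau> (mult_S f g)"
      if "\<tau> \<in> set \<gamma>" for \<tau>
      using length_le_level[OF that] le(3) unfolding initial_of_def nth_default_def
      by (smt (verit, best) order_less_le_trans)
    then show ?thesis unfolding ok_def region_def cyl_def using fg by auto
  qed
  have "product_le \<alpha> \<beta> \<gamma> \<longleftrightarrow> (\<forall>\<rho>\<in>set (extend \<alpha> L). \<forall>\<rho>'\<in>set (extend \<beta> L). ok \<rho> \<rho>')"
    by (simp add: product_le_def ok_def L_def)
  also have "\<dots> \<longleftrightarrow> (\<forall>f\<in>region \<alpha>. \<forall>g\<in>region \<beta>. mult_S f g \<in> region \<gamma>)"
  proof
    assume *: "\<forall>\<rho>\<in>set (extend \<alpha> L). \<forall>\<rho>'\<in>set (extend \<beta> L). ok \<rho> \<rho>'"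
    then show "\<forall>f\<in>region \<alpha>. \<forall>g\<in>region \<beta>. mult_S f g \<in> region \<gamma>"
      using restr_in_extend[OF \<alpha> leL(1)] restr_in_extend[OF \<beta> leL(2)] ok by blast
  next
    assume *: "\<forall>f\<in>region \<alpha>. \<forall>g\<in>region \<beta>. mult_S f g \<in> region \<gamma>"
    show "\<forall>\<rho>\<in>set (extend \<alpha> L). \<forall>\<rho>'\<in>set (extend \<beta> L). ok \<rho> \<rho>'"
    proof (intro ballI)
      fix \<rho> \<rho>' assume "\<rho> \<in> set (extend \<alpha> L)" "\<rho>' \<in> set (extend \<beta> L)"
      then obtain f g where "f \<in> region \<alpha>" "g \<in> region \<beta>" "\<rho> = restr f L" "\<rho>' = restr g L"
        using extend_obtain[OF \<alpha> leL(1)] extend_obtain[OF \<beta> leL(2)] by metis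
      then show "ok \<rho> \<rho>'" using * ok by blast
    qed
  qed
  finally show ?thesis .
qed

lemma compact_region: "valid \<alpha> \<Longrightarrow> compact (region \<alpha>)"
  unfolding region_def valid_def compact_string_def by (intro compact_UN) auto

lemma compactin_region: "valid \<alpha> \<Longrightarrow> compactin TC (region \<alpha>)"
  using compact_region region_C by (simp add: compactin_subtopology)

lemma openin_region: "openin TC (region \<alpha>)"
  unfolding region_def using openin_cyl by blast

text \<open>Around each point there is a cylinder inside K, which is compact as a closed subset of
  K; finitely many of them cover K.\<close>

lemma compact_open_region:
  assumes "compactin TC K" "openin TC K"
  shows "\<exists>\<alpha>. valid \<alpha> \<and> region \<alpha> = K"
proof -
  have KC: "K \<subseteq> C" and K: "compact K" using assms(1) by (auto simp: compactin_subtopology)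
  have "\<forall>f\<in>K. \<exists>n. cyl C (restr f n) \<subseteq> K" using openin_initial_of[OF assms(2)] by metis
  then obtain n where n: "\<And>f. f \<in> K \<Longrightarrow> cyl C (restr f (n f)) \<subseteq> K" by metis
  obtain D where D: "D \<subseteq> K" "finite D" "K \<subseteq> (\<Union>f\<in>D. {g. initial_of (restr f (n f)) g})"
    by (rule compactE_image[OF K, of K "\<lambda>f. {g. initial_of (restr f (n f)) g}"])
      (auto simp: open_initial_of, auto simp: initial_of_def)
  obtain fs where fs: "set fs = D" using finite_list[OF D(2)] by blast
  define \<alpha> where "\<alpha> = map (\<lambda>f. restr f (n f)) fs"
  have "compact_string (restr f (n f))" if "f \<in> K" for f
  proof -
    have "cyl C (restr f (n f)) = K \<inter> {g. initial_of (restr f (n f)) g}"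
      using n[OF that] KC by (auto simp: cyl_def)
    then show ?thesis
      using compact_Int_closed[OF K closed_initial_of] restr_in_Tree_of that KC
      by (auto simp: compact_string_def)
  qed
  then have "valid \<alpha>" using D(1) fs by (auto simp: valid_def \<alpha>_def)
  moreover have "region \<alpha> \<subseteq> K" using n D(1) fs unfolding region_def \<alpha>_def by auto
  moreover have "K \<subseteq> region \<alpha>" using D(3) fs KC by (fastforce simp: region_def \<alpha>_def cyl_def)
  ultimately show ?thesis by blast
qed

end


section \<open>Numbers that name the compact open cosets\<close>

definition string_list :: "nat \<Rightarrow> nat list list" where
  "string_list m = map list_decode (list_decode m)"

lemma string_list_surj: "\<exists>m. string_list m = \<alpha>"
  by (rule exI[of _ "list_encode (map list_encode \<alpha>)"]) (simp add: string_list_def o_def)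

definition set_part :: "nat \<Rightarrow> nat list list" where
  "set_part z = string_list (fst (prod_decode z))"

definition group_part :: "nat \<Rightarrow> nat list list" where
  "group_part z = string_list (snd (prod_decode z))"

context bounded_tree
begin

definition minimal_code :: "nat \<Rightarrow> bool" where
  "minimal_code m \<longleftrightarrow> valid (string_list m) \<and>
     (\<forall>j<m. \<not> (valid (string_list j) \<and> region_eq (string_list j) (string_list m)))"

text \<open>The second component is a certificate: it makes being a coset decidable, because it lets the
  condition be expressed with products of two factors only.\<close>

definition copy_dom :: "nat \<Rightarrow> bool" where
  "copy_dom z \<longleftrightarrow> minimal_code (fst (prod_decode z)) \<and> minimal_code (snd (prod_decode z)) \<and>
     product_le (inv_code (set_part z)) (set_part z) (group_part z) \<and>
     product_le (set_part z) (group_part z) (set_part z) \<and>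
     (region_le (set_part z) [] \<longrightarrow> region_le (group_part z) [])"

definition copy_set :: "nat \<Rightarrow> (nat \<Rightarrow> nat) set" where
  "copy_set z = region (set_part z)"

lemma minimal_code_unique:
  assumes "minimal_code m" "minimal_code n" "region (string_list m) = region (string_list n)"
  shows "m = n"
  using assms unfolding minimal_code_def by (metis linorder_neqE_nat region_eq_iff)

lemma minimal_code_exists:
  assumes "valid \<alpha>" shows "\<exists>m. minimal_code m \<and> region (string_list m) = region \<alpha>"
proof -
  let ?P = "\<lambda>m. valid (string_list m) \<and> region (string_list m) = region \<alpha>"
  obtain k where "?P k" using string_list_surj assms by metis
  then have "?P (LEAST m. ?P m)" by (rule LeastI)
  moreover have "\<not> ?P j" if "j < (LEAST m. ?P m)" for j using that by (rule not_less_Least)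
  ultimately have "minimal_code (LEAST m. ?P m)"
    unfolding minimal_code_def by (metis region_eq_iff)
  then show ?thesis using \<open>?P (LEAST m. ?P m)\<close> by blast
qed

lemma copy_dom_valid: "copy_dom z \<Longrightarrow> valid (set_part z)" "copy_dom z \<Longrightarrow> valid (group_part z)"
  by (simp_all add: copy_dom_def minimal_code_def set_part_def group_part_def)

lemma valid_Nil [simp]: "valid []" and region_Nil [simp]: "region [] = {}"
  by (simp_all add: valid_def region_def)

text \<open>For nonempty sets this is \<open>coset_right_group_iff\<close>. For the empty set both
  inclusions hold whatever the second component is; the last clause of \<open>copy_dom\<close> makes
  it empty too, so that the empty set has a single name.\<close>

lemma copy_dom_iff:
  "copy_dom z \<longleftrightarrow> minimal_code (fst (prod_decode z)) \<and> minimal_code (snd (prod_decode z)) \<and>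
     (copy_set z = {} \<and> region (group_part z) = {} \<or>
      CG.coset (copy_set z) \<and> region (group_part z) = CG.right_group (copy_set z))"
proof (cases "minimal_code (fst (prod_decode z)) \<and> minimal_code (snd (prod_decode z))")
  case True
  then have v: "valid (set_part z)" "valid (group_part z)"
    by (simp_all add: minimal_code_def set_part_def group_part_def)
  define A where "A = copy_set z"
  define V where "V = region (group_part z)"
  have sub: "A \<subseteq> C" "V \<subseteq> C" by (simp_all add: A_def V_def copy_set_def region_C)
  have 1: "product_le (inv_code (set_part z)) (set_part z) (group_part z) \<longleftrightarrow>
      (\<forall>x\<in>A. \<forall>y\<in>A. inv\<^bsub>GC\<^esub> x \<otimes>\<^bsub>GC\<^esub> y \<in> V)"
  proof -
    have "product_le (inv_code (set_part z)) (set_part z) (group_part z) \<longleftrightarrow>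
        (\<forall>x\<in>C. inv_S x \<in> A \<longrightarrow> (\<forall>y\<in>A. mult_S x y \<in> V))"
      unfolding product_le_iff[OF valid_inv_code[OF v(1)] v(1)] Ball_def mem_region_inv_code[OF v(1)]
      by (auto simp: A_def V_def copy_set_def)
    also have "\<dots> \<longleftrightarrow> (\<forall>x\<in>A. \<forall>y\<in>A. mult_S (inv_S x) y \<in> V)"
      using sub inv_S_closed inv_S_inv_S by (metis subsetD)
    also have "\<dots> \<longleftrightarrow> (\<forall>x\<in>A. \<forall>y\<in>A. inv\<^bsub>GC\<^esub> x \<otimes>\<^bsub>GC\<^esub> y \<in> V)"
      using sub by (auto simp: inv_GC mult_Sinf subset_iff)
    finally show ?thesis .
  qed
  have 2: "product_le (set_part z) (group_part z) (set_part z) \<longleftrightarrow> (\<forall>x\<in>A. \<forall>v\<in>V. x \<otimes>\<^bsub>GC\<^esub> v \<in> A)"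
    unfolding product_le_iff[OF v] by (simp add: A_def V_def copy_set_def mult_Sinf)
  have 3: "(region_le (set_part z) [] \<longrightarrow> region_le (group_part z) []) \<longleftrightarrow> (A = {} \<longrightarrow> V = {})"
    using v by (simp add: region_le_iff A_def V_def copy_set_def)
  have "compactin TC A" "openin TC A"
    using v by (simp_all add: A_def copy_set_def compactin_region openin_region)
  then have "A \<noteq> {} \<Longrightarrow> CG.coset A \<and> V = CG.right_group A \<longleftrightarrow>
      (\<forall>x\<in>A. \<forall>y\<in>A. inv\<^bsub>GC\<^esub> x \<otimes>\<^bsub>GC\<^esub> y \<in> V) \<and> (\<forall>x\<in>A. \<forall>v\<in>V. x \<otimes>\<^bsub>GC\<^esub> v \<in> A)"
    using CG.coset_right_group_iff[of A V] sub by simp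
  moreover have "\<not> CG.coset {}" using CG.cosetD(3) by blast
  ultimately show ?thesis
    using True unfolding copy_dom_def 1 2 3 A_def[symmetric] V_def[symmetric]
    by (cases "A = {}") auto
qed (auto simp: copy_dom_def)

lemma copy_set_inj:
  assumes "copy_dom w" "copy_dom z" "copy_set w = copy_set z" shows "w = z"
proof -
  have "region (group_part w) = region (group_part z)"
    using assms CG.cosetD(3) unfolding copy_dom_iff by metis
  then have "prod_decode w = prod_decode z"
    using assms minimal_code_unique unfolding copy_dom_iff copy_set_def set_part_def group_part_def
    by (metis prod_eqI)
  then show ?thesis by (metis prod_decode_inverse)
qed

lemma copy_exists:
  assumes "A = {} \<or> CG.coset A" shows "\<exists>z. copy_dom z \<and> copy_set z = A"
proof -
  obtain V where V: "compactin TC V" "openin TC V"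
    "A = {} \<and> V = {} \<or> CG.coset A \<and> V = CG.right_group A"
    using assms CG.compact_open_right_group[of A] unfolding compact_open_subgroup_def
    by (metis compactin_empty openin_empty)
  have A: "compactin TC A" "openin TC A" using assms CG.cosetD by auto
  obtain \<alpha> \<gamma> where "valid \<alpha>" "region \<alpha> = A" "valid \<gamma>" "region \<gamma> = V"
    using compact_open_region[OF A] compact_open_region[OF V(1,2)] by blast
  then obtain m n where "minimal_code m" "region (string_list m) = A"
    "minimal_code n" "region (string_list n) = V"
    using minimal_code_exists by metis
  then have "copy_dom (prod_encode (m, n)) \<and> copy_set (prod_encode (m, n)) = A"
    using V(3) by (auto simp: copy_dom_iff copy_set_def set_part_def group_part_def)
  then show ?thesis by blast
qed

lemma copy_cases: "copy_dom z \<Longrightarrow> copy_set z = {} \<or> CG.coset (copy_set z)"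
  by (auto simp: copy_dom_iff)

lemma group_part_eq: "copy_dom z \<Longrightarrow> CG.coset (copy_set z) \<Longrightarrow> region (group_part z) = CG.right_group (copy_set z)"
  using CG.cosetD(3) by (auto simp: copy_dom_iff)

definition c_inv :: "nat \<Rightarrow> nat" where
  "c_inv x = (LEAST w. copy_dom x \<longrightarrow> copy_dom w \<and> region_eq (set_part w) (inv_code (set_part x)))"

definition c_meet :: "nat \<Rightarrow> nat \<Rightarrow> nat" where
  "c_meet x y = (LEAST w. copy_dom x \<and> copy_dom y \<longrightarrow>
     copy_dom w \<and> region_eq (set_part w) (meet_code (set_part x) (set_part y)))"

text \<open>The second component of the inverse of \<open>y\<close> describes the left group of
  \<open>y\<close>. Since codes are unique, equality of subgroups is equality of codes. The two
  tests exclude the empty set, for which products are undefined.\<close>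

definition c_defined :: "nat \<Rightarrow> nat \<Rightarrow> bool" where
  "c_defined x y \<longleftrightarrow> copy_dom x \<and> copy_dom y \<and> \<not> region_le (set_part x) [] \<and> \<not> region_le (set_part y) [] \<and>
     group_part x = group_part (c_inv y)"

definition c_prod :: "nat \<Rightarrow> nat \<Rightarrow> nat" where
  "c_prod x y = (LEAST w. c_defined x y \<longrightarrow> copy_dom w \<and>
     product_le (set_part x) (set_part y) (set_part w) \<and>
     product_le (inv_code (set_part x)) (set_part w) (set_part y))"

lemma set_inv_copy_set:
  assumes "copy_dom x" shows "set_inv\<^bsub>GC\<^esub> (copy_set x) = region (inv_code (set_part x))"
proof -
  have sub: "copy_set x \<subseteq> carrier GC" by (simp add: copy_set_def region_C)
  show ?thesis
    unfolding CG.set_inv_eq[OF sub]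
  proof (rule Set.set_eqI)
    show "f \<in> {y \<in> carrier GC. inv\<^bsub>GC\<^esub> y \<in> copy_set x} \<longleftrightarrow> f \<in> region (inv_code (set_part x))" for f
      unfolding mem_region_inv_code[OF copy_dom_valid(1)[OF assms]] by (auto simp: inv_GC copy_set_def)
  qed
qed

lemma c_inv_exists:
  "\<exists>w. copy_dom x \<longrightarrow> copy_dom w \<and> region_eq (set_part w) (inv_code (set_part x))"
proof (cases "copy_dom x")
  case True
  have "set_inv\<^bsub>GC\<^esub> (copy_set x) = {} \<or> CG.coset (set_inv\<^bsub>GC\<^esub> (copy_set x))"
    using copy_cases[OF True] CG.coset_set_inv by (auto simp: SET_INV_def)
  then obtain w where "copy_dom w" "copy_set w = set_inv\<^bsub>GC\<^esub> (copy_set x)" using copy_exists by blast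
  then show ?thesis
    using True set_inv_copy_set[OF True] copy_dom_valid valid_inv_code
    by (auto simp: region_eq_iff copy_set_def intro!: exI[of _ w])
qed auto

lemma c_inv:
  assumes "copy_dom x" shows "copy_dom (c_inv x)" "copy_set (c_inv x) = set_inv\<^bsub>GC\<^esub> (copy_set x)"
proof -
  have *: "copy_dom (c_inv x) \<and> region_eq (set_part (c_inv x)) (inv_code (set_part x))"
    using LeastI_ex[OF c_inv_exists[of x]] assms by (simp add: c_inv_def)
  then show "copy_dom (c_inv x)" by blast
  show "copy_set (c_inv x) = set_inv\<^bsub>GC\<^esub> (copy_set x)"
    using * region_eq_iff[OF copy_dom_valid(1) valid_inv_code[OF copy_dom_valid(1)[OF assms]]]
    unfolding set_inv_copy_set[OF assms] unfolding copy_set_def by blast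
qed

lemma c_meet_exists:
  "\<exists>w. copy_dom x \<and> copy_dom y \<longrightarrow>
     copy_dom w \<and> region_eq (set_part w) (meet_code (set_part x) (set_part y))"
proof (cases "copy_dom x \<and> copy_dom y")
  case True
  then have "copy_set x \<inter> copy_set y = {} \<or> CG.coset (copy_set x \<inter> copy_set y)"
    using copy_cases CG.coset_Int by blast
  then obtain w where "copy_dom w" "copy_set w = copy_set x \<inter> copy_set y" using copy_exists by blast
  then show ?thesis
    using True copy_dom_valid valid_meet_code
    by (auto simp: region_eq_iff copy_set_def region_meet_code intro!: exI[of _ w])
qed auto

lemma c_meet:
  assumes "copy_dom x" "copy_dom y"
  shows "copy_dom (c_meet x y)" "copy_set (c_meet x y) = copy_set x \<inter> copy_set y"
proof -
  have *: "copy_dom (c_meet x y) \<and> region_eq (set_part (c_meet x y)) (meet_code (set_part x) (set_part y))"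
    using LeastI_ex[OF c_meet_exists[of x y]] assms by (simp add: c_meet_def)
  then show "copy_dom (c_meet x y)" by blast
  show "copy_set (c_meet x y) = copy_set x \<inter> copy_set y"
    using * region_eq_iff[OF copy_dom_valid(1) valid_meet_code[OF copy_dom_valid(1)[OF assms(1)]]]
      region_meet_code[OF copy_dom_valid(1)[OF assms(1)]]
    unfolding copy_set_def by blast
qed

lemma group_part_eq_iff:
  assumes "copy_dom x" "copy_dom y" "CG.coset (copy_set x)" "CG.coset (copy_set y)"
  shows "group_part x = group_part y \<longleftrightarrow> CG.right_group (copy_set x) = CG.right_group (copy_set y)"
  using assms group_part_eq minimal_code_unique unfolding copy_dom_iff group_part_def by metis

lemma c_defined_iff:
  "c_defined x y \<longleftrightarrow> copy_dom x \<and> copy_dom y \<and> meet_groupoid_prod GC TC (copy_set x) (copy_set y) \<noteq> None"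
proof (cases "copy_dom x \<and> copy_dom y")
  case True
  then have x: "copy_dom x" and y: "copy_dom y" by auto
  have ne: "\<not> region_le (set_part z) [] \<longleftrightarrow> CG.coset (copy_set z)" if "copy_dom z" for z
    using copy_cases[OF that] CG.cosetD(3) copy_dom_valid[OF that]
    by (auto simp: region_le_iff copy_set_def)
  have "group_part x = group_part (c_inv y) \<longleftrightarrow> CG.right_group (copy_set x) = CG.left_group (copy_set y)"
    if c: "CG.coset (copy_set x)" "CG.coset (copy_set y)"
    using group_part_eq_iff[OF x c_inv(1)[OF y] c(1)] CG.coset_set_inv[OF c(2)] c_inv(2)[OF y]
      CG.right_group_set_inv CG.cosetD(4)[OF c(2)] by simp
  then show ?thesis using x y ne by (auto simp: c_defined_def CG.meet_groupoid_prod_eq)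
qed (auto simp: c_defined_def)

lemma c_prod_iff:
  assumes "c_defined x y" "copy_dom w"
  shows "product_le (set_part x) (set_part y) (set_part w) \<and>
      product_le (inv_code (set_part x)) (set_part w) (set_part y) \<longleftrightarrow>
    copy_set w = copy_set x <#>\<^bsub>GC\<^esub> copy_set y"
proof -
  have x: "copy_dom x" and y: "copy_dom y"
    and c: "CG.coset (copy_set x)" "CG.coset (copy_set y)" "CG.right_group (copy_set x) = CG.left_group (copy_set y)"
    using assms(1) unfolding c_defined_iff CG.meet_groupoid_prod_eq by (auto split: if_splits)
  note v = copy_dom_valid[OF x] copy_dom_valid[OF y] copy_dom_valid[OF assms(2)]
  have sub: "copy_set z \<subseteq> C" for z by (simp add: copy_set_def region_C)
  have "product_le (inv_code (set_part x)) (set_part w) (set_part y) \<longleftrightarrow>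
      (\<forall>a\<in>C. inv_S a \<in> copy_set x \<longrightarrow> (\<forall>z\<in>copy_set w. mult_S a z \<in> copy_set y))"
    unfolding product_le_iff[OF valid_inv_code[OF v(1)] v(5)] Ball_def mem_region_inv_code[OF v(1)]
    by (auto simp: copy_set_def)
  also have "\<dots> \<longleftrightarrow> (\<forall>a\<in>copy_set x. \<forall>z\<in>copy_set w. mult_S (inv_S a) z \<in> copy_set y)"
    using sub inv_S_closed inv_S_inv_S by (metis subsetD)
  also have "\<dots> \<longleftrightarrow> (\<forall>a\<in>copy_set x. \<forall>z\<in>copy_set w. inv\<^bsub>GC\<^esub> a \<otimes>\<^bsub>GC\<^esub> z \<in> copy_set y)"
    using sub by (auto simp: inv_GC mult_Sinf subset_iff)
  finally have 1: "product_le (inv_code (set_part x)) (set_part w) (set_part y) \<longleftrightarrow>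
      (\<forall>a\<in>copy_set x. \<forall>z\<in>copy_set w. inv\<^bsub>GC\<^esub> a \<otimes>\<^bsub>GC\<^esub> z \<in> copy_set y)" .
  have "copy_set w \<subseteq> carrier GC" using sub by simp
  from CG.set_mult_eq_iff[OF c this] show ?thesis
    unfolding 1 product_le_iff[OF v(1,3)] by (simp add: copy_set_def mult_Sinf)
qed

lemma c_prod_exists:
  "\<exists>w. c_defined x y \<longrightarrow> copy_dom w \<and> product_le (set_part x) (set_part y) (set_part w) \<and>
     product_le (inv_code (set_part x)) (set_part w) (set_part y)"
proof (cases "c_defined x y")
  case True
  then have "CG.coset (copy_set x <#>\<^bsub>GC\<^esub> copy_set y)"
    using CG.coset_set_mult(1) unfolding c_defined_iff CG.meet_groupoid_prod_eq by (auto split: if_splits)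
  then obtain w where "copy_dom w" "copy_set w = copy_set x <#>\<^bsub>GC\<^esub> copy_set y"
    using copy_exists by blast
  then show ?thesis using c_prod_iff[OF True] by blast
qed auto

lemma c_prod:
  assumes "c_defined x y"
  shows "copy_dom (c_prod x y)" "copy_set (c_prod x y) = copy_set x <#>\<^bsub>GC\<^esub> copy_set y"
proof -
  have *: "copy_dom (c_prod x y) \<and> product_le (set_part x) (set_part y) (set_part (c_prod x y)) \<and>
     product_le (inv_code (set_part x)) (set_part (c_prod x y)) (set_part y)"
    using LeastI_ex[OF c_prod_exists[of x y]] assms by (simp add: c_prod_def)
  then show "copy_dom (c_prod x y)" by blast
  then show "copy_set (c_prod x y) = copy_set x <#>\<^bsub>GC\<^esub> copy_set y" using * c_prod_iff[OF assms] by blast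
qed

definition copy :: meet_structure where
  "copy = \<lparr>mdom = Collect copy_dom, minv = c_inv, mmeet = c_meet,
     mprod = (\<lambda>x y. if c_defined x y then Some (c_prod x y) else None)\<rparr>"

lemma meet_groupoid_iso_copy: "meet_groupoid_iso GC TC copy copy_set"
proof -
  have "bij_betw copy_set (Collect copy_dom) (meet_groupoid GC TC)"
  proof (rule bij_betw_imageI)
    show "inj_on copy_set (Collect copy_dom)" using copy_set_inj by (auto intro: inj_onI)
    show "copy_set ` Collect copy_dom = meet_groupoid GC TC"
    proof (intro Set.set_eqI iffI)
      fix A assume "A \<in> meet_groupoid GC TC"
      then obtain z where "copy_dom z" "copy_set z = A"
        using copy_exists[of A] by (auto simp: CG.meet_groupoid_eq)
      then show "A \<in> copy_set ` Collect copy_dom" by blast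
    qed (use copy_cases in \<open>auto simp: CG.meet_groupoid_eq\<close>)
  qed
  moreover have "map_option copy_set (if c_defined x y then Some (c_prod x y) else None) =
      meet_groupoid_prod GC TC (copy_set x) (copy_set y)" if "copy_dom x" "copy_dom y" for x y
    using that c_prod(2)[of x y] by (auto simp: c_defined_iff CG.meet_groupoid_prod_eq)
  ultimately show ?thesis
    using c_inv c_meet c_prod(1) by (auto simp: meet_groupoid_iso_def copy_def)
qed

section \<open>Subgroups of the copy and their indices\<close>

definition c_subgroup :: "nat \<Rightarrow> bool" where
  "c_subgroup u \<longleftrightarrow> c_defined u u \<and> c_prod u u = u"

lemma msubgroups_copy: "msubgroups copy = Collect c_subgroup"
  by (auto simp: msubgroups_def copy_def c_subgroup_def c_defined_def)

lemma c_subgroup_iff: "c_subgroup u \<longleftrightarrow> copy_dom u \<and> compact_open_subgroup GC TC (copy_set u)"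
proof (cases "copy_dom u")
  case True
  then have "copy_set u \<in> meet_groupoid GC TC" using copy_cases by (auto simp: CG.meet_groupoid_eq)
  then have "compact_open_subgroup GC TC (copy_set u) \<longleftrightarrow>
      meet_groupoid_prod GC TC (copy_set u) (copy_set u) = Some (copy_set u)"
    by (rule CG.meet_groupoid_prod_idem_iff[symmetric])
  also have "\<dots> \<longleftrightarrow> c_subgroup u"
  proof (cases "c_defined u u")
    case d: True
    then have "CG.coset (copy_set u) \<and> CG.right_group (copy_set u) = CG.left_group (copy_set u)"
      unfolding c_defined_iff CG.meet_groupoid_prod_eq by presburger
    then have "meet_groupoid_prod GC TC (copy_set u) (copy_set u) = Some (copy_set (c_prod u u))"
      unfolding c_prod(2)[OF d] CG.meet_groupoid_prod_eq by simp
    then show ?thesis using copy_set_inj[OF c_prod(1)[OF d] True] d by (auto simp: c_subgroup_def)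
  next
    case False
    then show ?thesis using True by (auto simp: c_defined_iff c_subgroup_def)
  qed
  finally show ?thesis using True by simp
qed (auto simp: c_subgroup_def c_defined_def)

text \<open>The equation says that \<open>e\<close> is a right coset of the intersection.\<close>

definition partition_list :: "nat \<Rightarrow> nat \<Rightarrow> nat list \<Rightarrow> bool" where
  "partition_list u v l \<longleftrightarrow> distinct l \<and>
     (\<forall>e\<in>set l. c_defined e (c_inv e) \<and> c_prod e (c_inv e) = c_meet u v \<and>
        region_le (set_part e) (set_part u)) \<and>
     region_le (set_part u) (concat (map set_part l))"

definition c_index :: "nat \<Rightarrow> nat \<Rightarrow> nat" where
  "c_index u v = length (list_decode (LEAST m. c_subgroup u \<and> c_subgroup v \<longrightarrow> partition_list u v (list_decode m)))"

lemma region_concat: "region (concat (map set_part l)) = (\<Union>e\<in>set l. copy_set e)"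
  by (auto simp: region_def copy_set_def)

text \<open>The product of a coset with its inverse is its left group, so a single equation in the
  copy says of which subgroup \<open>e\<close> is a right coset.\<close>

lemma c_prod_c_inv_iff:
  assumes "copy_dom e" "copy_dom w" "compact_open_subgroup GC TC (copy_set w)"
  shows "c_defined e (c_inv e) \<and> c_prod e (c_inv e) = w \<longleftrightarrow>
    CG.coset (copy_set e) \<and> CG.left_group (copy_set e) = copy_set w"
proof (cases "CG.coset (copy_set e)")
  case True
  have d: "c_defined e (c_inv e)"
    using assms(1) True c_inv[OF assms(1)] CG.coset_set_inv[OF True] CG.left_group_set_inv[of "copy_set e"]
      CG.cosetD(4)[OF True] by (simp add: c_defined_iff CG.meet_groupoid_prod_eq)
  have "copy_set (c_prod e (c_inv e)) = CG.left_group (copy_set e)"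
    unfolding c_prod(2)[OF d] c_inv(2)[OF assms(1)]
    by (auto simp: set_mult_def SET_INV_def CG.left_group_def)
  then show ?thesis using d True copy_set_inj[OF c_prod(1)[OF d] assms(2)] by auto
next
  case False
  then show ?thesis by (auto simp: c_defined_iff CG.meet_groupoid_prod_eq split: if_splits)
qed

text \<open>Right cosets of the intersection that lie in \<open>u\<close> and cover it are all of
  them, by \<open>right_cosets_partition\<close>. As names are unique, a list without repetitions
  then has the index as its length.\<close>

lemma partition_list_iff:
  assumes "c_subgroup u" "c_subgroup v"
  shows "partition_list u v l \<longleftrightarrow> distinct l \<and> (\<forall>e\<in>set l. copy_dom e) \<and>
    copy_set ` set l = (\<lambda>a. (copy_set u \<inter> copy_set v) #>\<^bsub>GC\<^esub> a) ` copy_set u"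
proof -
  define W where "W = copy_set u \<inter> copy_set v"
  have u: "copy_dom u" "compact_open_subgroup GC TC (copy_set u)"
    and v: "copy_dom v" "compact_open_subgroup GC TC (copy_set v)"
    using assms by (auto simp: c_subgroup_iff)
  have W: "compact_open_subgroup GC TC W"
    unfolding W_def using CG.compact_open_subgroup_Int[OF u(2) v(2)] .
  note w = c_meet[OF u(1) v(1)]
  have 1: "c_defined e (c_inv e) \<and> c_prod e (c_inv e) = c_meet u v \<and> region_le (set_part e) (set_part u) \<longleftrightarrow>
      copy_dom e \<and> CG.coset (copy_set e) \<and> CG.left_group (copy_set e) = W \<and> copy_set e \<subseteq> copy_set u" for e
  proof (cases "copy_dom e")
    case True
    have "compact_open_subgroup GC TC (copy_set (c_meet u v))" using W w(2) by (simp add: W_def)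
    from c_prod_c_inv_iff[OF True w(1) this] show ?thesis
      using True copy_dom_valid[OF True] w(2) by (simp add: region_le_iff copy_set_def W_def) blast
  qed (auto simp: c_defined_def)
  have 2: "region_le (set_part u) (concat (map set_part l)) \<longleftrightarrow> copy_set u \<subseteq> (\<Union>e\<in>set l. copy_set e)"
    using region_le_iff[OF copy_dom_valid(1)[OF u(1)]] by (simp only: region_concat copy_set_def)
  have 3: "(\<forall>e\<in>set l. CG.coset (copy_set e) \<and> CG.left_group (copy_set e) = W \<and> copy_set e \<subseteq> copy_set u) \<and>
      copy_set u \<subseteq> (\<Union>e\<in>set l. copy_set e) \<longleftrightarrow> copy_set ` set l = (\<lambda>a. W #>\<^bsub>GC\<^esub> a) ` copy_set u" (is "?L \<longleftrightarrow> ?R")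
  proof
    assume L: ?L
    show ?R by (rule CG.right_cosets_partition[OF u(2) W]) (use L in auto)
  next
    assume R: ?R
    have sub: "subgroup W GC" "subgroup (copy_set u) GC"
      using W u(2) by (auto simp: compact_open_subgroup_def)
    have car: "copy_set u \<subseteq> C" by (simp add: copy_set_def region_C)
    have "CG.coset (copy_set e) \<and> CG.left_group (copy_set e) = W \<and> copy_set e \<subseteq> copy_set u" if e: "e \<in> set l" for e
    proof -
      obtain a where a: "a \<in> copy_set u" "copy_set e = W #>\<^bsub>GC\<^esub> a" using R e by blast
      have "W #>\<^bsub>GC\<^esub> a \<subseteq> copy_set u"
        using subgroup.m_closed[OF sub(2) _ a(1)] by (auto simp: r_coset_def W_def)
      then show ?thesis using CG.coset_r_coset[OF W, of a] a car by auto
    qed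
    moreover have "a \<in> W #>\<^bsub>GC\<^esub> a" if "a \<in> copy_set u" for a
      using CG.rcos_self[OF _ sub(1)] that car by auto
    then have "copy_set u \<subseteq> \<Union>(copy_set ` set l)" unfolding R by blast
    ultimately show ?L by blast
  qed
  have "partition_list u v l \<longleftrightarrow> distinct l \<and>
      (\<forall>e\<in>set l. copy_dom e \<and> CG.coset (copy_set e) \<and> CG.left_group (copy_set e) = W \<and> copy_set e \<subseteq> copy_set u) \<and>
      copy_set u \<subseteq> (\<Union>e\<in>set l. copy_set e)"
    unfolding partition_list_def 1 2 by (rule refl)
  then show ?thesis unfolding ball_conj_distrib[of _ copy_dom] 3[symmetric] W_def[symmetric] by blast
qed

lemma c_index_exists:
  "\<exists>m. c_subgroup u \<and> c_subgroup v \<longrightarrow> partition_list u v (list_decode m)"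
proof (cases "c_subgroup u \<and> c_subgroup v")
  case True
  then have u: "compact_open_subgroup GC TC (copy_set u)"
    and W: "compact_open_subgroup GC TC (copy_set u \<inter> copy_set v)"
    using CG.compact_open_subgroup_Int by (auto simp: c_subgroup_iff)
  have *: "\<exists>z. copy_dom z \<and> copy_set z = B"
    if "B \<in> (\<lambda>a. (copy_set u \<inter> copy_set v) #>\<^bsub>GC\<^esub> a) ` copy_set u" for B
  proof (rule copy_exists)
    have "copy_set u \<subseteq> C" by (simp add: copy_set_def region_C)
    then show "B = {} \<or> CG.coset B" using that CG.coset_r_coset(1)[OF W] by auto
  qed
  have "(\<lambda>a. (copy_set u \<inter> copy_set v) #>\<^bsub>GC\<^esub> a) ` copy_set u \<subseteq> copy_set ` Collect copy_dom"
  proof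
    fix B assume "B \<in> (\<lambda>a. (copy_set u \<inter> copy_set v) #>\<^bsub>GC\<^esub> a) ` copy_set u"
    from *[OF this] obtain z where "copy_dom z" "copy_set z = B" by blast
    then show "B \<in> copy_set ` Collect copy_dom" by blast
  qed
  from finite_subset_image[OF CG.finite_right_cosets[OF u W] this]
  obtain E where E: "E \<subseteq> Collect copy_dom" "finite E"
      "(\<lambda>a. (copy_set u \<inter> copy_set v) #>\<^bsub>GC\<^esub> a) ` copy_set u = copy_set ` E" by auto
  obtain l where l: "set l = E" "distinct l" using finite_distinct_list[OF E(2)] by blast
  then have "partition_list u v (list_decode (list_encode l))"
    using True E by (auto simp: partition_list_iff)
  then show ?thesis by blast
qed auto

lemma c_index:
  assumes "c_subgroup u" "c_subgroup v"
  shows "c_index u v = subgroup_index GC (copy_set u) (copy_set u \<inter> copy_set v)"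
proof -
  define l where "l = list_decode (LEAST m. c_subgroup u \<and> c_subgroup v \<longrightarrow> partition_list u v (list_decode m))"
  have "partition_list u v l"
    using LeastI_ex[OF c_index_exists[of u v]] assms by (simp add: l_def)
  then have l: "distinct l" "\<forall>e\<in>set l. copy_dom e"
    "copy_set ` set l = (\<lambda>a. (copy_set u \<inter> copy_set v) #>\<^bsub>GC\<^esub> a) ` copy_set u"
    using partition_list_iff[OF assms] by auto
  have "inj_on copy_set (set l)" using l(2) copy_set_inj by (auto intro: inj_onI)
  then have "card (copy_set ` set l) = length l"
    using l(1) by (simp add: card_image distinct_card)
  then show ?thesis unfolding c_index_def CG.subgroup_index_eq l(3)[symmetric] l_def[symmetric] by simp
qed

end


section \<open>From closed subgroups to meet groupoids\<close>

text \<open>Divergence is produced by a minimisation whose test ignores the search variable: it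
  succeeds at once if P holds and never otherwise. The data of a copy demand functions that are
  undefined outside their domain, so total programs are cut down in this way.\<close>

lemma computable_partial:
  assumes "computable F P" "computable F f"
  obtains t where "\<And>c w x. (c, w) \<in> F \<Longrightarrow> orun w t (enc x) = (if P c x then Some (enc (f c x)) else None)"
proof -
  obtain s where s: "\<And>c w x. (c, w) \<in> F \<Longrightarrow> orun w s (enc x) = Some (enc (f c x))"
    using assms(2) by (rule computableE) blast
  obtain r where r: "\<And>c w x. (c, w) \<in> F \<Longrightarrow> orun w r (enc x) = Some (enc (\<not> P c x))"
    using computable_Not[OF assms(1)] by (rule computableE) blast
  have "orun w (OComp OFirst (OTuple s (OMinimize (OComp r OFirst)))) (enc x) =
      (if P c x then Some (enc (f c x)) else None)" if "(c, w) \<in> F" for c w x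
    using s[OF that] r[OF that] by (auto simp: Let_def dest: spec[of _ "0 :: nat"])
  then show ?thesis using that by blast
qed

text \<open>The oracles 0, 1, 2 are the three components of a presentation. The subgroup belongs to
  the context, so that correctness can be stated although no program sees it.\<close>

definition tree_family :: "((nat \<Rightarrow> nat) set \<times> (nat list \<Rightarrow> nat \<Rightarrow> nat)) family" where
  "tree_family = {((C, H), w) | C H w. bounded_tree C H \<and>
     (\<forall>\<sigma>. w 0 (list_encode \<sigma>) = Some (of_bool (\<sigma> \<in> Tree_of C))) \<and>
     (\<forall>\<sigma>. w 1 (list_encode \<sigma>) = Some (of_bool (\<sigma> \<in> Tree_of C \<and> compact (cyl C \<sigma>)))) \<and>
     (\<forall>\<sigma> i. w 2 (prod_encode (list_encode \<sigma>, i)) = Some (H \<sigma> i))}"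

lemma tree_familyD: "(c, w) \<in> tree_family \<Longrightarrow> bounded_tree (fst c) (snd c)"
  by (auto simp: tree_family_def)

section \<open>Computability of the operations on codes, uniformly in the tree\<close>

named_theorems tree_intros

lemma computable_tree [tree_intros]:
  assumes "computable tree_family f"
  shows "computable tree_family (\<lambda>c x. f c x \<in> Tree_of (fst c))"
proof -
  have "computable tree_family (\<lambda>c x. if True then f c x \<in> Tree_of (fst c) else False)"
    by (rule computable_oracle[where i=0 and g=f, OF computable_const assms])
      (auto simp: tree_family_def)
  then show ?thesis by simp
qed

lemma computable_compact_string [tree_intros]:
  assumes "computable tree_family f"
  shows "computable tree_family (\<lambda>c x. bounded_tree.compact_string (fst c) (f c x))"
proof -
  have "computable tree_family (\<lambda>c x. if True then bounded_tree.compact_string (fst c) (f c x) else False)"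
    by (rule computable_oracle[where i=1 and g=f, OF computable_const assms])
      (auto simp: tree_family_def bounded_tree.compact_string_def)
  then show ?thesis by simp
qed

lemma computable_bound [tree_intros]:
  assumes "computable tree_family f" "computable tree_family g"
  shows "computable tree_family (\<lambda>c x. snd c (f c x) (g c x))"
proof -
  have "computable tree_family (\<lambda>c x. if True then snd c (f c x) (g c x) else 0)"
    by (rule computable_oracle[where i=2, OF computable_const computable_Pair[OF assms]])
      (auto simp: tree_family_def enc_Pair)
  then show ?thesis by simp
qed

text \<open>Constants of a locale can be unfolded only where the locale holds, which is the case in
  all contexts of the family.\<close>

lemma computable_tree_unfold:
  assumes "\<And>c x. bounded_tree (fst c) (snd c) \<Longrightarrow> f c x = g c x" "computable tree_family g"
  shows "computable tree_family f"
  using assms(2) by (rule computable_cong) (metis assms(1) tree_familyD)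

lemma computable_valid [tree_intros]:
  assumes "computable tree_family f"
  shows "computable tree_family (\<lambda>c x. bounded_tree.valid (fst c) (f c x))"
  by (rule computable_tree_unfold, erule bounded_tree.valid_def)
    (intro computable_intros tree_intros assms)

lemma computable_level [computable_intros]:
  assumes "computable F f" shows "computable F (\<lambda>c x. level (f c x))"
  unfolding level_def by (intro computable_intros assms)

lemma computable_swap_string [computable_intros]:
  assumes "computable F f" shows "computable F (\<lambda>c x. swap_string (f c x))"
  unfolding swap_string_def by (intro computable_intros assms computable_comp[OF assms])

lemma computable_string_list [computable_intros]:
  assumes "computable F f" shows "computable F (\<lambda>c x. string_list (f c x))"
  unfolding string_list_def by (intro computable_intros assms)

lemma computable_set_part [computable_intros]:
  assumes "computable F f" shows "computable F (\<lambda>c x. set_part (f c x))"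
  unfolding set_part_def by (intro computable_intros assms)

lemma computable_group_part [computable_intros]:
  assumes "computable F f" shows "computable F (\<lambda>c x. group_part (f c x))"
  unfolding group_part_def by (intro computable_intros assms)

lemma computable_extend [tree_intros]:
  assumes "computable tree_family f" "computable tree_family g"
  shows "computable tree_family (\<lambda>c x. bounded_tree.extend (fst c) (snd c) (f c x) (g c x))"
  by (rule computable_tree_unfold, erule bounded_tree.extend_def)
    (intro computable_intros tree_intros assms computable_comp[OF assms(1)] computable_comp[OF assms(2)])

lemma computable_region_le [tree_intros]:
  assumes "computable tree_family f" "computable tree_family g"
  shows "computable tree_family (\<lambda>c x. bounded_tree.region_le (fst c) (snd c) (f c x) (g c x))"
  by (rule computable_tree_unfold, erule bounded_tree.region_le_def)
    (intro computable_intros tree_intros assms computable_comp[OF assms(1)] computable_comp[OF assms(2)])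

lemma computable_region_eq [tree_intros]:
  assumes "computable tree_family f" "computable tree_family g"
  shows "computable tree_family (\<lambda>c x. bounded_tree.region_eq (fst c) (snd c) (f c x) (g c x))"
  by (rule computable_tree_unfold, erule bounded_tree.region_eq_def)
    (intro computable_intros tree_intros assms)

lemma computable_meet_code [tree_intros]:
  assumes "computable tree_family f" "computable tree_family g"
  shows "computable tree_family (\<lambda>c x. bounded_tree.meet_code (fst c) (snd c) (f c x) (g c x))"
  by (rule computable_tree_unfold, erule bounded_tree.meet_code_def)
    (intro computable_intros tree_intros assms computable_comp[OF assms(1)] computable_comp[OF assms(2)])

lemma computable_inv_code [tree_intros]:
  assumes "computable tree_family f"
  shows "computable tree_family (\<lambda>c x. bounded_tree.inv_code (fst c) (snd c) (f c x))"
  by (rule computable_tree_unfold, erule bounded_tree.inv_code_def)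
    (intro computable_intros tree_intros assms)

lemma computable_entries [tree_intros]:
  assumes "computable tree_family f" "computable tree_family g"
  shows "computable tree_family (\<lambda>c x. bounded_tree.entries (fst c) (snd c) (f c x) (g c x))"
  by (rule computable_tree_unfold, erule bounded_tree.entries_def)
    (intro computable_intros tree_intros assms)

lemma computable_product_level [tree_intros]:
  assumes "computable tree_family f" "computable tree_family g" "computable tree_family h"
  shows "computable tree_family (\<lambda>c x. bounded_tree.product_level (fst c) (snd c) (f c x) (g c x) (h c x))"
  by (rule computable_tree_unfold, erule bounded_tree.product_level_def)
    (intro computable_intros tree_intros assms)

lemma computable_product_le [tree_intros]:
  assumes "computable tree_family f" "computable tree_family g" "computable tree_family h"
  shows "computable tree_family (\<lambda>c x. bounded_tree.product_le (fst c) (snd c) (f c x) (g c x) (h c x))"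
  by (rule computable_tree_unfold, erule bounded_tree.product_le_def)
    (intro computable_intros tree_intros assms computable_comp[OF assms(1)] computable_comp[OF assms(2)] computable_comp[OF assms(3)])

lemma computable_minimal_code [tree_intros]:
  assumes "computable tree_family f"
  shows "computable tree_family (\<lambda>c x. bounded_tree.minimal_code (fst c) (snd c) (f c x))"
  by (rule computable_tree_unfold, erule bounded_tree.minimal_code_def)
    (intro computable_intros tree_intros assms computable_comp[OF assms])

lemma computable_copy_dom [tree_intros]:
  assumes "computable tree_family f"
  shows "computable tree_family (\<lambda>c x. bounded_tree.copy_dom (fst c) (snd c) (f c x))"
  by (rule computable_tree_unfold, erule bounded_tree.copy_dom_def)
    (intro computable_intros tree_intros assms computable_comp[OF assms])

lemma computable_c_inv [tree_intros]:
  assumes "computable tree_family f"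
  shows "computable tree_family (\<lambda>c x. bounded_tree.c_inv (fst c) (snd c) (f c x))"
  by (rule computable_tree_unfold, erule bounded_tree.c_inv_def)
    (intro computable_intros tree_intros assms computable_comp[OF assms] bounded_tree.c_inv_exists, rule tree_familyD)

lemma computable_c_meet [tree_intros]:
  assumes "computable tree_family f" "computable tree_family g"
  shows "computable tree_family (\<lambda>c x. bounded_tree.c_meet (fst c) (snd c) (f c x) (g c x))"
  by (rule computable_tree_unfold, erule bounded_tree.c_meet_def)
    (intro computable_intros tree_intros assms computable_comp[OF assms(1)] computable_comp[OF assms(2)] bounded_tree.c_meet_exists, rule tree_familyD)

lemma computable_c_defined [tree_intros]:
  assumes "computable tree_family f" "computable tree_family g"
  shows "computable tree_family (\<lambda>c x. bounded_tree.c_defined (fst c) (snd c) (f c x) (g c x))"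
  by (rule computable_tree_unfold, erule bounded_tree.c_defined_def)
    (intro computable_intros tree_intros assms)

lemma computable_c_prod [tree_intros]:
  assumes "computable tree_family f" "computable tree_family g"
  shows "computable tree_family (\<lambda>c x. bounded_tree.c_prod (fst c) (snd c) (f c x) (g c x))"
  by (rule computable_tree_unfold, erule bounded_tree.c_prod_def)
    (intro computable_intros tree_intros assms computable_comp[OF assms(1)] computable_comp[OF assms(2)] bounded_tree.c_prod_exists, rule tree_familyD)

lemma computable_c_subgroup [tree_intros]:
  assumes "computable tree_family f"
  shows "computable tree_family (\<lambda>c x. bounded_tree.c_subgroup (fst c) (snd c) (f c x))"
  by (rule computable_tree_unfold, erule bounded_tree.c_subgroup_def)
    (intro computable_intros tree_intros assms)

lemma computable_partition_list [tree_intros]: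
  assumes "computable tree_family f" "computable tree_family g" "computable tree_family h"
  shows "computable tree_family (\<lambda>c x. bounded_tree.partition_list (fst c) (snd c) (f c x) (g c x) (h c x))"
  by (rule computable_tree_unfold, erule bounded_tree.partition_list_def)
    (intro computable_intros tree_intros assms computable_comp[OF assms(1)] computable_comp[OF assms(2)] computable_comp[OF assms(3)])

lemma computable_c_index [tree_intros]:
  assumes "computable tree_family f" "computable tree_family g"
  shows "computable tree_family (\<lambda>c x. bounded_tree.c_index (fst c) (snd c) (f c x) (g c x))"
  by (rule computable_tree_unfold, erule bounded_tree.c_index_def)
    (intro computable_intros tree_intros assms computable_comp[OF assms(1)] computable_comp[OF assms(2)] bounded_tree.c_index_exists, rule tree_familyD)

definition oracle_indices :: "nat \<Rightarrow> nat \<Rightarrow> nat" where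
  "oracle_indices p i = nth_default 0 (list_decode p) i"

lemma computable_oracle_indices [computable_intros]:
  assumes "computable F f" "computable F g" shows "computable F (\<lambda>c x. oracle_indices (f c x) (g c x))"
  unfolding oracle_indices_def by (intro computable_intros assms)

lemma tree_family_presentation:
  assumes "closed_subgroup_Sinf C" "clc_tree_data (Tree_of C) (s, k, h)" "p = list_encode [s, k, h]"
  obtains H where "((C, H), \<lambda>i. phi (oracle_indices p i)) \<in> tree_family"
proof -
  interpret closed_subgroup C by unfold_locales (rule assms(1))
  obtain H where H: "\<And>\<sigma> i. phi h (prod_encode (list_encode \<sigma>, i)) = Some (H \<sigma> i)"
    "\<And>\<sigma> \<rho> i. compact (cyl C \<sigma>) \<Longrightarrow> \<rho> \<in> Tree_of C \<Longrightarrow> prefix \<sigma> \<rho> \<Longrightarrow> i < length \<rho> \<Longrightarrow> \<rho> ! i \<le> H \<sigma> i"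
    using assms(2) unfolding clc_tree_data_def paths_through_eq by blast
  have mem: "list_encode \<sigma> \<in> list_encode ` A \<longleftrightarrow> \<sigma> \<in> A" for \<sigma> A
    by (auto simp: list_encode_eq)
  have "bounded_tree C H" by unfold_locales (rule H(2))
  moreover have "oracle_indices p 0 = s" "oracle_indices p (Suc 0) = k" "oracle_indices p 2 = h"
    by (simp_all add: assms(3) oracle_indices_def nth_default_def)
  ultimately have "((C, H), \<lambda>i. phi (oracle_indices p i)) \<in> tree_family"
    using assms(2) H(1) by (simp add: tree_family_def clc_tree_data_def decides_def paths_through_eq mem)
  then show ?thesis by (rule that)
qed

text \<open>The six programs are found once, relative to the oracles for a tree. Only the
  substitution of the indices in p for the oracles depends on the presentation, and this is
  computable from p.\<close>

lemma meet_groupoid_algorithm: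
  "\<exists>a. \<forall>(G :: ('g, 'm) monoid_scheme) T p. tdlc_group G T \<longrightarrow> closed_subgroup_presentation G T p \<longrightarrow>
     (\<exists>q. phi a p = Some q \<and> meet_groupoid_presentation G T q)"
proof -
  let ?F = tree_family
  have dom: "computable ?F (\<lambda>c x. bounded_tree.copy_dom (fst c) (snd c) x)"
    by (intro tree_intros computable_intros)
  obtain d where d: "\<And>c w x. (c, w) \<in> ?F \<Longrightarrow> orun w d (enc x) = Some (enc (bounded_tree.copy_dom (fst c) (snd c) x))"
    using dom by (rule computableE) blast
  have "computable ?F (\<lambda>c x. bounded_tree.c_inv (fst c) (snd c) x)"
    by (intro tree_intros computable_intros)
  then obtain i where i: "\<And>c w x. (c, w) \<in> ?F \<Longrightarrow> orun w i (enc x) =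
      (if bounded_tree.copy_dom (fst c) (snd c) x then Some (enc (bounded_tree.c_inv (fst c) (snd c) x)) else None)"
    using computable_partial[OF dom] by blast
  have dom2: "computable ?F (\<lambda>c z. bounded_tree.copy_dom (fst c) (snd c) (fst z) \<and>
      bounded_tree.copy_dom (fst c) (snd c) (snd z))"
    by (intro tree_intros computable_intros)
  have "computable ?F (\<lambda>c z. bounded_tree.c_meet (fst c) (snd c) (fst z) (snd z))"
    by (intro tree_intros computable_intros)
  then obtain m where m: "\<And>c w z. (c, w) \<in> ?F \<Longrightarrow> orun w m (enc z) =
      (if bounded_tree.copy_dom (fst c) (snd c) (fst z) \<and> bounded_tree.copy_dom (fst c) (snd c) (snd z)
       then Some (enc (bounded_tree.c_meet (fst c) (snd c) (fst z) (snd z))) else None)"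
    using computable_partial[OF dom2] by blast
  have def: "computable ?F (\<lambda>c z. bounded_tree.c_defined (fst c) (snd c) (fst z) (snd z))"
    by (intro tree_intros computable_intros)
  obtain r where r: "\<And>c w z. (c, w) \<in> ?F \<Longrightarrow> orun w r (enc z) =
      Some (enc (bounded_tree.c_defined (fst c) (snd c) (fst z) (snd z)))"
    using def by (rule computableE) blast
  have "computable ?F (\<lambda>c z. bounded_tree.c_prod (fst c) (snd c) (fst z) (snd z))"
    by (intro tree_intros computable_intros)
  then obtain q where q: "\<And>c w z. (c, w) \<in> ?F \<Longrightarrow> orun w q (enc z) =
      (if bounded_tree.c_defined (fst c) (snd c) (fst z) (snd z)
       then Some (enc (bounded_tree.c_prod (fst c) (snd c) (fst z) (snd z))) else None)"
    using computable_partial[OF def] by blast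
  have sub: "computable ?F (\<lambda>c z. bounded_tree.c_subgroup (fst c) (snd c) (fst z) \<and>
      bounded_tree.c_subgroup (fst c) (snd c) (snd z))"
    by (intro tree_intros computable_intros)
  have "computable ?F (\<lambda>c z. bounded_tree.c_index (fst c) (snd c) (fst z) (snd z))"
    by (intro tree_intros computable_intros)
  then obtain h where h: "\<And>c w z. (c, w) \<in> ?F \<Longrightarrow> orun w h (enc z) =
      (if bounded_tree.c_subgroup (fst c) (snd c) (fst z) \<and> bounded_tree.c_subgroup (fst c) (snd c) (snd z)
       then Some (enc (bounded_tree.c_index (fst c) (snd c) (fst z) (snd z))) else None)"
    using computable_partial[OF sub] by blast
  define out where "out p = map (\<lambda>t. instance_index (oracle_indices p) t) [d, i, m, r, q, h]" for p
  have "computable no_oracle (\<lambda>c p. list_encode (out p))"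
    unfolding out_def list.map by (intro computable_intros)
  then obtain a where a: "\<And>p. phi a p = Some (list_encode (out p))"
    using computable_no_oracle_phi by fastforce
  have "meet_groupoid_presentation G T (list_encode (out p))"
    if G: "tdlc_group G T" and p: "closed_subgroup_presentation G T p"
    for G :: "('g, 'm) monoid_scheme" and T p
  proof -
    let ?e = "oracle_indices p"
    obtain C s k hh where C: "p = list_encode [s, k, hh]" "closed_subgroup_Sinf C"
      "topological_group_iso G T (Sinf\<lparr>carrier := C\<rparr>) (top_of_set C)" "clc_tree_data (Tree_of C) (s, k, hh)"
      using p by (auto simp: closed_subgroup_presentation_def)
    obtain H where F: "((C, H), \<lambda>i. phi (?e i)) \<in> tree_family"
      using tree_family_presentation[OF C(2,4,1)] .
    interpret bounded_tree C H using tree_familyD[OF F] by simp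
    have run: "phi (instance_index ?e t) = orun (\<lambda>i. phi (?e i)) t" for t
      by (rule phi_instance_index)
    have enc2: "prod_encode (x, y) = enc (x, y)" for x y :: nat by (simp add: enc_Pair)
    have dec: "prod_encode (x, y) \<in> prod_encode ` A \<longleftrightarrow> (x, y) \<in> A" for x y A by auto
    have "Haar_computable_data GC copy copy_set (instance_index ?e d,
      instance_index ?e i, instance_index ?e m,
      instance_index ?e r, instance_index ?e q, instance_index ?e h)"
      unfolding Haar_computable_data_def prod.case
    proof (intro conjI)
      show "decides (instance_index ?e d) (mdom copy)"
        using d[OF F] by (simp add: decides_def run copy_def)
      show "\<forall>x. phi (instance_index ?e i) x = (if x \<in> mdom copy then Some (minv copy x) else None)"
        using i[OF F] by (simp add: run copy_def)
      show "computes2 (instance_index ?e m)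
          (\<lambda>x y. if x \<in> mdom copy \<and> y \<in> mdom copy then Some (mmeet copy x y) else None)"
        unfolding computes2_def run enc2 using m[OF F] by (simp add: copy_def)
      show "decides (instance_index ?e r)
          (prod_encode ` {(x, y). x \<in> mdom copy \<and> y \<in> mdom copy \<and> mprod copy x y \<noteq> None})"
        unfolding decides_def run
      proof
        fix x
        obtain y z where x: "x = prod_encode (y, z)" by (metis prod_decode_inverse surj_pair)
        show "orun (\<lambda>i. phi (?e i)) r x = Some (of_bool (x \<in> prod_encode `
            {(x, y). x \<in> mdom copy \<and> y \<in> mdom copy \<and> mprod copy x y \<noteq> None}))"
          unfolding x dec unfolding enc2 r[OF F] by (simp add: copy_def c_defined_def)
      qed
      show "computes2 (instance_index ?e q)
          (\<lambda>x y. if x \<in> mdom copy \<and> y \<in> mdom copy then mprod copy x y else None)"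
        unfolding computes2_def run enc2 q[OF F] by (auto simp: copy_def c_defined_def)
      show "computes2 (instance_index ?e h) (\<lambda>u v. if u \<in> msubgroups copy \<and> v \<in> msubgroups copy
          then Some (subgroup_index GC (copy_set u) (copy_set u \<inter> copy_set v)) else None)"
        unfolding computes2_def run enc2 h[OF F] by (simp add: msubgroups_copy c_index)
    qed
    then have via: "meet_groupoid_presentation_via GC TC copy copy_set (list_encode (out p))"
      using meet_groupoid_iso_copy by (auto simp: meet_groupoid_presentation_via_def out_def)
    have tG: "topological_group G T" using G by (simp add: tdlc_group_def)
    have tC: "topological_group GC TC" using CG.top_group_axioms by (simp add: top_group_iff)
    obtain f where "top_group_iso GC TC G T f"
      using topological_group_iso_obtain[OF topological_group_iso_sym[OF C(3) tG tC] tC tG] .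
    then have "meet_groupoid_presentation_via G T copy (\<lambda>x. f ` copy_set x) (list_encode (out p))"
      using top_group_iso.presentation_via_image via by blast
    then show ?thesis by (auto simp: meet_groupoid_presentation_def)
  qed
  then show ?thesis using a by blast
qed


section \<open>Van Dantzig's theorem\<close>

locale tdlc = top_group +
  assumes totally_disconnected: "totally_disconnected_space T"
    and locally_compact: "locally_compact_space T"
begin

text \<open>Total disconnectedness gives an open set that contains exactly one of z and 1. If it
  contains 1, its preimage under the map from g to g^-1 z is used: that map exchanges z and 1, so
  the preimage contains z and not 1.\<close>

lemma closedin_one: "closedin T {\<one>}"
proof -
  have "\<exists>V. openin T V \<and> z \<in> V \<and> V \<subseteq> topspace T - {\<one>}" if "z \<in> topspace T - {\<one>}" for z
  proof -
    have z: "z \<in> carrier G" "z \<noteq> \<one>" using that by (auto simp: topspace_eq)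
    obtain V where V: "openin T V" "(z \<in> V) \<noteq> (\<one> \<in> V)"
      using totally_disconnected_imp_t0[OF totally_disconnected, of z \<one>] z by (auto simp: topspace_eq)
    show ?thesis
    proof (cases "z \<in> V")
      case True
      then show ?thesis using V openin_subset by blast
    next
      case False
      let ?V = "{g \<in> topspace T. inv g \<otimes> z \<in> V}"
      have "continuous_map T T (\<lambda>g. inv g \<otimes> z)"
        by (intro continuous_mult2 continuous_inv) (simp add: z(1) topspace_eq)
      then have "openin T ?V" using V(1) by (rule openin_continuous_map_preimage)
      moreover have "z \<in> ?V" "\<one> \<notin> ?V" using V(2) False z by (auto simp: topspace_eq)
      ultimately show ?thesis by blast
    qed
  qed
  then have "openin T (topspace T - {\<one>})" by (subst openin_subopen) blast
  then show ?thesis by (simp add: closedin_def topspace_eq)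
qed

text \<open>The diagonal is the preimage of the closed set {1} under the map to x^-1 y.\<close>

lemma Hausdorff: "Hausdorff_space T"
proof -
  have "continuous_map (prod_topology T T) T (\<lambda>p. inv (fst p) \<otimes> snd p)"
    by (intro continuous_mult2 continuous_inv_compose continuous_map_fst continuous_map_snd)
  from closedin_continuous_map_preimage[OF this closedin_one]
  have "closedin (prod_topology T T) {p \<in> topspace (prod_topology T T). inv (fst p) \<otimes> snd p \<in> {\<one>}}" .
  moreover have "{p \<in> topspace (prod_topology T T). inv (fst p) \<otimes> snd p \<in> {\<one>}} = (\<lambda>x. (x, x)) ` topspace T"
  proof -
    have "inv x \<otimes> y = \<one> \<longleftrightarrow> x = y" if "x \<in> carrier G" "y \<in> carrier G" for x y
      using that inv_solve_left'[of \<one> x y] by auto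
    then show ?thesis by (auto simp: topspace_eq image_iff)
  qed
  ultimately show ?thesis by (simp add: Hausdorff_space_closedin_diagonal)
qed

text \<open>In the compact Hausdorff neighbourhood Q components and quasi-components coincide, so
  {1} is a quasi-component and a clopen set of Q separates it from the compact rest outside N
  \<inter> W. Being inside N, that set is open in the whole group.\<close>

lemma compact_open_neighbourhood:
  assumes W: "openin T W" "\<one> \<in> W"
  obtains K where "compactin T K" "openin T K" "\<one> \<in> K" "K \<subseteq> W"
proof -
  have "\<one> \<in> topspace T" by (simp add: topspace_eq)
  then obtain N Q where N: "openin T N" "compactin T Q" "\<one> \<in> N" "N \<subseteq> Q"
    using locally_compact unfolding locally_compact_space_def by blast
  define X where "X = subtopology T Q"
  have top: "topspace X = Q" using compactin_subset_topspace[OF N(2)] by (auto simp: X_def)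
  have cX: "compact_space X" using N(2) by (auto simp: X_def compactin_subspace)
  have quasi: "quasi_components_of X = connected_components_of X"
    by (rule quasi_eq_connected_components_of) (use cX in \<open>simp add: X_def Hausdorff_space_subtopology[OF Hausdorff]\<close>)
  have "connected_component_of_set X \<one> = {\<one>}"
  proof -
    have "connectedin X (connected_component_of_set X \<one>)" by (rule connectedin_connected_component_of)
    then have "connectedin T (connected_component_of_set X \<one>)" by (simp add: X_def connectedin_subtopology)
    then obtain x where "connected_component_of_set X \<one> \<subseteq> {x}"
      using totally_disconnected unfolding totally_disconnected_space_def by blast
    moreover have "\<one> \<in> connected_component_of_set X \<one>"
      using N(3,4) by (auto simp: connected_component_of_refl top)
    ultimately show ?thesis by blast
  qed
  moreover have "connected_component_of_set X \<one> \<in> connected_components_of X"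
    using N(3,4) by (auto simp: connected_components_of_def top)
  ultimately have comp: "{\<one>} \<in> quasi_components_of X" using quasi by simp
  have "openin X (N \<inter> W \<inter> Q)"
    using openin_Int[OF N(1) W(1)] by (auto simp: X_def openin_subtopology)
  from closedin_diff[OF closedin_topspace this] have "closedin X (Q - (N \<inter> W))"
    by (simp add: top Diff_Int)
  then have F: "compactin X (Q - (N \<inter> W))" using cX closedin_compact_space by blast
  have "separated_between X {\<one>} (Q - (N \<inter> W))"
    using separated_between_quasi_component_compact[OF comp F] N(3) W(2) by (simp add: disjnt_iff)
  then obtain K where K: "closedin X K" "openin X K" "{\<one>} \<subseteq> K" "Q - (N \<inter> W) \<subseteq> topspace X - K"
    unfolding separated_between by blast
  have KQ: "K \<subseteq> Q" using closedin_subset[OF K(1)] top by simp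
  then have KN: "K \<subseteq> N \<inter> W" using K(4) by blast
  obtain S where S: "openin T S" "K = S \<inter> Q" using K(2) by (auto simp: X_def openin_subtopology)
  then have "K = S \<inter> (N \<inter> W)" using KN N(4) by blast
  then have "openin T K" using S(1) N(1) W(1) by (simp add: openin_Int)
  moreover have "compactin T K"
    using closedin_compact_space[OF cX K(1)] by (simp add: X_def compactin_subtopology)
  ultimately show ?thesis using K(3) KN that by blast
qed

text \<open>The elements with K g \<subseteq> K and K g^-1 \<subseteq> K form a subgroup. It lies in
  K because 1 does, is closed and hence compact, and is open because K is compact and open.\<close>

theorem van_dantzig:
  assumes W: "openin T W" "\<one> \<in> W"
  obtains V where "compact_open_subgroup G T V" "V \<subseteq> W"
proof -
  obtain K where K: "compactin T K" "openin T K" "\<one> \<in> K" "K \<subseteq> W"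
    using compact_open_neighbourhood[OF W] .
  have Kc: "K \<subseteq> carrier G" using openin_carrier K(2) by blast
  have Kcl: "closedin T K" using compactin_imp_closedin[OF Hausdorff K(1)] .
  define V1 where "V1 = {g \<in> carrier G. \<forall>k\<in>K. k \<otimes> g \<in> K}"
  define V where "V = {g \<in> V1. inv g \<in> V1}"
  have V_eq: "V1 \<inter> {g \<in> topspace T. inv g \<in> V1} = V" by (auto simp: V_def V1_def topspace_eq)
  have V: "V \<subseteq> carrier G" by (auto simp: V_def V1_def)
  have "subgroup V G"
  proof
    show "V \<subseteq> carrier G" by (rule V)
    show "\<one> \<in> V" using Kc by (auto simp: V_def V1_def)
    show "x \<otimes> y \<in> V" if "x \<in> V" "y \<in> V" for x y
      using that Kc by (simp add: V_def V1_def inv_mult_group subset_iff flip: m_assoc)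
    show "inv x \<in> V" if "x \<in> V" for x using that by (simp add: V_def V1_def)
  qed
  moreover have "openin T V1"
  proof -
    \<comment> \<open>The complement of \<open>V1\<close> is the projection of the closed set of
      pairs (k, g) with k g outside K; projecting along the compact K is a closed map.\<close>
    define X where "X = prod_topology (subtopology T K) T"
    have "continuous_map X T fst" "continuous_map X T snd"
      using continuous_map_in_subtopology[THEN iffD1, OF continuous_map_fst[of "subtopology T K" T]]
        continuous_map_snd by (auto simp: X_def)
    then have "continuous_map X T (\<lambda>p. fst p \<otimes> snd p)" by (rule continuous_mult2)
    then have "closedin X {p \<in> topspace X. fst p \<otimes> snd p \<in> topspace T - K}"
      by (rule closedin_continuous_map_preimage) (use K(2) in blast)
    moreover have "closed_map X T snd"
      unfolding X_def by (rule closed_map_snd) (use K(1) in \<open>simp add: compactin_subspace\<close>)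
    ultimately have "closedin T (snd ` {p \<in> topspace X. fst p \<otimes> snd p \<in> topspace T - K})"
      unfolding closed_map_def by blast
    moreover have "snd ` {p \<in> topspace X. fst p \<otimes> snd p \<in> topspace T - K} = topspace T - V1"
      using Kc by (force simp: X_def V1_def topspace_eq image_iff)
    ultimately have "openin T (topspace T - (topspace T - V1))" by (metis closedin_def)
    moreover have "topspace T - (topspace T - V1) = V1" by (auto simp: V1_def topspace_eq)
    ultimately show ?thesis by simp
  qed
  then have "openin T (V1 \<inter> {g \<in> topspace T. inv g \<in> V1})"
    using openin_continuous_map_preimage[OF continuous_inv] by (intro openin_Int) auto
  then have "openin T V" by (simp add: V_eq)
  moreover have "compactin T V"
  proof -
    have "closedin T {g \<in> topspace T. k \<otimes> g \<in> K}" if "k \<in> K" for k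
      using closedin_continuous_map_preimage[OF continuous_left Kcl, of k] that Kc by blast
    then have "closedin T (\<Inter>k\<in>K. {g \<in> topspace T. k \<otimes> g \<in> K})"
      using K(3) by (intro closedin_Inter) auto
    moreover have "(\<Inter>k\<in>K. {g \<in> topspace T. k \<otimes> g \<in> K}) = V1"
      using K(3) by (auto simp: V1_def topspace_eq)
    ultimately have V1: "closedin T V1" by simp
    have "closedin T (V1 \<inter> {g \<in> topspace T. inv g \<in> V1})"
      using closedin_continuous_map_preimage[OF continuous_inv V1] V1 by (rule closedin_Int[rotated])
    moreover have "V \<subseteq> K" using K(3) V by (auto simp: V_def V1_def subset_iff)
    ultimately show ?thesis using closed_compactin[OF K(1)] by (metis V_eq)
  qed
  moreover have "V \<subseteq> W" using K(3,4) V by (auto simp: V_def V1_def subset_iff)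
  ultimately show ?thesis using that by (simp add: compact_open_subgroup_def)
qed

lemma coset_base:
  assumes "openin T W" "g \<in> W"
  obtains V where "compact_open_subgroup G T V" "g <# V \<subseteq> W"
proof -
  have g: "g \<in> carrier G" using openin_carrier assms by blast
  have "openin T (inv g <# W)" "\<one> \<in> inv g <# W"
    using openin_l_coset[OF assms(1)] g assms mem_l_coset[OF openin_carrier[OF assms(1)], of "inv g" \<one>] by auto
  then obtain V where V: "compact_open_subgroup G T V" "V \<subseteq> inv g <# W"
    using van_dantzig by blast
  have "g <# V \<subseteq> W"
    using V(2) g mem_l_coset[OF openin_carrier[OF assms(1)], of "inv g"] by (auto simp: l_coset_def)
  then show ?thesis using V(1) that by blast
qed

end


section \<open>The action on a copy of the meet groupoid\<close>

text \<open>Here and below the total versions of the operations return 0 outside the domain, as a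
  default for \<open>computable_oracle\<close> when its guard fails.\<close>

definition dinv :: "meet_structure \<Rightarrow> nat \<Rightarrow> nat" where
  "dinv M x = (if x \<in> mdom M then minv M x else 0)"

definition dmeet :: "meet_structure \<Rightarrow> nat \<Rightarrow> nat \<Rightarrow> nat" where
  "dmeet M x y = (if x \<in> mdom M \<and> y \<in> mdom M then mmeet M x y else 0)"

definition pdefined :: "meet_structure \<Rightarrow> nat \<Rightarrow> nat \<Rightarrow> bool" where
  "pdefined M x y \<longleftrightarrow> x \<in> mdom M \<and> y \<in> mdom M \<and> mprod M x y \<noteq> None"

definition pprod :: "meet_structure \<Rightarrow> nat \<Rightarrow> nat \<Rightarrow> nat" where
  "pprod M x y = (if pdefined M x y then the (mprod M x y) else 0)"

text \<open>The quotient of y by x is y x^-1, defined if both are left cosets of the same subgroup.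
  It names the set of all g with g x = y.\<close>

definition qdefined :: "meet_structure \<Rightarrow> nat \<Rightarrow> nat \<Rightarrow> bool" where
  "qdefined M y x \<longleftrightarrow> x \<in> mdom M \<and> pdefined M y (dinv M x)"

definition quot :: "meet_structure \<Rightarrow> nat \<Rightarrow> nat \<Rightarrow> nat" where
  "quot M y x = pprod M y (dinv M x)"

text \<open>The quotient x x^-1 exists for every coset and not for the empty set, so that the name
  of the empty set is recognised without being given.\<close>

definition nonempty :: "meet_structure \<Rightarrow> nat \<Rightarrow> bool" where
  "nonempty M x \<longleftrightarrow> qdefined M x x"

locale groupoid_copy = tdlc +
  fixes M \<theta>
  assumes copy_iso: "meet_groupoid_iso G T M \<theta>"
begin

lemma theta_bij: "bij_betw \<theta> (mdom M) (meet_groupoid G T)"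
  and minv: "x \<in> mdom M \<Longrightarrow> minv M x \<in> mdom M" "x \<in> mdom M \<Longrightarrow> \<theta> (minv M x) = set_inv (\<theta> x)"
  and mmeet: "x \<in> mdom M \<Longrightarrow> y \<in> mdom M \<Longrightarrow> mmeet M x y \<in> mdom M"
    "x \<in> mdom M \<Longrightarrow> y \<in> mdom M \<Longrightarrow> \<theta> (mmeet M x y) = \<theta> x \<inter> \<theta> y"
  and mprod: "x \<in> mdom M \<Longrightarrow> y \<in> mdom M \<Longrightarrow> set_option (mprod M x y) \<subseteq> mdom M"
    "x \<in> mdom M \<Longrightarrow> y \<in> mdom M \<Longrightarrow> map_option \<theta> (mprod M x y) = meet_groupoid_prod G T (\<theta> x) (\<theta> y)"
  using copy_iso by (simp_all add: meet_groupoid_iso_def)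

lemma theta_cases: "x \<in> mdom M \<Longrightarrow> \<theta> x = {} \<or> coset (\<theta> x)"
  using bij_betw_apply[OF theta_bij] by (auto simp: meet_groupoid_eq)

lemma theta_carrier: "x \<in> mdom M \<Longrightarrow> \<theta> x \<subseteq> carrier G"
  using theta_cases cosetD(4) by blast

lemma theta_inj: "x \<in> mdom M \<Longrightarrow> y \<in> mdom M \<Longrightarrow> \<theta> x = \<theta> y \<longleftrightarrow> x = y"
  using bij_betw_imp_inj_on[OF theta_bij] by (auto simp: inj_on_def)

lemma theta_surj:
  assumes "A = {} \<or> coset A" shows "\<exists>x\<in>mdom M. \<theta> x = A"
proof -
  have "A \<in> \<theta> ` mdom M"
    unfolding bij_betw_imp_surj_on[OF theta_bij] meet_groupoid_eq using assms by simp
  then show ?thesis by blast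
qed

lemma pdefined_iff:
  "pdefined M x y \<longleftrightarrow> x \<in> mdom M \<and> y \<in> mdom M \<and> coset (\<theta> x) \<and> coset (\<theta> y) \<and>
     right_group (\<theta> x) = left_group (\<theta> y)"
proof (cases "x \<in> mdom M \<and> y \<in> mdom M")
  case True
  have "mprod M x y \<noteq> None \<longleftrightarrow> map_option \<theta> (mprod M x y) \<noteq> None" by simp
  also have "\<dots> \<longleftrightarrow> coset (\<theta> x) \<and> coset (\<theta> y) \<and> right_group (\<theta> x) = left_group (\<theta> y)"
    unfolding mprod(2)[OF conjunct1[OF True] conjunct2[OF True]] meet_groupoid_prod_eq by simp
  finally show ?thesis using True by (simp add: pdefined_def)
qed (auto simp: pdefined_def)

lemma pprod:
  assumes "pdefined M x y" shows "pprod M x y \<in> mdom M" "\<theta> (pprod M x y) = \<theta> x <#> \<theta> y"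
proof -
  have xy: "x \<in> mdom M" "y \<in> mdom M" using assms by (auto simp: pdefined_def)
  obtain z where z: "mprod M x y = Some z" using assms by (auto simp: pdefined_def)
  have "Some (\<theta> z) = meet_groupoid_prod G T (\<theta> x) (\<theta> y)"
    using mprod(2)[OF xy] z by simp
  then have "\<theta> z = \<theta> x <#> \<theta> y"
    using assms unfolding pdefined_iff meet_groupoid_prod_eq by simp
  then show "pprod M x y \<in> mdom M" "\<theta> (pprod M x y) = \<theta> x <#> \<theta> y"
    using assms z mprod(1)[OF xy] by (simp_all add: pprod_def)
qed

lemma dinv: "x \<in> mdom M \<Longrightarrow> dinv M x \<in> mdom M" "x \<in> mdom M \<Longrightarrow> \<theta> (dinv M x) = set_inv (\<theta> x)"
  using minv by (simp_all add: dinv_def)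

lemma dmeet:
  "x \<in> mdom M \<Longrightarrow> y \<in> mdom M \<Longrightarrow> dmeet M x y \<in> mdom M"
  "x \<in> mdom M \<Longrightarrow> y \<in> mdom M \<Longrightarrow> \<theta> (dmeet M x y) = \<theta> x \<inter> \<theta> y"
  using mmeet by (simp_all add: dmeet_def)

lemma coset_set_inv_iff:
  assumes "A \<subseteq> carrier G" shows "coset (set_inv A) \<longleftrightarrow> coset A"
  using coset_set_inv set_inv_set_inv[OF assms] by metis

lemma qdefined_iff:
  "qdefined M y x \<longleftrightarrow> x \<in> mdom M \<and> y \<in> mdom M \<and> coset (\<theta> x) \<and> coset (\<theta> y) \<and>
     right_group (\<theta> y) = right_group (\<theta> x)"
proof (cases "x \<in> mdom M")
  case True
  then show ?thesis
    using dinv[OF True] coset_set_inv_iff[OF theta_carrier[OF True]] left_group_set_inv[OF theta_carrier[OF True]]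
    by (auto simp: qdefined_def pdefined_iff)
qed (simp add: qdefined_def)

lemma nonempty_iff: "nonempty M x \<longleftrightarrow> x \<in> mdom M \<and> coset (\<theta> x)"
  by (auto simp: nonempty_def qdefined_iff)

lemma nonempty_iff': "x \<in> mdom M \<Longrightarrow> nonempty M x \<longleftrightarrow> \<theta> x \<noteq> {}"
  using theta_cases[of x] cosetD(3) by (auto simp: nonempty_iff)

lemma quot:
  assumes "qdefined M y x"
  shows "quot M y x \<in> mdom M" "\<theta> (quot M y x) = \<theta> y <#> set_inv (\<theta> x)" "coset (\<theta> (quot M y x))"
proof -
  have d: "pdefined M y (dinv M x)" "x \<in> mdom M" using assms by (auto simp: qdefined_def)
  show "quot M y x \<in> mdom M" "\<theta> (quot M y x) = \<theta> y <#> set_inv (\<theta> x)"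
    using pprod[OF d(1)] dinv[OF d(2)] by (simp_all add: quot_def)
  show "coset (\<theta> (quot M y x))"
    unfolding quot_def pprod(2)[OF d(1)] using d(1) by (intro coset_set_mult) (auto simp: pdefined_iff)
qed

text \<open>If g = b a^-1, then g A is b times the right group of A, which is also that of B, and so
  g A = B. The elements that move A to B thus form a coset that the copy can compute.\<close>

lemma translate_eq_iff:
  assumes A: "coset A" and B: "coset B" and g: "g \<in> carrier G" and right: "right_group B = right_group A"
  shows "g <# A = B \<longleftrightarrow> g \<in> B <#> set_inv A"
proof -
  obtain a where a: "a \<in> A" "a \<in> carrier G" using cosetD[OF A] by blast
  have Bc: "B \<subseteq> carrier G" and Ac: "A \<subseteq> carrier G" using cosetD(4) A B by auto
  show ?thesis
  proof
    assume "g <# A = B"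
    then have "g \<otimes> a \<in> B" using a by (auto simp: l_coset_def)
    then have "(g \<otimes> a) \<otimes> inv a \<in> B <#> set_inv A" using a by (auto simp: set_mult_def SET_INV_def)
    then show "g \<in> B <#> set_inv A" using g a by (simp add: m_assoc)
  next
    assume "g \<in> B <#> set_inv A"
    then obtain b a' where b: "g = b \<otimes> inv a'" "b \<in> B" "a' \<in> A" by (auto simp: set_mult_def SET_INV_def)
    have c: "b \<in> carrier G" "a' \<in> carrier G" using b Ac Bc by auto
    have "g <# A = b <# (inv a' <# A)" using b(1) c lcos_m_assoc[OF Ac] by simp
    also have "inv a' <# A = right_group A" using right_group_eq[OF A b(3)] by simp
    also have "b <# right_group A = B" using coset_eq_l_coset[OF B b(2)] right by simp
    finally show "g <# A = B" .
  qed
qed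

text \<open>Numbers outside the domain are fixed, so that the group acts by permutations of all
  numbers.\<close>

definition act :: "'a \<Rightarrow> nat \<Rightarrow> nat" where
  "act g x = (if x \<in> mdom M then inv_into (mdom M) \<theta> (g <# \<theta> x) else x)"

lemma act_mdom:
  assumes "g \<in> carrier G" "x \<in> mdom M" shows "act g x \<in> mdom M" "\<theta> (act g x) = g <# \<theta> x"
proof -
  have "g <# \<theta> x = {} \<or> coset (g <# \<theta> x)"
    using theta_cases[OF assms(2)] coset_translate(1)[OF _ assms(1)] by (auto simp: l_coset_def)
  from theta_surj[OF this] have "g <# \<theta> x \<in> \<theta> ` mdom M" by (metis imageI)
  then show "act g x \<in> mdom M" "\<theta> (act g x) = g <# \<theta> x"
    using assms(2) by (simp_all add: act_def inv_into_into f_inv_into_f)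
qed

lemma act_eq_iff: "g \<in> carrier G \<Longrightarrow> x \<in> mdom M \<Longrightarrow> act g x = y \<longleftrightarrow> y \<in> mdom M \<and> g <# \<theta> x = \<theta> y"
  using act_mdom theta_inj by metis

lemma act_nonempty_iff:
  assumes g: "g \<in> carrier G" and x: "nonempty M x"
  shows "act g x = y \<longleftrightarrow> qdefined M y x \<and> g \<in> \<theta> (quot M y x)"
proof -
  have x': "x \<in> mdom M" "coset (\<theta> x)" using x by (simp_all add: nonempty_iff)
  show ?thesis
  proof
    assume "act g x = y"
    then have y: "y \<in> mdom M" "g <# \<theta> x = \<theta> y" using act_eq_iff[OF g x'(1)] by auto
    then have d: "qdefined M y x"
      using coset_translate[OF x'(2) g] x' by (simp add: qdefined_iff)
    then have "coset (\<theta> y)" "right_group (\<theta> y) = right_group (\<theta> x)" by (auto simp: qdefined_iff)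
    from translate_eq_iff[OF x'(2) this(1) g this(2)] show "qdefined M y x \<and> g \<in> \<theta> (quot M y x)"
      unfolding quot(2)[OF d] using y(2) d by blast
  next
    assume d: "qdefined M y x \<and> g \<in> \<theta> (quot M y x)"
    then have "coset (\<theta> y)" "right_group (\<theta> y) = right_group (\<theta> x)" "y \<in> mdom M"
      by (auto simp: qdefined_iff)
    from translate_eq_iff[OF x'(2) this(1) g this(2)] this(3) show "act g x = y"
      using quot(2)[OF conjunct1[OF d]] d act_eq_iff[OF g x'(1)] by blast
  qed
qed

lemma act_trivial: "g \<in> carrier G \<Longrightarrow> \<not> nonempty M x \<Longrightarrow> act g x = x"
  using act_eq_iff[of g x x] theta_cases[of x] by (cases "x \<in> mdom M") (auto simp: nonempty_iff l_coset_def act_def)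

lemma act_one: "act \<one> x = x"
  using act_eq_iff[of \<one> x x] lcos_mult_one[OF theta_carrier] by (cases "x \<in> mdom M") (auto simp: act_def)

lemma act_mult:
  assumes "g \<in> carrier G" "h \<in> carrier G" shows "act (g \<otimes> h) x = act g (act h x)"
proof (cases "x \<in> mdom M")
  case True
  then show ?thesis
    using act_eq_iff[of "g \<otimes> h" x] act_mdom assms lcos_m_assoc[OF theta_carrier[OF True] assms] by simp
qed (simp add: act_def)

lemma act_inv: "g \<in> carrier G \<Longrightarrow> act (inv g) (act g x) = x" "g \<in> carrier G \<Longrightarrow> act g (act (inv g) x) = x"
  by (simp_all add: act_one flip: act_mult)

section \<open>The embedding into the symmetric group and its closed image\<close>

definition emb :: "'a \<Rightarrow> nat \<Rightarrow> nat" where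
  "emb g = interleave (act g) (act (inv g))"

definition "C = emb ` carrier G"

lemma emb_even: "emb g (2 * i) = act g i" and emb_odd: "emb g (Suc (2 * i)) = act (inv g) i"
  by (simp_all add: emb_def interleave_def)

lemma emb_carrier: "g \<in> carrier G \<Longrightarrow> emb g \<in> carrier Sinf"
  by (simp add: carrier_Sinf inverse_pairs_def emb_even emb_odd act_inv)

lemma emb_mult: "g \<in> carrier G \<Longrightarrow> h \<in> carrier G \<Longrightarrow> emb (g \<otimes> h) = mult_S (emb g) (emb h)"
  by (rule ext) (auto simp: mult_S_def emb_even emb_odd act_mult inv_mult_group elim!: evenE oddE)

text \<open>Some g V with V a compact open subgroup avoids h, so g V differs from h V, and g and h
  move the name of V to different numbers.\<close>

lemma emb_inj: "inj_on emb (carrier G)"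
proof (rule inj_onI, rule ccontr)
  fix g h assume gh: "g \<in> carrier G" "h \<in> carrier G" "emb g = emb h" "g \<noteq> h"
  have "g \<in> topspace T - {h}" using gh by (simp add: topspace_eq)
  moreover have "openin T (topspace T - {h})"
    using closedin_Hausdorff_singleton[OF Hausdorff, of h] gh(2) by (simp add: topspace_eq closedin_def)
  ultimately obtain V where V: "compact_open_subgroup G T V" "g <# V \<subseteq> topspace T - {h}"
    using coset_base by metis
  obtain x where x: "x \<in> mdom M" "\<theta> x = V" using theta_surj[of V] coset_subgroup[OF V(1)] by blast
  have "act g x = act h x" using gh(3) by (metis emb_even)
  then have "g <# V = h <# V" using act_mdom(2)[OF gh(1) x(1)] act_mdom(2)[OF gh(2) x(1)] x(2) by simp
  moreover have "h \<in> h <# V"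
    using V(1) gh(2) by (force simp: compact_open_subgroup_iff l_coset_def)
  ultimately show False using V(2) by blast
qed

lemma act_open: "openin T {g \<in> carrier G. act g x = y}"
proof (cases "nonempty M x")
  case True
  show ?thesis
  proof (cases "qdefined M y x")
    case d: True
    have "{g \<in> carrier G. act g x = y} = \<theta> (quot M y x)"
      using act_nonempty_iff[OF _ True] d cosetD(4)[OF quot(3)[OF d]] by auto
    then show ?thesis using cosetD(2)[OF quot(3)[OF d]] by simp
  next
    case False
    then have "{g \<in> carrier G. act g x = y} = {}" using act_nonempty_iff[OF _ True] by auto
    then show ?thesis by (simp only: openin_empty)
  qed
next
  case False
  then have "{g \<in> carrier G. act g x = y} = (if x = y then topspace T else {})"
    using act_trivial by (auto simp: topspace_eq)
  then show ?thesis by (metis openin_empty openin_topspace)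
qed

lemma continuous_act: "continuous_map T euclidean (\<lambda>g. act g x)"
proof -
  have "openin T {g \<in> topspace T. act g x \<in> U}" for U
  proof -
    have "{g \<in> topspace T. act g x \<in> U} = (\<Union>y\<in>U. {g \<in> carrier G. act g x = y})"
      by (auto simp: topspace_eq)
    then show ?thesis using act_open by auto
  qed
  then show ?thesis by (simp add: continuous_map_def)
qed

lemma continuous_emb: "continuous_map T euclidean emb"
proof -
  have "continuous_map T euclidean (\<lambda>g. emb g i)" for i
  proof (cases "even i")
    case True
    then show ?thesis using continuous_act by (auto simp: emb_even elim!: evenE)
  next
    case False
    have "continuous_map T euclidean (\<lambda>g. act (inv g) x)" for x
      using continuous_map_compose[OF continuous_inv continuous_act] by (simp add: o_def)
    then show ?thesis using False by (auto simp: emb_odd elim!: oddE)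
  qed
  then show ?thesis by (simp add: continuous_map_componentwise_UNIV flip: euclidean_product_topology)
qed

text \<open>For openness: an open set around g contains some g V, and the entry of
  \<open>emb g\<close> at twice the name of V determines the coset g V. So a single coordinate
  describes the neighbourhood.\<close>

lemma emb_homeo: "homeomorphic_map T (top_of_set C) emb"
proof (rule bijective_open_imp_homeomorphic_map)
  show "continuous_map T (top_of_set C) emb"
    using continuous_emb by (auto simp: continuous_map_in_subtopology C_def topspace_eq)
  show "emb ` topspace T = topspace (top_of_set C)" by (simp add: C_def topspace_eq)
  show "inj_on emb (topspace T)" using emb_inj by (simp add: topspace_eq)
  show "open_map T (top_of_set C) emb"
    unfolding open_map_def
  proof (intro allI impI)
    fix W assume W: "openin T W"
    have "\<exists>S. openin (top_of_set C) S \<and> f \<in> S \<and> S \<subseteq> emb ` W" if "f \<in> emb ` W" for f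
    proof -
      obtain g where g: "f = emb g" "g \<in> W" "g \<in> carrier G" using \<open>f \<in> emb ` W\<close> W openin_carrier by blast
      obtain V where V: "compact_open_subgroup G T V" "g <# V \<subseteq> W" using coset_base[OF W g(2)] .
      obtain x where x: "x \<in> mdom M" "\<theta> x = V" using theta_surj[of V] coset_subgroup[OF V(1)] by blast
      let ?S = "C \<inter> (\<lambda>f. f (2 * x)) -` {f (2 * x)}"
      have "open ((\<lambda>f :: nat \<Rightarrow> nat. f (2 * x)) -` {f (2 * x)})"
        by (intro open_vimage continuous_on_product_coordinates) (simp add: open_discrete)
      then have "openin (top_of_set C) ?S" by (auto simp: openin_open)
      moreover have "f \<in> ?S" using g by (auto simp: C_def)
      moreover have "?S \<subseteq> emb ` W"
      proof
        fix f' assume "f' \<in> ?S"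
        then obtain h where h: "h \<in> carrier G" "f' = emb h" "act h x = act g x"
          using g(1) by (auto simp: C_def emb_even)
        then have "h <# V = g <# V"
          using act_mdom(2)[OF h(1) x(1)] act_mdom(2)[OF g(3) x(1)] x(2) by simp
        moreover have "h \<in> h <# V"
          using V(1) h(1) by (force simp: compact_open_subgroup_iff l_coset_def)
        ultimately show "f' \<in> emb ` W" using V(2) h(2) by blast
      qed
      ultimately show ?thesis by blast
    qed
    then show "openin (top_of_set C) (emb ` W)" by (subst openin_subopen) blast
  qed
qed

lemma C_subset: "C \<subseteq> carrier Sinf"
  using emb_carrier by (auto simp: C_def)

lemma emb_iso: "emb \<in> iso G (Sinf\<lparr>carrier := C\<rparr>)"
  using emb_inj emb_mult by (auto simp: iso_def hom_def bij_betw_def C_def mult_Sinf)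

lemma subgroup_C: "subgroup C Sinf"
proof (rule group.subgroupI[OF group_Sinf C_subset])
  show "C \<noteq> {}" by (auto simp: C_def)
  show "inv\<^bsub>Sinf\<^esub> f \<in> C" if f: "f \<in> C" for f
  proof -
    obtain g where g: "g \<in> carrier G" "f = emb g" using f by (auto simp: C_def)
    have "inv_S (emb g) = emb (inv g)"
      using g(1) by (auto simp: fun_eq_iff inv_S_def emb_even emb_odd elim!: evenE oddE)
    then show ?thesis using g by (simp add: C_def inv_Sinf emb_carrier)
  qed
  show "f \<otimes>\<^bsub>Sinf\<^esub> f' \<in> C" if "f \<in> C" "f' \<in> C" for f f'
    using that by (auto simp: C_def mult_Sinf simp flip: emb_mult)
qed

lemma nonempty_exists: "\<exists>x. nonempty M x"
proof -
  have "openin T (topspace T)" by (rule openin_topspace)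
  moreover have "\<one> \<in> topspace T" by (simp add: topspace_eq)
  ultimately obtain V where "compact_open_subgroup G T V" using van_dantzig by blast
  then show ?thesis using theta_surj[of V] coset_subgroup[of V] by (auto simp: nonempty_iff)
qed

text \<open>The elements that agree with f up to n form a decreasing sequence of nonempty closed
  sets. As soon as the image of one nonempty coset is prescribed, they lie in the compact coset of
  all elements with that image, so they have a common element.\<close>

lemma closed_C:
  assumes f: "f \<in> carrier Sinf" "\<And>n. \<exists>g\<in>carrier G. initial_of (restr f n) (emb g)"
  shows "f \<in> C"
proof -
  define Q where "Q n = {g \<in> carrier G. initial_of (restr f n) (emb g)}" for n
  have cl: "closedin T (Q n)" for n
    using closedin_continuous_map_preimage[OF continuous_emb, of "{f'. initial_of (restr f n) f'}"]
      closed_initial_of[of "restr f n"] by (simp add: Q_def topspace_eq)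
  obtain x where x: "nonempty M x" using nonempty_exists by blast
  \<comment> \<open>Long enough to include the entry at 2 x, which prescribes the image of
    x.\<close>
  define N where "N = 2 * x + 1"
  have act: "act g x = f (2 * x)" if "g \<in> Q N" for g
  proof -
    have "emb g (2 * x) = restr f N ! (2 * x)" using that by (auto simp: Q_def initial_of_def N_def)
    then show ?thesis by (simp add: N_def emb_even del: upt_Suc)
  qed
  obtain g0 where g0: "g0 \<in> Q N" using f(2)[of N] by (auto simp: Q_def)
  then have d: "qdefined M (f (2 * x)) x"
    using act_nonempty_iff[OF _ x] act[OF g0] by (auto simp: Q_def)
  have sub: "Q N \<subseteq> \<theta> (quot M (f (2 * x)) x)"
    using act act_nonempty_iff[OF _ x] by (auto simp: Q_def)
  have "compactin T (Q N)"
    using closed_compactin[OF cosetD(1)[OF quot(3)[OF d]] sub cl] .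
  then have cpt: "compact_space (subtopology T (Q N))" by (simp add: compactin_subspace)
  have dec: "Q m \<subseteq> Q n" if "n \<le> m" for m n
    using that by (auto simp: Q_def initial_of_def)
  have "(\<Inter>n. Q (N + n)) \<noteq> {}"
  proof (rule compact_space_imp_nest[OF cpt])
    show "closedin (subtopology T (Q N)) (Q (N + n))" for n
      using cl[of "N + n"] dec[of N "N + n"] by (auto simp: closedin_subtopology)
    show "Q (N + n) \<noteq> {}" for n using f(2)[of "N + n"] by (auto simp: Q_def)
    show "decseq (\<lambda>n. Q (N + n))" using dec by (auto simp: decseq_def)
  qed
  then obtain g where g: "\<And>n. g \<in> Q (N + n)" by blast
  have "emb g i = f i" for i
    using g[of "Suc i"] by (auto simp: Q_def initial_of_def simp del: upt_Suc)
  then have "f = emb g" by auto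
  then show ?thesis using g[of 0] by (auto simp: C_def Q_def)
qed

sublocale CS: closed_subgroup C
proof
  have "closedin (top_of_set (carrier Sinf)) C"
    unfolding closedin_closed
  proof (intro exI conjI)
    show "closed (closure C)" by simp
    show "C = carrier Sinf \<inter> closure C"
    proof
      show "C \<subseteq> carrier Sinf \<inter> closure C" using C_subset closure_subset by auto
      show "carrier Sinf \<inter> closure C \<subseteq> C"
      proof
        fix f assume f: "f \<in> carrier Sinf \<inter> closure C"
        have "\<exists>g\<in>carrier G. initial_of (restr f n) (emb g)" for n
        proof -
          have "f \<in> {f'. initial_of (restr f n) f'}" by (simp add: initial_of_def)
          then have "{f'. initial_of (restr f n) f'} \<inter> C \<noteq> {}"
            using f open_Int_closure_eq_empty[OF open_initial_of, of "restr f n" C] by blast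
          then show ?thesis by (auto simp: C_def)
        qed
        then show "f \<in> C" using closed_C f by blast
      qed
    qed
  qed
  then show "closed_subgroup_Sinf C" using subgroup_C by (simp add: closed_subgroup_Sinf_def)
qed

lemma iso_C: "topological_group_iso G T (Sinf\<lparr>carrier := C\<rparr>) (top_of_set C)"
  using emb_iso emb_homeo by (auto simp: topological_group_iso_def)

end


section \<open>The tree of the action\<close>

text \<open>Each entry as the demand that g moves the first number to the second. An odd entry is a
  value of the inverse, so its pair is turned around.\<close>

definition string_pairs :: "nat list \<Rightarrow> (nat \<times> nat) list" where
  "string_pairs \<eta> = map (\<lambda>i. if even i then (i div 2, nth_default 0 \<eta> i) else (nth_default 0 \<eta> i, i div 2)) [0..<length \<eta>]"

text \<open>What a demand must satisfy for any g to meet it: a coset moves only to left cosets of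
  the same subgroup, and all other numbers are fixed.\<close>

definition pair_ok :: "meet_structure \<Rightarrow> nat \<times> nat \<Rightarrow> bool" where
  "pair_ok M p \<longleftrightarrow> (if nonempty M (fst p) then qdefined M (snd p) (fst p) else snd p = fst p)"

text \<open>The list \<^term>\<open>es\<close> is empty for a noncompact group; otherwise it consists of the element that denotes
  the whole group, so that even the empty string is constrained to a compact coset.\<close>

definition constraints :: "meet_structure \<Rightarrow> nat list \<Rightarrow> nat list \<Rightarrow> nat list" where
  "constraints M es \<eta> = map (\<lambda>p. quot M (snd p) (fst p)) (filter (\<lambda>p. nonempty M (fst p)) (string_pairs \<eta>)) @ es"

definition meet_list :: "meet_structure \<Rightarrow> nat list \<Rightarrow> nat" where
  "meet_list M ds = fold (\<lambda>y b. dmeet M y b) (tl ds) (hd_default ds)"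

definition in_tree :: "meet_structure \<Rightarrow> nat list \<Rightarrow> nat list \<Rightarrow> bool" where
  "in_tree M es \<eta> \<longleftrightarrow> (\<forall>p\<in>set (string_pairs \<eta>). pair_ok M p) \<and>
     (constraints M es \<eta> \<noteq> [] \<longrightarrow> nonempty M (meet_list M (constraints M es \<eta>)))"

definition bounded_string :: "meet_structure \<Rightarrow> nat list \<Rightarrow> nat list \<Rightarrow> bool" where
  "bounded_string M es \<eta> \<longleftrightarrow> in_tree M es \<eta> \<and> constraints M es \<eta> \<noteq> []"

definition is_subgroup :: "meet_structure \<Rightarrow> nat \<Rightarrow> bool" where
  "is_subgroup M u \<longleftrightarrow> pdefined M u u \<and> pprod M u u = u"

definition dindex :: "meet_structure \<Rightarrow> (nat \<Rightarrow> nat \<Rightarrow> nat) \<Rightarrow> nat \<Rightarrow> nat \<Rightarrow> nat" where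
  "dindex M I u v = (if is_subgroup M u \<and> is_subgroup M v then I u v else 0)"

text \<open>Single values can be verified in the copy, but only their number shows that none is
  missing. It is the index in D^-1 D of the intersection with x x^-1, the stabiliser of x.\<close>

definition orbit_list :: "meet_structure \<Rightarrow> (nat \<Rightarrow> nat \<Rightarrow> nat) \<Rightarrow> nat \<Rightarrow> nat \<Rightarrow> nat list \<Rightarrow> bool" where
  "orbit_list M I D x l \<longleftrightarrow> distinct l \<and> length l = dindex M I (pprod M (dinv M D) D) (quot M x x) \<and>
     (\<forall>e\<in>set l. qdefined M e x \<and> nonempty M (dmeet M (quot M e x) D))"

text \<open>At odd positions the string bounds the inverse, hence the inverted coset.\<close>

definition bounding_coset :: "meet_structure \<Rightarrow> nat list \<Rightarrow> nat list \<Rightarrow> nat \<Rightarrow> nat" where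
  "bounding_coset M es \<eta> i =
     (if even i then meet_list M (constraints M es \<eta>) else dinv M (meet_list M (constraints M es \<eta>)))"

text \<open>The sum of the list bounds every value in it. A number that does not name a nonempty
  coset is fixed, so there the entry is known exactly.\<close>

definition string_bound :: "meet_structure \<Rightarrow> (nat \<Rightarrow> nat \<Rightarrow> nat) \<Rightarrow> nat list \<Rightarrow> nat list \<Rightarrow> nat \<Rightarrow> nat" where
  "string_bound M I es \<eta> i =
     (if nonempty M (i div 2)
      then sum_list (list_decode (LEAST m. bounded_string M es \<eta> \<and> nonempty M (i div 2) \<longrightarrow>
             orbit_list M I (bounding_coset M es \<eta> i) (i div 2) (list_decode m)))
      else i div 2)"

text \<open>Both images are the quotient of V by the same equivalence relation.\<close>

lemma bij_betw_image_quotients: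
  assumes "\<And>v w. v \<in> V \<Longrightarrow> w \<in> V \<Longrightarrow> f v = f w \<longleftrightarrow> r v = r w"
  shows "\<exists>h. bij_betw h (r ` V) (f ` V)"
proof -
  define h where "h y = f (inv_into V r y)" for y
  have h: "h (r v) = f v" if "v \<in> V" for v
    using assms[of "inv_into V r (r v)" v] inv_into_into[of "r v" r V] f_inv_into_f[of "r v" r V] that
    by (simp add: h_def)
  have "inj_on h (r ` V)" using h assms by (auto simp: inj_on_def)
  moreover have "h ` r ` V = f ` V" using h by (auto simp: image_image)
  ultimately show ?thesis by (auto simp: bij_betw_def)
qed

section \<open>The values of the action on a coset and their number\<close>

context groupoid_copy
begin

lemma is_subgroup_iff: "is_subgroup M u \<longleftrightarrow> u \<in> mdom M \<and> compact_open_subgroup G T (\<theta> u)"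
proof
  assume u: "u \<in> mdom M \<and> compact_open_subgroup G T (\<theta> u)"
  then have p: "pdefined M u u"
    using coset_subgroup right_group_subgroup by (simp add: pdefined_iff)
  have "\<theta> u <#> \<theta> u = \<theta> u"
    using u subgroup_mult_id by (simp add: compact_open_subgroup_def)
  then show "is_subgroup M u"
    using pprod[OF p] theta_inj[of "pprod M u u" u] u p by (simp add: is_subgroup_def)
next
  assume u: "is_subgroup M u"
  then have p: "pdefined M u u" and eq: "pprod M u u = u" by (auto simp: is_subgroup_def)
  have "meet_groupoid_prod G T (\<theta> u) (\<theta> u) = Some (\<theta> u)"
    using p pprod(2)[OF p] eq unfolding pdefined_iff meet_groupoid_prod_eq by simp
  moreover have "\<theta> u \<in> meet_groupoid G T" using p by (simp add: pdefined_iff meet_groupoid_eq)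
  ultimately show "u \<in> mdom M \<and> compact_open_subgroup G T (\<theta> u)"
    using meet_groupoid_prod_idem_iff p by (simp add: pdefined_iff)
qed

lemma initial_of_emb_iff:
  assumes "g \<in> carrier G"
  shows "initial_of \<eta> (emb g) \<longleftrightarrow> (\<forall>p\<in>set (string_pairs \<eta>). act g (fst p) = snd p)"
proof -
  have "emb g i = \<eta> ! i \<longleftrightarrow> act g (fst (if even i then (i div 2, \<eta> ! i) else (\<eta> ! i, i div 2))) =
      snd (if even i then (i div 2, \<eta> ! i) else (\<eta> ! i, i div 2))" for i
  proof (cases "even i")
    case True
    then show ?thesis by (auto simp: emb_even elim!: evenE)
  next
    case False
    then obtain j where j: "i = Suc (2 * j)" by (auto elim!: oddE)
    have "act (inv g) j = \<eta> ! i \<longleftrightarrow> act g (\<eta> ! i) = j" using act_inv[OF assms] by metis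
    then show ?thesis using False by (simp add: j emb_odd)
  qed
  then show ?thesis
    unfolding initial_of_def all_set_conv_all_nth by (simp add: string_pairs_def nth_default_def)
qed

lemma Tree_of_C_iff: "\<eta> \<in> Tree_of C \<longleftrightarrow> (\<exists>g\<in>carrier G. initial_of \<eta> (emb g))"
  unfolding CS.Tree_of_iff_C cyl_def by (auto simp: C_def)

lemma meet_list:
  assumes "ds \<noteq> []" "set ds \<subseteq> mdom M"
  shows "meet_list M ds \<in> mdom M" "\<theta> (meet_list M ds) = (\<Inter>d\<in>set ds. \<theta> d)"
proof -
  have fold: "fold (\<lambda>y b. dmeet M y b) ds d \<in> mdom M \<and>
      \<theta> (fold (\<lambda>y b. dmeet M y b) ds d) = \<theta> d \<inter> (\<Inter>d\<in>set ds. \<theta> d)"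
    if "d \<in> mdom M" "set ds \<subseteq> mdom M" for d ds
    using that
  proof (induction ds arbitrary: d)
    case (Cons a ds)
    then show ?case using dmeet[of a d] Cons.IH[of "dmeet M a d"] by auto
  qed simp
  obtain d ds' where ds: "ds = d # ds'" using assms(1) by (cases ds) auto
  show "meet_list M ds \<in> mdom M" "\<theta> (meet_list M ds) = (\<Inter>d\<in>set ds. \<theta> d)"
    using fold[of d ds'] assms(2) by (simp_all add: ds meet_list_def hd_default_def)
qed

text \<open>Write D = d V with V the right group of D. Then d a^-1 and d b^-1 agree on x iff a b^-1
  is in the stabiliser x x^-1, that is, iff a and b lie in the same right coset of its intersection
  with V. So the values correspond to these cosets, which are finitely many.\<close>

lemma orbit_finite_card:
  assumes D: "nonempty M D" and x: "nonempty M x"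
    and I: "\<And>u v. u \<in> msubgroups M \<Longrightarrow> v \<in> msubgroups M \<Longrightarrow> I u v = subgroup_index G (\<theta> u) (\<theta> u \<inter> \<theta> v)"
  shows "finite ((\<lambda>g. act g x) ` \<theta> D)"
    "card ((\<lambda>g. act g x) ` \<theta> D) = dindex M I (pprod M (dinv M D) D) (quot M x x)"
proof -
  have D': "D \<in> mdom M" "coset (\<theta> D)" and x': "x \<in> mdom M" "coset (\<theta> x)"
    using D x by (auto simp: nonempty_iff)
  note Dc = cosetD(4)[OF D'(2)] and xc = cosetD(4)[OF x'(2)]
  define v where "v = pprod M (dinv M D) D"
  define u where "u = quot M x x"
  have p: "pdefined M (dinv M D) D"
    using D' dinv[OF D'(1)] coset_set_inv[OF D'(2)] right_group_set_inv[OF Dc] by (simp add: pdefined_iff)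
  have v: "v \<in> mdom M" "\<theta> v = right_group (\<theta> D)"
    using pprod[OF p] dinv[OF D'(1)] by (auto simp: v_def set_mult_def SET_INV_def right_group_def)
  have q: "qdefined M x x" using x by (simp add: nonempty_def)
  have u: "u \<in> mdom M" "\<theta> u = left_group (\<theta> x)"
    using quot[OF q] by (auto simp: u_def set_mult_def SET_INV_def left_group_def)
  define W where "W = \<theta> v \<inter> \<theta> u"
  have vg: "compact_open_subgroup G T (\<theta> v)" unfolding v(2) by (rule compact_open_right_group[OF D'(2)])
  have ug: "compact_open_subgroup G T (\<theta> u)" unfolding u(2) by (rule compact_open_left_group[OF x'(2)])
  have Wg: "compact_open_subgroup G T W" unfolding W_def by (rule compact_open_subgroup_Int[OF vg ug])
  have sub: "is_subgroup M v" "is_subgroup M u" using v(1) u(1) vg ug by (simp_all add: is_subgroup_iff)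
  then have "v \<in> msubgroups M" "u \<in> msubgroups M"
    by (auto simp: is_subgroup_def msubgroups_def pdefined_def pprod_def split: if_splits)
  then have idx: "dindex M I v u = card ((\<lambda>a. W #> a) ` \<theta> v)"
    using sub I by (simp add: dindex_def subgroup_index_eq W_def)
  obtain d where d: "d \<in> \<theta> D" using cosetD(3)[OF D'(2)] by blast
  have dc: "d \<in> carrier G" using d Dc by blast
  have vsub: "subgroup (\<theta> v) G" and Wsub: "subgroup W G"
    using vg Wg by (simp_all add: compact_open_subgroup_def)
  have vc: "\<theta> v \<subseteq> carrier G" by (rule subgroup.subset[OF vsub])
  \<comment> \<open>The inverse of a turns the left cosets, on which the action naturally depends,
    into the right cosets that \<open>subgroup_index\<close> counts.\<close>
  define f where "f a = act (d \<otimes> inv a) x" for a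
  have im: "(\<lambda>g. act g x) ` \<theta> D = f ` \<theta> v"
  proof (intro Set.set_eqI iffI)
    fix e assume "e \<in> (\<lambda>g. act g x) ` \<theta> D"
    then obtain g where g: "g \<in> \<theta> D" "e = act g x" by blast
    have gc: "g \<in> carrier G" using g Dc by blast
    have "inv d \<otimes> g \<in> \<theta> v" unfolding v(2) right_group_def using d g(1) by blast
    then have "inv (inv d \<otimes> g) \<in> \<theta> v" by (rule subgroup.m_inv_closed[OF vsub])
    moreover have "f (inv (inv d \<otimes> g)) = e" using g(2) gc dc by (simp add: f_def)
    ultimately show "e \<in> f ` \<theta> v" by blast
  next
    fix e assume "e \<in> f ` \<theta> v"
    then obtain a where a: "a \<in> \<theta> v" "e = f a" by blast
    have "inv a \<in> right_group (\<theta> D)" using subgroup.m_inv_closed[OF vsub a(1)] v(2) by simp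
    then have "d \<otimes> inv a \<in> \<theta> D" using mem_right_group[OF D'(2) d] by blast
    then show "e \<in> (\<lambda>g. act g x) ` \<theta> D" using a(2) by (simp add: f_def)
  qed
  have "f a = f b \<longleftrightarrow> W #> a = W #> b" if ab: "a \<in> \<theta> v" "b \<in> \<theta> v" for a b
  proof -
    have c: "a \<in> carrier G" "b \<in> carrier G" using ab vc by auto
    have "f a = f b \<longleftrightarrow> act (inv a) x = act (inv b) x"
      using act_inv[OF dc] c dc by (simp add: f_def act_mult) metis
    also have "\<dots> \<longleftrightarrow> act (a \<otimes> inv b) x = x"
      using act_inv[OF c(1)] c by (simp add: act_mult) metis
    also have "\<dots> \<longleftrightarrow> a \<otimes> inv b \<in> \<theta> u"
      using act_nonempty_iff[OF _ x, of "a \<otimes> inv b" x] q c by (simp add: u_def)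
    also have "\<dots> \<longleftrightarrow> a \<otimes> inv b \<in> W"
      using ab subgroup.m_closed[OF vsub] subgroup.m_inv_closed[OF vsub] by (simp add: W_def)
    also have "\<dots> \<longleftrightarrow> a \<in> W #> b"
      using mem_r_coset[OF subgroup.subset[OF Wsub] c(2)] c by simp
    also have "\<dots> \<longleftrightarrow> W #> a = W #> b"
      using repr_independence[OF _ c(2) Wsub] rcos_self[OF c(1) Wsub] by blast
    finally show ?thesis .
  qed
  then obtain h where h: "bij_betw h ((\<lambda>a. W #> a) ` \<theta> v) (f ` \<theta> v)"
    using bij_betw_image_quotients[of "\<theta> v" f "\<lambda>a. W #> a"] by blast
  show "finite ((\<lambda>g. act g x) ` \<theta> D)"
    using finite_right_cosets[OF vg Wg] bij_betw_finite[OF h] im by simp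
  show "card ((\<lambda>g. act g x) ` \<theta> D) = dindex M I (pprod M (dinv M D) D) (quot M x x)"
    using bij_betw_same_card[OF h] im idx unfolding v_def u_def by simp
qed

text \<open>The elements that move x to e form the coset e x^-1, so the question is whether this
  coset meets D.\<close>

lemma mem_orbit_iff:
  assumes D: "nonempty M D" and x: "nonempty M x"
  shows "e \<in> (\<lambda>g. act g x) ` \<theta> D \<longleftrightarrow> qdefined M e x \<and> nonempty M (dmeet M (quot M e x) D)"
proof -
  have D': "D \<in> mdom M" "\<theta> D \<subseteq> carrier G" using D cosetD(4) by (auto simp: nonempty_iff)
  have "e \<in> (\<lambda>g. act g x) ` \<theta> D \<longleftrightarrow> (\<exists>g\<in>\<theta> D. qdefined M e x \<and> g \<in> \<theta> (quot M e x))"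
    using act_nonempty_iff[OF _ x] D'(2) by (auto simp: image_iff) (metis subsetD)+
  also have "\<dots> \<longleftrightarrow> qdefined M e x \<and> nonempty M (dmeet M (quot M e x) D)"
  proof (cases "qdefined M e x")
    case True
    note m = dmeet[OF quot(1)[OF True] D'(1)]
    show ?thesis unfolding nonempty_iff'[OF m(1)] m(2) using True by blast
  qed simp
  finally show ?thesis .
qed

text \<open>A list of distinct elements of a finite set exhausts the set as soon as it has the right
  length.\<close>

lemma orbit_list_iff:
  assumes D: "nonempty M D" and x: "nonempty M x"
    and I: "\<And>u v. u \<in> msubgroups M \<Longrightarrow> v \<in> msubgroups M \<Longrightarrow> I u v = subgroup_index G (\<theta> u) (\<theta> u \<inter> \<theta> v)"
  shows "orbit_list M I D x l \<longleftrightarrow> distinct l \<and> set l = (\<lambda>g. act g x) ` \<theta> D"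
proof -
  have fin: "finite ((\<lambda>g. act g x) ` \<theta> D)"
    by (rule orbit_finite_card(1)[OF D x I])
  have card: "dindex M I (pprod M (dinv M D) D) (quot M x x) = card ((\<lambda>g. act g x) ` \<theta> D)"
    by (rule orbit_finite_card(2)[OF D x I, symmetric])
  have "orbit_list M I D x l \<longleftrightarrow> distinct l \<and> length l = card ((\<lambda>g. act g x) ` \<theta> D) \<and> set l \<subseteq> (\<lambda>g. act g x) ` \<theta> D"
    unfolding orbit_list_def card mem_orbit_iff[OF D x, symmetric] by blast
  also have "\<dots> \<longleftrightarrow> distinct l \<and> set l = (\<lambda>g. act g x) ` \<theta> D"
    using card_subset_eq[OF fin, of "set l"] distinct_card[of l] by (metis subset_refl)
  finally show ?thesis .
qed

end

section \<open>The tree of the image, given the hint\<close>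

locale hinted_copy = groupoid_copy +
  fixes es :: "nat list" and I :: "nat \<Rightarrow> nat \<Rightarrow> nat"
  assumes hint: "es = [] \<and> \<not> compact_space T \<or> (\<exists>u\<in>mdom M. es = [u] \<and> \<theta> u = carrier G)"
    and index: "\<And>u v. u \<in> msubgroups M \<Longrightarrow> v \<in> msubgroups M \<Longrightarrow> I u v = subgroup_index G (\<theta> u) (\<theta> u \<inter> \<theta> v)"
begin

lemma constraints_mdom:
  assumes "\<forall>p\<in>set (string_pairs \<eta>). pair_ok M p"
  shows "set (constraints M es \<eta>) \<subseteq> mdom M"
  using assms hint quot(1) by (auto simp: constraints_def pair_ok_def)

lemma mem_constraints_iff:
  assumes g: "g \<in> carrier G"
  shows "initial_of \<eta> (emb g) \<longleftrightarrow> (\<forall>p\<in>set (string_pairs \<eta>). pair_ok M p) \<and> (\<forall>d\<in>set (constraints M es \<eta>). g \<in> \<theta> d)"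
proof -
  have "act g (fst p) = snd p \<longleftrightarrow> pair_ok M p \<and> (nonempty M (fst p) \<longrightarrow> g \<in> \<theta> (quot M (snd p) (fst p)))" for p
    using act_nonempty_iff[OF g, of "fst p" "snd p"] act_trivial[OF g, of "fst p"] by (auto simp: pair_ok_def)
  moreover have "\<forall>d\<in>set es. g \<in> \<theta> d" using hint g by auto
  ultimately show ?thesis
    unfolding initial_of_emb_iff[OF g] by (auto simp: constraints_def)
qed

lemma solutions:
  assumes "\<forall>p\<in>set (string_pairs \<eta>). pair_ok M p" "constraints M es \<eta> \<noteq> []"
  shows "cyl C \<eta> = emb ` \<theta> (meet_list M (constraints M es \<eta>))"
    "meet_list M (constraints M es \<eta>) \<in> mdom M"
proof -
  note m = meet_list[OF assms(2) constraints_mdom[OF assms(1)]]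
  show "meet_list M (constraints M es \<eta>) \<in> mdom M" by (rule m(1))
  have "g \<in> \<theta> (meet_list M (constraints M es \<eta>)) \<longleftrightarrow> initial_of \<eta> (emb g)" if "g \<in> carrier G" for g
    using mem_constraints_iff[OF that] assms(1) unfolding m(2) by simp
  then show "cyl C \<eta> = emb ` \<theta> (meet_list M (constraints M es \<eta>))"
    using theta_carrier[OF m(1)] by (auto simp: cyl_def C_def)
qed

text \<open>Without constraints the identity element satisfies the string. With constraints the
  solutions are the meet of the corresponding cosets, and the string is in the tree iff this meet is
  not empty.\<close>

lemma in_tree_iff: "in_tree M es \<eta> \<longleftrightarrow> \<eta> \<in> Tree_of C"
proof (cases "\<forall>p\<in>set (string_pairs \<eta>). pair_ok M p")
  case ok: True
  show ?thesis
  proof (cases "constraints M es \<eta> = []")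
    case True
    have "initial_of \<eta> (emb \<one>)" using mem_constraints_iff[of \<one>] ok True by simp
    then have "\<eta> \<in> Tree_of C" by (auto simp: Tree_of_C_iff)
    then show ?thesis using ok True by (simp add: in_tree_def)
  next
    case False
    show ?thesis
      unfolding CS.Tree_of_iff_C solutions(1)[OF ok False] in_tree_def
      using ok False nonempty_iff'[OF solutions(2)[OF ok False]] by simp
  qed
next
  case False
  then have "\<not> initial_of \<eta> (emb g)" if "g \<in> carrier G" for g using mem_constraints_iff[OF that] by blast
  then have "\<eta> \<notin> Tree_of C" by (auto simp: Tree_of_C_iff)
  then show ?thesis using False by (auto simp: in_tree_def)
qed

text \<open>With a constraint the cylinder is the image of a compact coset. Without one the hint is
  empty, so the group is not compact, and the cylinder is the whole image, which is not compact
  either.\<close>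

lemma bounded_string_iff: "bounded_string M es \<eta> \<longleftrightarrow> \<eta> \<in> Tree_of C \<and> compact (cyl C \<eta>)"
proof (cases "in_tree M es \<eta>")
  case True
  then have ok: "\<forall>p\<in>set (string_pairs \<eta>). pair_ok M p" by (simp add: in_tree_def)
  have "constraints M es \<eta> \<noteq> [] \<longleftrightarrow> compact (cyl C \<eta>)"
  proof
    assume ne: "constraints M es \<eta> \<noteq> []"
    note s = solutions[OF ok ne]
    have "compactin T (\<theta> (meet_list M (constraints M es \<eta>)))"
      using theta_cases[OF s(2)] cosetD(1) by auto
    then show "compact (cyl C \<eta>)"
      unfolding s(1) using image_compactin[OF _ continuous_emb] by simp
  next
    assume c: "compact (cyl C \<eta>)"
    show "constraints M es \<eta> \<noteq> []"
    proof
      assume emp: "constraints M es \<eta> = []"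
      then have "initial_of \<eta> (emb g)" if "g \<in> carrier G" for g
        using mem_constraints_iff[OF that] ok by simp
      then have "cyl C \<eta> = C" by (auto simp: cyl_def C_def)
      then have "compact_space (top_of_set C)" using c by (simp add: compact_space_subtopology)
      then have "compact_space T"
        using emb_homeo homeomorphic_map_imp_homeomorphic_space homeomorphic_compact_space by blast
      then show False using emp hint by (auto simp: constraints_def)
    qed
  qed
  then show ?thesis using True in_tree_iff by (simp add: bounded_string_def)
qed (auto simp: bounded_string_def in_tree_iff)

lemma bounding_coset:
  assumes "bounded_string M es \<eta>"
  shows "nonempty M (bounding_coset M es \<eta> i)"
    "\<theta> (bounding_coset M es \<eta> i) = (if even i then {g \<in> carrier G. initial_of \<eta> (emb g)} else {g \<in> carrier G. initial_of \<eta> (emb (inv g))})"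
proof -
  have ok: "\<forall>p\<in>set (string_pairs \<eta>). pair_ok M p" and ne: "constraints M es \<eta> \<noteq> []"
    using assms by (auto simp: bounded_string_def in_tree_def)
  define D where "D = meet_list M (constraints M es \<eta>)"
  note m = meet_list[OF ne constraints_mdom[OF ok], folded D_def]
  have D: "nonempty M D" using assms by (simp add: bounded_string_def in_tree_def D_def)
  have mem: "g \<in> \<theta> D \<longleftrightarrow> initial_of \<eta> (emb g)" if "g \<in> carrier G" for g
    using mem_constraints_iff[OF that] ok unfolding m(2) by simp
  have Dc: "\<theta> D \<subseteq> carrier G" by (rule theta_carrier[OF m(1)])
  have "nonempty M (dinv M D)"
    using D dinv[OF m(1)] coset_set_inv by (auto simp: nonempty_iff)
  then show "nonempty M (bounding_coset M es \<eta> i)" using D by (simp add: bounding_coset_def D_def)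
  have 1: "\<theta> D = {g \<in> carrier G. initial_of \<eta> (emb g)}" using mem Dc by blast
  have 2: "\<theta> (dinv M D) = {g \<in> carrier G. initial_of \<eta> (emb (inv g))}"
    unfolding dinv(2)[OF m(1)] set_inv_eq[OF Dc] using mem by auto
  show "\<theta> (bounding_coset M es \<eta> i) = (if even i then {g \<in> carrier G. initial_of \<eta> (emb g)} else {g \<in> carrier G. initial_of \<eta> (emb (inv g))})"
    using 1 2 by (simp add: bounding_coset_def D_def)
qed

lemma orbit_list_exists:
  "\<exists>m. bounded_string M es \<eta> \<and> nonempty M (i div 2) \<longrightarrow>
     orbit_list M I (bounding_coset M es \<eta> i) (i div 2) (list_decode m)"
proof (cases "bounded_string M es \<eta> \<and> nonempty M (i div 2)")
  case True
  then have D: "nonempty M (bounding_coset M es \<eta> i)" and x: "nonempty M (i div 2)"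
    using bounding_coset(1) by auto
  obtain l where "set l = (\<lambda>g. act g (i div 2)) ` \<theta> (bounding_coset M es \<eta> i)" "distinct l"
    using finite_distinct_list[OF orbit_finite_card(1)[OF D x index]] by blast
  then have "orbit_list M I (bounding_coset M es \<eta> i) (i div 2) (list_decode (list_encode l))"
    using orbit_list_iff[OF D x index] by simp
  then show ?thesis by blast
qed auto

text \<open>The entry of \<open>\<rho>\<close> is a value of the action of an element that satisfies
  \<open>\<eta>\<close>, or of its inverse. The list found by the search contains all such values,
  and its sum bounds each of them.\<close>

lemma string_bound:
  assumes c: "compact (cyl C \<eta>)" and \<rho>: "\<rho> \<in> Tree_of C" "prefix \<eta> \<rho>" "i < length \<rho>"
  shows "\<rho> ! i \<le> string_bound M I es \<eta> i"
proof -
  obtain g where g: "g \<in> carrier G" "initial_of \<rho> (emb g)"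
    using \<rho>(1) by (auto simp: Tree_of_C_iff)
  have \<eta>1: "initial_of \<eta> (emb g)"
    using CS.cyl_mono[OF \<rho>(2)] g by (auto simp: cyl_def C_def)
  then have \<eta>: "initial_of \<eta> (emb g)" "\<eta> \<in> Tree_of C"
    using g(1) unfolding Tree_of_C_iff by blast+
  then have b: "bounded_string M es \<eta>" using c by (simp add: bounded_string_iff)
  define k where "k = (if even i then g else inv g)"
  have k: "k \<in> carrier G" "k \<in> \<theta> (bounding_coset M es \<eta> i)"
    using g(1) \<eta>(1) by (simp_all add: k_def bounding_coset(2)[OF b])
  have val: "\<rho> ! i = act k (i div 2)"
  proof -
    have "\<rho> ! i = emb g i" using g(2) \<rho>(3) by (simp add: initial_of_def)
    then show ?thesis by (cases "even i") (auto simp: k_def emb_even emb_odd elim!: evenE oddE)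
  qed
  show ?thesis
  proof (cases "nonempty M (i div 2)")
    case x: True
    define m where "m = (LEAST m. bounded_string M es \<eta> \<and> nonempty M (i div 2) \<longrightarrow>
       orbit_list M I (bounding_coset M es \<eta> i) (i div 2) (list_decode m))"
    have "orbit_list M I (bounding_coset M es \<eta> i) (i div 2) (list_decode m)"
      using LeastI_ex[OF orbit_list_exists[of \<eta> i]] b x by (simp add: m_def)
    then have "set (list_decode m) = (\<lambda>g. act g (i div 2)) ` \<theta> (bounding_coset M es \<eta> i)"
      using orbit_list_iff[OF bounding_coset(1)[OF b] x index] by blast
    then have "\<rho> ! i \<in> set (list_decode m)" using k(2) val by simp
    then have "\<rho> ! i \<le> sum_list (list_decode m)" by (rule member_le_sum_list) simp_all
    then show ?thesis using x by (simp add: string_bound_def m_def)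
  next
    case False
    then show ?thesis using val act_trivial[OF k(1) False] by (simp add: string_bound_def)
  qed
qed

end


section \<open>From meet groupoids to closed subgroups\<close>

text \<open>No group appears in the context: the programs rely only on the answers of the oracles
  and, in the last clause, on the termination of the search for the values. Oracles 0 to 5 are the
  six data of the copy, oracle 6 supplies the hint.\<close>

definition copy_family :: "(meet_structure \<times> (nat \<Rightarrow> nat \<Rightarrow> nat) \<times> nat list) family" where
  "copy_family = {((M, I, es), w) | M I es w.
     (\<forall>x. w 0 x = Some (of_bool (x \<in> mdom M))) \<and>
     (\<forall>x. x \<in> mdom M \<longrightarrow> w 1 x = Some (minv M x)) \<and>
     (\<forall>x y. x \<in> mdom M \<and> y \<in> mdom M \<longrightarrow> w 2 (prod_encode (x, y)) = Some (mmeet M x y)) \<and>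
     (\<forall>x y. w 3 (prod_encode (x, y)) = Some (of_bool (pdefined M x y))) \<and>
     (\<forall>x y. pdefined M x y \<longrightarrow> w 4 (prod_encode (x, y)) = mprod M x y) \<and>
     (\<forall>u v. is_subgroup M u \<and> is_subgroup M v \<longrightarrow> w 5 (prod_encode (u, v)) = Some (I u v)) \<and>
     (\<forall>x. w 6 x = Some (list_encode es)) \<and>
     (\<forall>\<eta> i. \<exists>m. bounded_string M es \<eta> \<and> nonempty M (i div 2) \<longrightarrow>
        orbit_list M I (bounding_coset M es \<eta> i) (i div 2) (list_decode m))}"

lemma copy_family_iff:
  "((M, I, es), w) \<in> copy_family \<longleftrightarrow>
     (\<forall>x. w 0 x = Some (of_bool (x \<in> mdom M))) \<and>
     (\<forall>x. x \<in> mdom M \<longrightarrow> w 1 x = Some (minv M x)) \<and>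
     (\<forall>x y. x \<in> mdom M \<and> y \<in> mdom M \<longrightarrow> w 2 (prod_encode (x, y)) = Some (mmeet M x y)) \<and>
     (\<forall>x y. w 3 (prod_encode (x, y)) = Some (of_bool (pdefined M x y))) \<and>
     (\<forall>x y. pdefined M x y \<longrightarrow> w 4 (prod_encode (x, y)) = mprod M x y) \<and>
     (\<forall>u v. is_subgroup M u \<and> is_subgroup M v \<longrightarrow> w 5 (prod_encode (u, v)) = Some (I u v)) \<and>
     (\<forall>x. w 6 x = Some (list_encode es)) \<and>
     (\<forall>\<eta> i. \<exists>m. bounded_string M es \<eta> \<and> nonempty M (i div 2) \<longrightarrow>
        orbit_list M I (bounding_coset M es \<eta> i) (i div 2) (list_decode m))"
  by (simp add: copy_family_def)

section \<open>Computability of the tree, uniformly in the copy\<close>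

named_theorems copy_intros

lemma computable_mdom [copy_intros]:
  assumes "computable copy_family f"
  shows "computable copy_family (\<lambda>c x. f c x \<in> mdom (fst c))"
proof -
  have "computable copy_family (\<lambda>c x. if True then f c x \<in> mdom (fst c) else False)"
    by (rule computable_oracle[where i=0, OF computable_const assms]) (auto simp: copy_family_def)
  then show ?thesis by simp
qed

lemma computable_dinv [copy_intros]:
  assumes "computable copy_family f"
  shows "computable copy_family (\<lambda>c x. dinv (fst c) (f c x))"
proof -
  have "computable copy_family (\<lambda>c x. if f c x \<in> mdom (fst c) then minv (fst c) (f c x) else 0)"
    by (rule computable_oracle[where i=1, OF computable_mdom[OF assms] assms]) (auto simp: copy_family_def)
  then show ?thesis by (simp add: dinv_def)
qed

lemma computable_dmeet [copy_intros]:
  assumes "computable copy_family f" "computable copy_family g"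
  shows "computable copy_family (\<lambda>c x. dmeet (fst c) (f c x) (g c x))"
proof -
  have "computable copy_family (\<lambda>c x. if f c x \<in> mdom (fst c) \<and> g c x \<in> mdom (fst c)
      then mmeet (fst c) (f c x) (g c x) else 0)"
    by (rule computable_oracle[where i=2, OF
          computable_conj[OF computable_mdom[OF assms(1)] computable_mdom[OF assms(2)]] computable_Pair[OF assms]])
      (auto simp: copy_family_def enc_Pair)
  then show ?thesis by (simp add: dmeet_def)
qed

lemma computable_pdefined [copy_intros]:
  assumes "computable copy_family f" "computable copy_family g"
  shows "computable copy_family (\<lambda>c x. pdefined (fst c) (f c x) (g c x))"
proof -
  have "computable copy_family (\<lambda>c x. if True then pdefined (fst c) (f c x) (g c x) else False)"
    by (rule computable_oracle[where i=3, OF computable_const computable_Pair[OF assms]])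
      (auto simp: copy_family_def enc_Pair)
  then show ?thesis by simp
qed

lemma computable_pprod [copy_intros]:
  assumes "computable copy_family f" "computable copy_family g"
  shows "computable copy_family (\<lambda>c x. pprod (fst c) (f c x) (g c x))"
proof -
  have "computable copy_family (\<lambda>c x. if pdefined (fst c) (f c x) (g c x)
      then the (mprod (fst c) (f c x) (g c x)) else 0)"
    by (rule computable_oracle[where i=4, OF computable_pdefined[OF assms] computable_Pair[OF assms]])
      (auto simp: copy_family_def enc_Pair pdefined_def)
  then show ?thesis by (simp add: pprod_def)
qed

lemma computable_is_subgroup [copy_intros]:
  assumes "computable copy_family f"
  shows "computable copy_family (\<lambda>c x. is_subgroup (fst c) (f c x))"
  unfolding is_subgroup_def by (intro computable_intros copy_intros assms)

lemma computable_dindex [copy_intros]: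
  assumes "computable copy_family f" "computable copy_family g"
  shows "computable copy_family (\<lambda>c x. dindex (fst c) (fst (snd c)) (f c x) (g c x))"
proof -
  have "computable copy_family (\<lambda>c x. if is_subgroup (fst c) (f c x) \<and> is_subgroup (fst c) (g c x)
      then fst (snd c) (f c x) (g c x) else 0)"
    by (rule computable_oracle[where i=5, OF
          computable_conj[OF computable_is_subgroup[OF assms(1)] computable_is_subgroup[OF assms(2)]]
          computable_Pair[OF assms]])
      (auto simp: copy_family_def enc_Pair)
  then show ?thesis by (simp add: dindex_def)
qed

lemma computable_hint [copy_intros]: "computable copy_family (\<lambda>c x. snd (snd c))"
proof -
  have "computable copy_family (\<lambda>c x. if True then snd (snd c) else [])"
    by (rule computable_oracle[where i=6, OF computable_const computable_id]) (auto simp: copy_family_def)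
  then show ?thesis by simp
qed

lemma computable_qdefined [copy_intros]:
  assumes "computable copy_family f" "computable copy_family g"
  shows "computable copy_family (\<lambda>c x. qdefined (fst c) (f c x) (g c x))"
  unfolding qdefined_def by (intro computable_intros copy_intros assms)

lemma computable_quot [copy_intros]:
  assumes "computable copy_family f" "computable copy_family g"
  shows "computable copy_family (\<lambda>c x. quot (fst c) (f c x) (g c x))"
  unfolding quot_def by (intro computable_intros copy_intros assms)

lemma computable_nonempty [copy_intros]:
  assumes "computable copy_family f"
  shows "computable copy_family (\<lambda>c x. nonempty (fst c) (f c x))"
  unfolding nonempty_def by (intro computable_intros copy_intros assms)

lemma computable_string_pairs [computable_intros]:
  assumes "computable F f" shows "computable F (\<lambda>c x. string_pairs (f c x))"
  unfolding string_pairs_def by (intro computable_intros assms computable_comp[OF assms])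

lemma computable_pair_ok [copy_intros]:
  assumes "computable copy_family f"
  shows "computable copy_family (\<lambda>c x. pair_ok (fst c) (f c x))"
  unfolding pair_ok_def by (intro computable_intros copy_intros assms)

lemma computable_constraints [copy_intros]:
  assumes "computable copy_family f"
  shows "computable copy_family (\<lambda>c x. constraints (fst c) (snd (snd c)) (f c x))"
  unfolding constraints_def by (intro computable_intros copy_intros assms)

lemma computable_meet_list [copy_intros]:
  assumes "computable copy_family f"
  shows "computable copy_family (\<lambda>c x. meet_list (fst c) (f c x))"
  unfolding meet_list_def by (intro computable_intros copy_intros computable_hd_default assms)

lemma computable_in_tree [copy_intros]:
  assumes "computable copy_family f"
  shows "computable copy_family (\<lambda>c x. in_tree (fst c) (snd (snd c)) (f c x))"
  unfolding in_tree_def by (intro computable_intros copy_intros assms)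

lemma computable_bounded_string [copy_intros]:
  assumes "computable copy_family f"
  shows "computable copy_family (\<lambda>c x. bounded_string (fst c) (snd (snd c)) (f c x))"
  unfolding bounded_string_def by (intro computable_intros copy_intros assms)

lemma computable_orbit_list [copy_intros]:
  assumes "computable copy_family f" "computable copy_family g" "computable copy_family h"
  shows "computable copy_family (\<lambda>c x. orbit_list (fst c) (fst (snd c)) (f c x) (g c x) (h c x))"
  unfolding orbit_list_def
  by (intro computable_intros copy_intros assms computable_comp[OF assms(1)] computable_comp[OF assms(2)])

lemma computable_bounding_coset [copy_intros]:
  assumes "computable copy_family f" "computable copy_family g"
  shows "computable copy_family (\<lambda>c x. bounding_coset (fst c) (snd (snd c)) (f c x) (g c x))"
  unfolding bounding_coset_def by (intro computable_intros copy_intros assms)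

lemma computable_string_bound:
  "computable copy_family (\<lambda>c z. string_bound (fst c) (fst (snd c)) (snd (snd c)) (fst z) (snd z))"
  unfolding string_bound_def
  by (intro computable_intros copy_intros) (auto simp: copy_family_def)

text \<open>A presentation lists six indices, so the appended constant program becomes oracle 6 and
  answers every input with the hint.\<close>

definition hinted_indices :: "nat \<Rightarrow> nat \<Rightarrow> nat \<Rightarrow> nat" where
  "hinted_indices q n i = nth_default 0 (list_decode q @ [const_index n]) i"

lemma computable_hinted_indices [computable_intros]:
  assumes "computable F f" "computable F g" "computable F h"
  shows "computable F (\<lambda>c x. hinted_indices (f c x) (g c x) (h c x))"
  unfolding hinted_indices_def by (intro computable_intros assms)

lemma copy_family_presentation:
  assumes hc: "hinted_copy G T M \<theta> es (\<lambda>u v. subgroup_index G (\<theta> u) (\<theta> u \<inter> \<theta> v))"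
    and q: "q = list_encode [d, i, m, r, p, h]" and data: "Haar_computable_data G M \<theta> (d, i, m, r, p, h)"
  shows "((M, \<lambda>u v. subgroup_index G (\<theta> u) (\<theta> u \<inter> \<theta> v), es),
    \<lambda>j. phi (hinted_indices q (list_encode es) j)) \<in> copy_family"
proof -
  interpret hinted_copy G T M \<theta> es "\<lambda>u v. subgroup_index G (\<theta> u) (\<theta> u \<inter> \<theta> v)" by (rule hc)
  have ix: "hinted_indices q (list_encode es) 0 = d" "hinted_indices q (list_encode es) (Suc 0) = i"
    "hinted_indices q (list_encode es) 2 = m" "hinted_indices q (list_encode es) 3 = r"
    "hinted_indices q (list_encode es) 4 = p" "hinted_indices q (list_encode es) 5 = h"
    "hinted_indices q (list_encode es) 6 = const_index (list_encode es)"
    by (simp_all add: q hinted_indices_def nth_default_def nth_append)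
  have dec: "prod_encode (x, y) \<in> prod_encode ` A \<longleftrightarrow> (x, y) \<in> A" for x y A by auto
  have data': "decides d (mdom M)"
    "\<And>x. phi i x = (if x \<in> mdom M then Some (minv M x) else None)"
    "\<And>x y. phi m (prod_encode (x, y)) = (if x \<in> mdom M \<and> y \<in> mdom M then Some (mmeet M x y) else None)"
    "decides r (prod_encode ` {(x, y). x \<in> mdom M \<and> y \<in> mdom M \<and> mprod M x y \<noteq> None})"
    "\<And>x y. phi p (prod_encode (x, y)) = (if x \<in> mdom M \<and> y \<in> mdom M then mprod M x y else None)"
    "\<And>u v. phi h (prod_encode (u, v)) = (if u \<in> msubgroups M \<and> v \<in> msubgroups M
       then Some (subgroup_index G (\<theta> u) (\<theta> u \<inter> \<theta> v)) else None)"
    using data unfolding Haar_computable_data_def prod.case computes2_def by blast+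
  have sub: "u \<in> msubgroups M" if "is_subgroup M u" for u
    using that by (auto simp: is_subgroup_def msubgroups_def pdefined_def pprod_def split: if_splits)
  have r: "phi r (prod_encode (x, y)) = Some (of_bool (pdefined M x y))" for x y
    using data'(4) unfolding decides_def pdefined_def by (simp only: dec mem_Collect_eq prod.case)
  have "\<forall>\<eta> i. \<exists>m. bounded_string M es \<eta> \<and> nonempty M (i div 2) \<longrightarrow>
      orbit_list M (\<lambda>u v. subgroup_index G (\<theta> u) (\<theta> u \<inter> \<theta> v)) (bounding_coset M es \<eta> i) (i div 2) (list_decode m)"
    using orbit_list_exists by blast
  then show ?thesis
    using data'(1-3,5,6) sub unfolding copy_family_iff
    by (intro conjI) (assumption | simp add: ix r phi_const_index decides_def pdefined_def)+
qed

text \<open>The hint is passed as a number, so that one construction yields both algorithms: the one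
  for noncompact groups fixes the empty hint, the other takes the name of the whole group as an
  additional input.\<close>

lemma closed_subgroup_algorithm:
  obtains f where "computable no_oracle (\<lambda>c z. f (fst z) (snd z))"
    "\<And>(G :: ('g, 'm) monoid_scheme) T M \<theta> q es. tdlc_group G T \<Longrightarrow> meet_groupoid_presentation_via G T M \<theta> q \<Longrightarrow>
       es = [] \<and> \<not> compact_space T \<or> (\<exists>u\<in>mdom M. es = [u] \<and> \<theta> u = carrier G) \<Longrightarrow>
       closed_subgroup_presentation G T (f q (list_encode es))"
proof -
  have "computable copy_family (\<lambda>c \<eta>. in_tree (fst c) (snd (snd c)) \<eta>)"
    by (intro copy_intros computable_intros)
  then obtain s where s: "\<And>c w \<eta>. (c, w) \<in> copy_family \<Longrightarrow>
      orun w s (enc \<eta>) = Some (enc (in_tree (fst c) (snd (snd c)) \<eta>))"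
    by (rule computableE) blast
  have "computable copy_family (\<lambda>c \<eta>. bounded_string (fst c) (snd (snd c)) \<eta>)"
    by (intro copy_intros computable_intros)
  then obtain k where k: "\<And>c w \<eta>. (c, w) \<in> copy_family \<Longrightarrow>
      orun w k (enc \<eta>) = Some (enc (bounded_string (fst c) (snd (snd c)) \<eta>))"
    by (rule computableE) blast
  obtain h where h: "\<And>c w z. (c, w) \<in> copy_family \<Longrightarrow>
      orun w h (enc z) = Some (enc (string_bound (fst c) (fst (snd c)) (snd (snd c)) (fst z) (snd z)))"
    using computable_string_bound by (rule computableE) blast
  define f where "f q n = list_encode (map (\<lambda>t. instance_index (hinted_indices q n) t) [s, k, h])" for q n
  have "computable no_oracle (\<lambda>c z. f (fst z) (snd z))"
    unfolding f_def list.map by (intro computable_intros)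
  moreover have "closed_subgroup_presentation G T (f q (list_encode es))"
    if G: "tdlc_group G T" and via: "meet_groupoid_presentation_via G T M \<theta> q"
      and hint: "es = [] \<and> \<not> compact_space T \<or> (\<exists>u\<in>mdom M. es = [u] \<and> \<theta> u = carrier G)"
    for G :: "('g, 'm) monoid_scheme" and T M \<theta> q es
  proof -
    let ?I = "\<lambda>u v. subgroup_index G (\<theta> u) (\<theta> u \<inter> \<theta> v)"
    obtain d i m r p hh where q: "q = list_encode [d, i, m, r, p, hh]"
      and data: "Haar_computable_data G M \<theta> (d, i, m, r, p, hh)" and iso: "meet_groupoid_iso G T M \<theta>"
      using via by (auto simp: meet_groupoid_presentation_via_def)
    have "top_group G T" using G by (simp add: top_group_iff tdlc_group_def)
    then interpret hinted_copy G T M \<theta> es ?I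
      using G hint iso by (simp add: hinted_copy_def hinted_copy_axioms_def groupoid_copy_def
          groupoid_copy_axioms_def tdlc_def tdlc_axioms_def tdlc_group_def)
    define e where "e = hinted_indices q (list_encode es)"
    have F: "((M, ?I, es), \<lambda>j. phi (e j)) \<in> copy_family"
      unfolding e_def by (rule copy_family_presentation[OF _ q data]) unfold_locales
    have run: "phi (instance_index e t) = orun (\<lambda>j. phi (e j)) t" for t
      by (rule phi_instance_index)
    have mem: "x \<in> list_encode ` A \<longleftrightarrow> list_decode x \<in> A" for x A
      by (metis image_iff list_decode_inverse list_encode_inverse)
    \<comment> \<open>Every number codes a string, so correctness on codes of strings covers all
      inputs, as \<open>decides\<close> demands.\<close>
    have at: "phi (instance_index e t) x = orun (\<lambda>j. phi (e j)) t (enc (list_decode x))" for t x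
      by (simp add: run)
    have "clc_tree_data (Tree_of C) (instance_index e s, instance_index e k, instance_index e h)"
      unfolding clc_tree_data_def prod.case CS.paths_through_eq CS.paths_Tree_of
    proof (intro conjI)
      show "is_tree (Tree_of C)" "leafless (Tree_of C)"
        by (rule CS.is_tree_Tree_of CS.leafless_Tree_of)+
      show "decides (instance_index e s) (list_encode ` Tree_of C)"
        unfolding decides_def at s[OF F] mem by (simp add: in_tree_iff)
      show "locally_compact_space (top_of_set C)"
        using locally_compact emb_homeo homeomorphic_map_imp_homeomorphic_space
          homeomorphic_locally_compact_space by blast
      show "decides (instance_index e k) (list_encode ` {\<sigma> \<in> Tree_of C. compact (cyl C \<sigma>)})"
        unfolding decides_def at k[OF F] mem by (simp add: bounded_string_iff)
      show "\<exists>H. (\<forall>\<sigma> i. phi (instance_index e h) (prod_encode (list_encode \<sigma>, i)) = Some (H \<sigma> i)) \<and>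
        (\<forall>\<sigma> \<rho>. compact (cyl C \<sigma>) \<and> \<rho> \<in> Tree_of C \<and> prefix \<sigma> \<rho> \<longrightarrow> (\<forall>i<length \<rho>. \<rho> ! i \<le> H \<sigma> i))"
      proof (intro exI conjI allI impI)
        show "phi (instance_index e h) (prod_encode (list_encode \<sigma>, i)) = Some (string_bound M ?I es \<sigma> i)" for \<sigma> i
          using h[OF F, of "(\<sigma>, i)"] by (simp add: run enc_Pair)
        show "\<rho> ! i \<le> string_bound M ?I es \<sigma> i"
          if "compact (cyl C \<sigma>) \<and> \<rho> \<in> Tree_of C \<and> prefix \<sigma> \<rho>" "i < length \<rho>" for \<sigma> \<rho> i
          using string_bound that by blast
      qed
    qed
    then show ?thesis
      unfolding closed_subgroup_presentation_def f_def e_def[symmetric] list.map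
      using CS.closed_subgroup iso_C by blast
  qed
  ultimately show ?thesis by (rule that)
qed


section \<open>The equivalence\<close>

lemma uniform_translations_exist: "\<exists>a b c. uniform_translations TYPE('g) a b c"
proof -
  obtain a where a: "\<And>(G :: 'g monoid) T p. tdlc_group G T \<Longrightarrow> closed_subgroup_presentation G T p \<Longrightarrow>
     (\<exists>q. phi a p = Some q \<and> meet_groupoid_presentation G T q)"
    using meet_groupoid_algorithm by blast
  obtain f where f: "computable no_oracle (\<lambda>c z. f (fst z) (snd z))"
    and pres: "\<And>(G :: 'g monoid) T M \<theta> q es. tdlc_group G T \<Longrightarrow> meet_groupoid_presentation_via G T M \<theta> q \<Longrightarrow>
       es = [] \<and> \<not> compact_space T \<or> (\<exists>u\<in>mdom M. es = [u] \<and> \<theta> u = carrier G) \<Longrightarrow>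
       closed_subgroup_presentation G T (f q (list_encode es))"
    using closed_subgroup_algorithm by blast
  have "computable no_oracle (\<lambda>c q. f q (list_encode []))"
    by (intro computable_comp2[OF f] computable_intros)
  then obtain b where b: "\<And>q. phi b q = Some (f q (list_encode []))"
    using computable_no_oracle_phi by fastforce
  have "computable no_oracle (\<lambda>c z. f (fst (prod_decode z)) (list_encode [snd (prod_decode z)]))"
    by (intro computable_comp2[OF f] computable_intros)
  then obtain c where c: "\<And>z. phi c z = Some (f (fst (prod_decode z)) (list_encode [snd (prod_decode z)]))"
    using computable_no_oracle_phi by fastforce
  have "uniform_translations TYPE('g) a b c"
    unfolding uniform_translations_def
  proof (intro allI impI conjI)
    fix G :: "'g monoid" and T q
    assume "tdlc_group G T" "\<not> compact_space T \<and> meet_groupoid_presentation G T q"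
    then show "\<exists>p. phi b q = Some p \<and> closed_subgroup_presentation G T p"
      using pres[of G T _ _ q "[]"] b by (auto simp: meet_groupoid_presentation_def)
  next
    fix G :: "'g monoid" and T M \<theta> q u
    assume "tdlc_group G T" "meet_groupoid_presentation_via G T M \<theta> q \<and> u \<in> mdom M \<and> \<theta> u = carrier G"
    then show "\<exists>p. phi c (prod_encode (q, u)) = Some p \<and> closed_subgroup_presentation G T p"
      using pres[of G T M \<theta> q "[u]"] c by auto
  qed (use a in blast)
  then show ?thesis by blast
qed

lemma closed_subgroup_iff_presentation:
  "computably_tdlc_via_closed_subgroup G T \<longleftrightarrow> (\<exists>p. closed_subgroup_presentation G T p)"
  by (auto simp: computably_tdlc_via_closed_subgroup_def closed_subgroup_presentation_def clc_tree_def)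

lemma meet_groupoid_iff_presentation:
  "computably_tdlc_via_meet_groupoid G T \<longleftrightarrow> (\<exists>q. meet_groupoid_presentation G T q)"
  by (auto simp: computably_tdlc_via_meet_groupoid_def meet_groupoid_presentation_def
      meet_groupoid_presentation_via_def; blast)

text \<open>A compact group is a compact open subgroup of itself and so has a name in every copy.
  For the equivalence without uniformity it is enough that this name, the hint, exists.\<close>

lemma carrier_in_meet_groupoid:
  assumes "tdlc_group G T" "compact_space T" shows "carrier G \<in> meet_groupoid G T"
proof -
  interpret top_group G T using assms(1) by (simp add: top_group_iff tdlc_group_def)
  have "coset (carrier G)"
    using assms(2) openin_topspace[of T] by (auto simp: coset_def compact_space_def topspace_eq)
  then show ?thesis by (simp add: meet_groupoid_eq)
qed

theorem theorem5p1:
  "(\<forall>(G :: 'g monoid) T. tdlc_group G T \<longrightarrow>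
      (computably_tdlc_via_closed_subgroup G T \<longleftrightarrow> computably_tdlc_via_meet_groupoid G T)) \<and>
   equivalence_uniform TYPE('g)"
proof (intro conjI allI impI)
  fix G :: "'g monoid" and T assume G: "tdlc_group G T"
  obtain a b c where "uniform_translations TYPE('g) a b c" using uniform_translations_exist by blast
  then have
    a: "\<And>p. closed_subgroup_presentation G T p \<Longrightarrow> \<exists>q. meet_groupoid_presentation G T q" and
    b: "\<And>q. \<not> compact_space T \<Longrightarrow> meet_groupoid_presentation G T q \<Longrightarrow> \<exists>p. closed_subgroup_presentation G T p" and
    c: "\<And>M \<theta> q u. meet_groupoid_presentation_via G T M \<theta> q \<Longrightarrow> u \<in> mdom M \<Longrightarrow> \<theta> u = carrier G \<Longrightarrow>
      \<exists>p. closed_subgroup_presentation G T p"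
    using G unfolding uniform_translations_def by blast+
  have "\<exists>p. closed_subgroup_presentation G T p" if q: "meet_groupoid_presentation G T q" for q
  proof (cases "compact_space T")
    case True
    obtain M \<theta> where via: "meet_groupoid_presentation_via G T M \<theta> q"
      using q by (auto simp: meet_groupoid_presentation_def)
    then have "\<theta> ` mdom M = meet_groupoid G T"
      by (auto simp: meet_groupoid_presentation_via_def meet_groupoid_iso_def bij_betw_def)
    then obtain u where "u \<in> mdom M" "\<theta> u = carrier G"
      using carrier_in_meet_groupoid[OF G True] by (metis imageE)
    then show ?thesis using c[OF via] by blast
  qed (use b q in blast)
  then show "computably_tdlc_via_closed_subgroup G T \<longleftrightarrow> computably_tdlc_via_meet_groupoid G T"
    using a unfolding closed_subgroup_iff_presentation meet_groupoid_iff_presentation by blast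
next
  show "equivalence_uniform TYPE('g)"
    unfolding equivalence_uniform_def
    using uniform_translations_exist uniform_translations_transfer by blast
qed

end
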